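(* Fix integers $0\le k<m$, $n,q,r\ge1$. Let $\tau_z\subset TI^m$, $z\in I^q$, be a smooth family of hyperplane fields and $\sigma_z:I^m\to J^r(\mathbb R^m,\mathbb R^n)$ a smooth family of sections such that $\sigma_z=0$ on an open neighborhood of $\partial I^m$, $\sigma_z^\perp=0$ on $I^m$ with respect to $\tau_z$, and $\sigma_z=0$ on all of $I^m$ for $z$ in an open neighborhood of $\partial I^q$. Then for every $\varepsilon>0$ there exist a family of isotopies $F^z_t:I^m\to I^m$ and a family of holonomic sections $\hat\sigma_z$ such that: $\mathrm{dist}_{C^0}(\hat\sigma_z,\sigma_z)<\varepsilon$ on an open neighborhood of $F^z_1(I^k)$; $\|\hat\sigma^\perp_z\|_{C^0}<\varepsilon$ on $I^m$ (with respect to $\tau_z$); $\mathrm{dist}_{C^0}(F^z_t,\mathrm{id})<\varepsilon$; $F^z_t=\mathrm{id}$ and $\hat\sigma_z=0$ on an open neighborhood of $\partial I^m$; and $F^z_t=\mathrm{id}$ and $\hat\sigma_z=0$ on all of $I^m$ for $z$ in an open neighborhood of $\partial I^q$.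
   Context: $I=[-1,1]$, $I^k=I^k\times\{0\}^{m-k}\subset I^m$. $J^r(\mathbb R^m,\mathbb R^n)\cong\mathbb R^m\times(\mathcal P_r)^n$ via Taylor polynomials, with linear structure from $\mathbb R^n$; $0$ is the jet of the zero map. For a hyperplane field $\tau$, the $\perp$-component of $\sigma(x)=j^r(h)(x)$ consists of the $(r-1)$-jet of $h$ at $x$ and the derivatives $\partial_\nu\partial_\alpha h(x)$ with $|\alpha|=r-1$, $\nu\in\tau_x$; its norm is the sup of $|\partial_\nu\partial_\alpha h(x)|$ over $|\alpha|<r$, unit $\nu\in\tau_x$, and of the $(r-1)$-jet entries. Holonomic means of the form $j^r(h)$. *)

theory Defs
  imports "HOL-Analysis.Analysis"
begin

fun Ck_on :: "nat \<Rightarrow> 'a::real_normed_vector set \<Rightarrow> ('a \<Rightarrow> 'b::real_normed_vector) \<Rightarrow> bool" where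
  "Ck_on 0 U f \<longleftrightarrow> continuous_on U f"
| "Ck_on (Suc k) U f \<longleftrightarrow> (\<forall>x\<in>U. f differentiable (at x)) \<and>
      (\<forall>v. Ck_on k U (\<lambda>x. frechet_derivative f (at x) v))"

definition smooth_open :: "'a::real_normed_vector set \<Rightarrow> ('a \<Rightarrow> 'b::real_normed_vector) \<Rightarrow> bool" where
  "smooth_open U f \<longleftrightarrow> open U \<and> (\<forall>k. Ck_on k U f)"

definition smooth_on :: "'a::real_normed_vector set \<Rightarrow> ('a \<Rightarrow> 'b::real_normed_vector) \<Rightarrow> bool" where
  "smooth_on S f \<longleftrightarrow> (\<exists>U g. open U \<and> S \<subseteq> U \<and> smooth_open U g \<and> (\<forall>x\<in>S. g x = f x))"

definition cube :: "(real^'m) set" where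
  "cube = cbox (- One) One"

definition first_coords :: "nat \<Rightarrow> 'm::{finite,linorder} set" where
  "first_coords k = {i. card {j. j < i} < k}"

definition subcube :: "nat \<Rightarrow> (real^'m::{finite,linorder}) set" where
  "subcube k = {x \<in> cube. \<forall>i. i \<notin> first_coords k \<longrightarrow> x $ i = 0}"

type_synonym 'm mindex = "'m \<Rightarrow> nat"

definition mabs :: "'m::finite mindex \<Rightarrow> nat" where
  "mabs \<alpha> = (\<Sum>i\<in>UNIV. \<alpha> i)"

definition madd1 :: "'m mindex \<Rightarrow> 'm \<Rightarrow> 'm mindex" where
  "madd1 \<alpha> i = \<alpha>(i := Suc (\<alpha> i))"

fun Dlist :: "'m::finite list \<Rightarrow> (real^'m \<Rightarrow> 'b::real_normed_vector) \<Rightarrow> real^'m \<Rightarrow> 'b" where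
  "Dlist [] f = f"
| "Dlist (i # is) f = (\<lambda>x. frechet_derivative (Dlist is f) (at x) (axis i 1))"

definition mlist :: "'m::finite mindex \<Rightarrow> 'm list" where
  "mlist \<alpha> = (SOME xs. \<forall>i. count_list xs i = \<alpha> i)"

definition pderiv :: "'m::finite mindex \<Rightarrow> (real^'m \<Rightarrow> 'b::real_normed_vector) \<Rightarrow> real^'m \<Rightarrow> 'b" where
  "pderiv \<alpha> f = Dlist (mlist \<alpha>) f"

text \<open>An r-jet at a point (fibre of J^r(R^m,R^n)) is represented by its components
  sigma alpha (for |alpha| <= r), the alpha-th partial derivative of any representative.
  Components with |alpha| > r are ignored everywhere.\<close>
type_synonym ('m,'n) jet = "'m mindex \<Rightarrow> real^'n"

definition jet_zero :: "nat \<Rightarrow> ('m::finite,'n::finite) jet \<Rightarrow> bool" where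
  "jet_zero r s \<longleftrightarrow> (\<forall>\<alpha>. mabs \<alpha> \<le> r \<longrightarrow> s \<alpha> = 0)"

definition jet_close :: "nat \<Rightarrow> real \<Rightarrow> ('m::finite,'n::finite) jet \<Rightarrow> ('m,'n) jet \<Rightarrow> bool" where
  "jet_close r \<epsilon> s s' \<longleftrightarrow> (\<forall>\<alpha>. mabs \<alpha> \<le> r \<longrightarrow> norm (s \<alpha> - s' \<alpha>) < \<epsilon>)"

text \<open>partial_nu partial_alpha of a jet, nu a tangent vector, |alpha| < r.\<close>
definition jet_dir :: "('m::finite,'n::finite) jet \<Rightarrow> real^'m \<Rightarrow> 'm mindex \<Rightarrow> real^'n" where
  "jet_dir s \<nu> \<alpha> = (\<Sum>i\<in>UNIV. (\<nu> $ i) *\<^sub>R s (madd1 \<alpha> i))"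

definition perp_small :: "nat \<Rightarrow> real \<Rightarrow> (real^'m) set \<Rightarrow> ('m::finite,'n::finite) jet \<Rightarrow> bool" where
  "perp_small r \<epsilon> T s \<longleftrightarrow> (\<forall>\<alpha>. mabs \<alpha> < r \<longrightarrow>
      norm (s \<alpha>) < \<epsilon> \<and> (\<forall>\<nu>\<in>T. norm \<nu> = 1 \<longrightarrow> norm (jet_dir s \<nu> \<alpha>) < \<epsilon>))"

definition perp_zero :: "nat \<Rightarrow> (real^'m) set \<Rightarrow> ('m::finite,'n::finite) jet \<Rightarrow> bool" where
  "perp_zero r T s \<longleftrightarrow> (\<forall>\<alpha>. mabs \<alpha> < r \<longrightarrow>
      s \<alpha> = 0 \<and> (\<forall>\<nu>\<in>T. jet_dir s \<nu> \<alpha> = 0))"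

definition smooth_section_family :: "nat \<Rightarrow> (real^'q::finite \<Rightarrow> real^'m::finite \<Rightarrow> ('m,'n::finite) jet) \<Rightarrow> bool" where
  "smooth_section_family r \<sigma> \<longleftrightarrow>
     (\<forall>\<alpha>. mabs \<alpha> \<le> r \<longrightarrow> smooth_on (cube \<times> cube) (\<lambda>(z,x). \<sigma> z x \<alpha>))"

definition holonomic :: "nat \<Rightarrow> (real^'m::finite \<Rightarrow> ('m,'n::finite) jet) \<Rightarrow> bool" where
  "holonomic r s \<longleftrightarrow> (\<exists>h. smooth_on cube h \<and>
     (\<exists>U g. open U \<and> cube \<subseteq> U \<and> smooth_open U g \<and> (\<forall>x\<in>cube. g x = h x) \<and>
        (\<forall>x\<in>cube. \<forall>\<alpha>. mabs \<alpha> \<le> r \<longrightarrow> s x \<alpha> = pderiv \<alpha> g x)))"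

text \<open>Smooth family of hyperplane fields tau_z on I^m, z in I^q: locally the kernel
  of a smooth nowhere vanishing 1-form (represented by its dual vector field).\<close>
definition smooth_hyperplane_family :: "(real^'q::finite \<Rightarrow> real^'m::finite \<Rightarrow> (real^'m) set) \<Rightarrow> bool" where
  "smooth_hyperplane_family \<tau> \<longleftrightarrow>
     (\<forall>p\<in>cube \<times> cube. \<exists>W \<nu>. open W \<and> p \<in> W \<and> smooth_open W (\<nu> :: (real^'q) \<times> (real^'m) \<Rightarrow> real^'m) \<and>
        (\<forall>z x. (z,x) \<in> W \<inter> (cube \<times> cube) \<longrightarrow> \<nu> (z,x) \<noteq> 0 \<and> \<tau> z x = {v. \<nu> (z,x) \<bullet> v = 0}))"

definition isotopy_family :: "(real^'q::finite \<Rightarrow> real \<Rightarrow> real^'m::finite \<Rightarrow> real^'m) \<Rightarrow> bool" where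
  "isotopy_family F \<longleftrightarrow>
     smooth_on ((cube \<times> {0..1}) \<times> cube) (\<lambda>((z,t),x). F z t x) \<and>
     (\<forall>z\<in>cube. (\<forall>x\<in>cube. F z 0 x = x) \<and>
        (\<forall>t\<in>{0..1}. bij_betw (F z t) cube cube \<and>
            smooth_on cube (inv_into cube (F z t))))"

end

theory Submission
  imports Defs
begin

text \<open>Since \<open>\<sigma>\<close> vanishes in its \<open>\<bottom>\<close>-component, pointwise it is a rank one tensor \<open>a \<otimes> \<nu>\<^sup>r\<close> with
  \<open>\<nu>\<close> normal to \<open>\<tau>\<close>. A partition of unity reduces the problem to a finite sum of terms \<open>\<rho> a \<otimes> \<nu>\<^sup>r\<close> with
  constant \<open>a\<close> and \<open>\<nu>\<close>, and these are treated one after the other: each step adds a function to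
  \<open>h\<close> and composes the isotopy with a further, arbitrarily small one, so that the closeness already
  achieved near the image of the hyperplane \<open>x\<^sub>i = 0\<close> (which contains \<open>I\<^sup>k\<close>) is not destroyed.

  For one term, write the current image of the hyperplane as \<open>f = 0\<close>. Where \<open>\<nabla>f\<close> is almost parallel to
  \<open>\<nu>\<close>, a function of \<open>f/\<eta>\<close> works without moving anything. Elsewhere, take two sawtooth functions of
  \<open>\<nu> \<bullet> x / \<eta>\<close> shifted by half a period against each other, use one of them where \<open>f\<close> is
  positive and the other one where \<open>f\<close> is negative, and let the hypersurface zigzag between
  the two regions so as to avoid the teeth. The zigzag moves points along the projection of \<open>\<nabla>f\<close> to
  the hyperplane \<open>\<nu>\<^sup>\<bottom>\<close>; its amplitude is fixed before \<open>\<eta>\<close> tends to \<open>0\<close>, so all derivatives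
  falling on slow factors are negligible.\<close>

subsection \<open>Smooth functions\<close>

text \<open>The obstacle is that a function with small (r-1)-jet cannot have r-th derivative close
  to 1 along a long segment: a sawtooth must return, and there its r-th derivative is wrong. At the
  returns only the direction is controlled: the r-jet is still close to b \<nu>^r \<otimes> a, with
  |b| at most M times the weight, where M bounds the r-th derivative of the sawtooth power and
  depends on r alone. So the perpendicular part is small everywhere once \<nu> is nearly normal to
  \<tau>, and the partition can be made fine enough for this M beforehand. Correct coefficients are
  required only along a hypersurface, which leaves one dimension for avoiding the returns; this is
  where k < m is used.

  The threshold \<kappa> separates two regimes: tangency at most 2\<kappa> lets a multiple of the
  gradient stand in for \<nu>, tangency at least \<kappa> gives a definite rate at which a
  displacement changes f.

  The parameter z is an inert variable: all functions live on the whole product space, only x is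
  moved and differentiated, and compact supports inside the open product of cubes give all boundary
  conditions.\<close>

abbreviation Ck :: "nat \<Rightarrow> ('a::real_normed_vector \<Rightarrow> 'b::real_normed_vector) \<Rightarrow> bool" where
  "Ck k f \<equiv> Ck_on k UNIV f"

abbreviation smooth :: "('a::real_normed_vector \<Rightarrow> 'b::real_normed_vector) \<Rightarrow> bool" where
  "smooth f \<equiv> smooth_open UNIV f"

lemma smooth_iff: "smooth f \<longleftrightarrow> (\<forall>k. Ck k f)"
  by (simp add: smooth_open_def)

declare Ck_on.simps(2) [simp del]

lemma Ck_SucI:
  assumes "\<And>x. (f has_derivative f' x) (at x)" and "\<And>v. Ck k (\<lambda>x. f' x v)"
  shows "Ck (Suc k) f"
proof -
  have "frechet_derivative f (at x) = f' x" for x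
    using frechet_derivative_at[OF assms(1)] by simp
  then show ?thesis using assms by (auto simp: differentiable_def Ck_on.simps(2))
qed

lemma Ck_SucD:
  assumes "Ck (Suc k) f"
  shows "(f has_derivative frechet_derivative f (at x)) (at x)"
    and "Ck k (\<lambda>x. frechet_derivative f (at x) v)"
  using assms by (auto simp: frechet_derivative_works Ck_on.simps(2))

lemma Ck_Suc_imp: "Ck (Suc k) f \<Longrightarrow> Ck k f"
proof (induction k arbitrary: f)
  case 0
  then have "isCont f x" for x
    using Ck_SucD(1) has_derivative_continuous by blast
  then show ?case by (simp add: continuous_at_imp_continuous_on)
next
  case (Suc k)
  show ?case
    by (rule Ck_SucI[OF Ck_SucD(1)[OF Suc.prems] Suc.IH[OF Ck_SucD(2)[OF Suc.prems]]])
qed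

lemma Ck_continuous: "Ck k f \<Longrightarrow> continuous_on UNIV f"
  by (induction k) (auto dest: Ck_Suc_imp)

lemma smooth_continuous: "smooth f \<Longrightarrow> continuous_on S f"
  using Ck_continuous[of 0 f] continuous_on_subset[of UNIV f S] unfolding smooth_iff by blast

lemma Ck_const: "Ck k (\<lambda>x. c)"
proof (induction k arbitrary: c)
  case (Suc k)
  show ?case by (rule Ck_SucI[where f'="\<lambda>x v. 0"]) (auto intro: Suc)
qed auto

lemma Ck_bounded_linear: assumes "bounded_linear f" shows "Ck k f"
proof (cases k)
  case 0
  then show ?thesis using assms by (simp add: linear_continuous_on)
next
  case (Suc k')
  show ?thesis unfolding Suc
    by (rule Ck_SucI[where f'="\<lambda>x. f"])
       (auto intro: bounded_linear_imp_has_derivative assms Ck_const)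
qed

lemma Ck_add: "Ck k f \<Longrightarrow> Ck k g \<Longrightarrow> Ck k (\<lambda>x. f x + g x)"
proof (induction k arbitrary: f g)
  case 0 then show ?case by (auto intro: continuous_intros)
next
  case (Suc k)
  note F = Ck_SucD[OF Suc.prems(1)] and G = Ck_SucD[OF Suc.prems(2)]
  show ?case
    by (rule Ck_SucI[OF has_derivative_add[OF F(1) G(1)]]) (intro Suc.IH F G)
qed

lemma (in bounded_bilinear) Ck_prod: "Ck k f \<Longrightarrow> Ck k g \<Longrightarrow> Ck k (\<lambda>x. prod (f x) (g x))"
proof (induction k arbitrary: f g)
  case 0 then show ?case by (auto intro: continuous_on)
next
  case (Suc k)
  note F = Ck_SucD[OF Suc.prems(1)] and G = Ck_SucD[OF Suc.prems(2)]
  show ?case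
    by (rule Ck_SucI[OF FDERIV[OF F(1) G(1)]])
       (intro Ck_add Suc.IH F G Suc.prems[THEN Ck_Suc_imp])
qed

lemma Ck_sum: "(\<And>i. i \<in> I \<Longrightarrow> Ck k (f i)) \<Longrightarrow> Ck k (\<lambda>x. \<Sum>i\<in>I. f i x)"
  by (induction I rule: infinite_finite_induct) (auto intro: Ck_const Ck_add)

text \<open>The chain rule applies the derivative of \<open>f\<close> to a vector that varies with
  x, whereas \<open>Ck_on\<close> speaks only of derivatives in fixed directions. Expanding that
  vector in the basis gives a finite sum of products to which the induction hypothesis
  applies.\<close>

lemma Ck_compose:
  fixes g :: "'a::real_normed_vector \<Rightarrow> 'b::euclidean_space"
  shows "Ck k f \<Longrightarrow> Ck k g \<Longrightarrow> Ck k (\<lambda>x. f (g x))"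
proof (induction k arbitrary: f g)
  case 0 then show ?case by (auto intro: continuous_on_compose2)
next
  case (Suc k)
  note F = Ck_SucD[OF Suc.prems(1)] and G = Ck_SucD[OF Suc.prems(2)]
  have "Ck k (\<lambda>x. frechet_derivative f (at (g x)) (frechet_derivative g (at x) v))" for v
  proof -
    have "frechet_derivative f (at (g x)) (frechet_derivative g (at x) v) =
      (\<Sum>b\<in>Basis. (frechet_derivative g (at x) v \<bullet> b) *\<^sub>R frechet_derivative f (at (g x)) b)" for x
    proof -
      have l: "linear (frechet_derivative f (at (g x)))"
        using F(1) has_derivative_linear by blast
      show ?thesis
        by (subst euclidean_representation[of "frechet_derivative g (at x) v", symmetric])
           (simp only: linear_sum[OF l] linear_cmul[OF l])
    qed
    moreover have "Ck k (\<lambda>x. \<Sum>b\<in>Basis. (frechet_derivative g (at x) v \<bullet> b) *\<^sub>R frechet_derivative f (at (g x)) b)"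
      by (intro Ck_sum bounded_bilinear.Ck_prod[OF bounded_bilinear_scaleR]
          bounded_bilinear.Ck_prod[OF bounded_bilinear_inner] Ck_const G
          Suc.IH[where f="\<lambda>x. frechet_derivative f (at x) b" for b] F(2) Ck_Suc_imp[OF Suc.prems(2)])
    ultimately show ?thesis by simp
  qed
  then show ?case
    by (intro Ck_SucI[OF has_derivative_compose[OF G(1) F(1)]])
qed

lemma Ck_linear_compose:
  assumes "bounded_linear L"
  shows "Ck k f \<Longrightarrow> Ck k (\<lambda>x. L (f x))"
proof (induction k arbitrary: f)
  case 0 then show ?case using assms(1) by (auto intro: bounded_linear.continuous_on)
next
  case (Suc k)
  show ?case
    by (rule Ck_SucI[OF bounded_linear.has_derivative[OF assms(1) Ck_SucD(1)[OF Suc.prems]]])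
      (intro Suc.IH Ck_SucD(2)[OF Suc.prems])
qed

lemma Ck_Pair: 
  assumes "Ck k f" "Ck k g"
  shows "Ck k (\<lambda>x. (f x, g x))"
proof -
  have "Ck k (\<lambda>x. (f x, 0) + (0, g x))"
    by (intro Ck_add Ck_linear_compose[OF _ assms(1)] Ck_linear_compose[OF _ assms(2)]
        bounded_linear_Pair bounded_linear_ident bounded_linear_zero)
  then show ?thesis by simp
qed

text \<open>Makes the global closure lemmas available for functions that have a formula only
  locally, such as the sawtooth near and away from its jumps.\<close>

lemma Ck_cong_local:
  assumes "\<And>x. \<exists>U g. open U \<and> x \<in> U \<and> Ck k g \<and> (\<forall>y\<in>U. f y = g y)"
  shows "Ck k f"
  using assms
proof (induction k arbitrary: f)
  case 0
  have "isCont f x" for x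
  proof -
    obtain U g where U: "open U" "x \<in> U" "continuous_on UNIV g" "\<forall>y\<in>U. f y = g y"
      using 0[of x] by auto
    then have "isCont g x" by (simp add: continuous_on_eq_continuous_at)
    moreover have "eventually (\<lambda>y. f y = g y) (nhds x)"
      using U by (auto simp: eventually_nhds)
    ultimately show ?thesis using isCont_cong by blast
  qed
  then show ?case by (simp add: continuous_on_eq_continuous_at)
next
  case (Suc k)
  have D: "\<exists>U g. open U \<and> x \<in> U \<and> Ck (Suc k) g \<and> (\<forall>y\<in>U. f y = g y \<and> 
      (f has_derivative frechet_derivative g (at y)) (at y))" for x
  proof -
    obtain U g where U: "open U" "x \<in> U" "Ck (Suc k) g" "\<forall>y\<in>U. f y = g y"
      using Suc.prems[of x] by blast
    have "(f has_derivative frechet_derivative g (at y)) (at y)" if "y \<in> U" for y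
      using has_derivative_transform_within_open[OF Ck_SucD(1)[OF U(3)] U(1) that] U(4) by auto
    with U show ?thesis by blast
  qed
  show ?case
  proof (rule Ck_SucI[where f'="\<lambda>x. frechet_derivative f (at x)"])
    show "(f has_derivative frechet_derivative f (at x)) (at x)" for x
      using D[of x] frechet_derivative_at by metis
    show "Ck k (\<lambda>x. frechet_derivative f (at x) v)" for v
    proof (rule Suc.IH)
      fix x
      obtain U g where U: "open U" "x \<in> U" "Ck (Suc k) g" 
        "\<forall>y\<in>U. f y = g y \<and> (f has_derivative frechet_derivative g (at y)) (at y)"
        using D[of x] by blast
      have "frechet_derivative f (at y) v = frechet_derivative g (at y) v" if "y \<in> U" for y
        using U(4) that frechet_derivative_at by metis
      then show "\<exists>U g. open U \<and> x \<in> U \<and> Ck k g \<and> (\<forall>y\<in>U. frechet_derivative f (at y) v = g y)"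
        using U Ck_SucD(2)[OF U(3)] by blast
    qed
  qed
qed

lemma smooth_cong_local:
  assumes "\<And>x. \<exists>U g. open U \<and> x \<in> U \<and> smooth g \<and> (\<forall>y\<in>U. f y = g y)"
  shows "smooth f"
  unfolding smooth_iff using assms by (intro allI Ck_cong_local) (metis smooth_iff)

named_theorems smooth_intros

lemma smooth_const [smooth_intros]: "smooth (\<lambda>x. c)"
  by (simp add: smooth_iff Ck_const)

lemma smooth_bounded_linear: "bounded_linear f \<Longrightarrow> smooth f"
  by (simp add: smooth_iff Ck_bounded_linear)

lemma smooth_ident [smooth_intros]: "smooth (\<lambda>x. x)"
  by (rule smooth_bounded_linear[OF bounded_linear_ident])

lemma smooth_compose:
  fixes g :: "'a::real_normed_vector \<Rightarrow> 'b::euclidean_space"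
  shows "smooth f \<Longrightarrow> smooth g \<Longrightarrow> smooth (\<lambda>x. f (g x))"
  by (simp add: smooth_iff Ck_compose)

lemma smooth_add [smooth_intros]: "smooth f \<Longrightarrow> smooth g \<Longrightarrow> smooth (\<lambda>x. f x + g x)"
  by (simp add: smooth_iff Ck_add)

lemma smooth_scaleR [smooth_intros]: "smooth f \<Longrightarrow> smooth g \<Longrightarrow> smooth (\<lambda>x. f x *\<^sub>R g x)"
  by (simp add: smooth_iff bounded_bilinear.Ck_prod[OF bounded_bilinear_scaleR])

lemma smooth_mult [smooth_intros]:
  fixes f g :: "'a::real_normed_vector \<Rightarrow> 'b::real_normed_algebra"
  shows "smooth f \<Longrightarrow> smooth g \<Longrightarrow> smooth (\<lambda>x. f x * g x)"
  by (simp add: smooth_iff bounded_bilinear.Ck_prod[OF bounded_bilinear_mult])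

lemma smooth_inner [smooth_intros]: "smooth f \<Longrightarrow> smooth g \<Longrightarrow> smooth (\<lambda>x. f x \<bullet> g x)"
  by (simp add: smooth_iff bounded_bilinear.Ck_prod[OF bounded_bilinear_inner])

lemma smooth_sum [smooth_intros]: "(\<And>i. i \<in> I \<Longrightarrow> smooth (f i)) \<Longrightarrow> smooth (\<lambda>x. \<Sum>i\<in>I. f i x)"
  by (simp add: smooth_iff Ck_sum)

lemma smooth_power [smooth_intros]:
  fixes f :: "'a::real_normed_vector \<Rightarrow> real"
  shows "smooth f \<Longrightarrow> smooth (\<lambda>x. f x ^ n)"
  by (induction n) (auto intro: smooth_intros)

lemma smooth_linear_compose: "bounded_linear L \<Longrightarrow> smooth f \<Longrightarrow> smooth (\<lambda>x. L (f x))"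
  by (simp add: smooth_iff Ck_linear_compose)

lemma smooth_minus [smooth_intros]: "smooth f \<Longrightarrow> smooth (\<lambda>x. - f x)"
  by (rule smooth_linear_compose[OF bounded_linear_minus[OF bounded_linear_ident]])

lemma smooth_diff [smooth_intros]: "smooth f \<Longrightarrow> smooth g \<Longrightarrow> smooth (\<lambda>x. f x - g x)"
  using smooth_add[OF _ smooth_minus, of f g] by simp

lemma smooth_fst [smooth_intros]: "smooth f \<Longrightarrow> smooth (\<lambda>x. fst (f x))"
  by (rule smooth_linear_compose[OF bounded_linear_fst])

lemma smooth_snd [smooth_intros]: "smooth f \<Longrightarrow> smooth (\<lambda>x. snd (f x))"
  by (rule smooth_linear_compose[OF bounded_linear_snd])

lemma smooth_nth [smooth_intros]: "smooth f \<Longrightarrow> smooth (\<lambda>x. f x $ i)"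
  by (rule smooth_linear_compose[OF bounded_linear_vec_nth])

lemma smooth_Pair [smooth_intros]: "smooth f \<Longrightarrow> smooth g \<Longrightarrow> smooth (\<lambda>x. (f x, g x))"
  by (simp add: smooth_iff Ck_Pair)

lemma smooth_inverse:
  fixes f :: "'a::real_normed_vector \<Rightarrow> real"
  assumes "smooth f" and nz: "\<And>x. f x \<noteq> 0"
  shows "smooth (\<lambda>x. inverse (f x))"
proof -
  have "Ck k (\<lambda>x. inverse (f x))" for k
  proof (induction k)
    case 0 
    then show ?case using smooth_continuous[OF assms(1)] nz by (auto intro: continuous_intros)
  next
    case (Suc k)
    have f: "Ck (Suc k) f" using assms(1) by (simp add: smooth_iff del: Ck_on.simps)
    \<comment> \<open>This derivative contains 1/f only undifferentiated, so order k for 1/f gives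
      order k + 1.\<close>
    have "((\<lambda>x. inverse (f x)) has_derivative
       (\<lambda>h. (-1) * (inverse (f x) * frechet_derivative f (at x) h * inverse (f x)))) (at x)" for x
      using Deriv.has_derivative_inverse[OF nz Ck_SucD(1)[OF f], of x] by simp
    then show ?case
      by (rule Ck_SucI)
        (intro bounded_bilinear.Ck_prod[OF bounded_bilinear_mult] Suc Ck_SucD(2)[OF f] Ck_const)
  qed
  then show ?thesis by (simp add: smooth_iff)
qed

lemma smooth_divide:
  fixes f g :: "'a::real_normed_vector \<Rightarrow> real"
  shows "smooth f \<Longrightarrow> smooth g \<Longrightarrow> (\<And>x. g x \<noteq> 0) \<Longrightarrow> smooth (\<lambda>x. f x / g x)"
  by (simp add: divide_inverse smooth_mult smooth_inverse)

lemma smooth_divide_const [smooth_intros]: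
  fixes f :: "'a::real_normed_vector \<Rightarrow> real"
  shows "smooth f \<Longrightarrow> smooth (\<lambda>x. f x / c)"
  by (simp add: divide_inverse smooth_mult smooth_const)

lemma smooth_has_derivative:
  "smooth f \<Longrightarrow> (f has_derivative frechet_derivative f (at x)) (at x)"
  using Ck_SucD(1)[of 0 f] by (auto simp: smooth_iff)

lemma smooth_frechet_derivative:
  "smooth f \<Longrightarrow> smooth (\<lambda>x. frechet_derivative f (at x) v)"
  using Ck_SucD(2) by (auto simp: smooth_iff)

subsection \<open>Cutoff and sawtooth functions\<close>

lemma Ck_Suc_real:
  fixes f :: "real \<Rightarrow> real"
  assumes "\<And>x. (f has_real_derivative f' x) (at x)" and "Ck k f'"
  shows "Ck (Suc k) f"
  by (rule Ck_SucI[OF assms(1)[unfolded has_field_derivative_def]])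
     (intro bounded_bilinear.Ck_prod[OF bounded_bilinear_mult] assms(2) Ck_const)

lemma smooth_has_real_derivative:
  fixes f :: "real \<Rightarrow> real"
  assumes "smooth f"
  shows "(f has_real_derivative deriv f x) (at x)"
proof -
  have "f differentiable (at x)"
    using smooth_has_derivative[OF assms] by (auto simp: differentiable_def)
  then show ?thesis
    by (simp add: DERIV_deriv_iff_real_differentiable)
qed

lemma smooth_deriv:
  fixes f :: "real \<Rightarrow> real"
  assumes "smooth f"
  shows "smooth (deriv f)"
proof -
  have "frechet_derivative f (at x) 1 = deriv f x" for x
    using frechet_derivative_at[OF smooth_has_real_derivative[OF assms, unfolded has_field_derivative_def]]
    by (metis mult.right_neutral)
  then show ?thesis using smooth_frechet_derivative[OF assms, of 1] by simp
qed

lemma smooth_deriv_iter: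
  fixes f :: "real \<Rightarrow> real"
  shows "smooth f \<Longrightarrow> smooth ((deriv ^^ j) f)"
  by (induction j) (auto intro: smooth_deriv)

lemma smooth_cos [smooth_intros]: 
  fixes f :: "'a::real_normed_vector \<Rightarrow> real"
  assumes "smooth f" shows "smooth (\<lambda>x. cos (f x))"
proof -
  \<comment> \<open>Sine and cosine are derivatives of each other up to sign, so the induction
    carries both.\<close>
  have "Ck k (sin :: real \<Rightarrow> real) \<and> Ck k (cos :: real \<Rightarrow> real)" for k
  proof (induction k)
    case (Suc k)
    have "Ck k (\<lambda>x::real. (-1) * sin x)"
      using Suc by (intro bounded_bilinear.Ck_prod[OF bounded_bilinear_mult] Ck_const) auto
    then have 1: "Ck k (\<lambda>x::real. - sin x)" by simp
    show ?case
      using Ck_Suc_real[OF DERIV_sin, of k] Ck_Suc_real[OF DERIV_cos 1] Suc by auto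
  qed (auto intro: continuous_intros)
  then have "smooth (cos :: real \<Rightarrow> real)" by (simp add: smooth_iff)
  then show ?thesis using smooth_compose assms by blast
qed

section \<open>Flat functions, the smooth transition and the periodic sawtooth\<close>

text \<open>With powers of 1/x in front of exp (- 1/x) the family is closed under differentiation up
  to linear combinations, so one induction with \<open>n\<close> arbitrary gives all orders of
  smoothness.\<close>

definition flat :: "nat \<Rightarrow> real \<Rightarrow> real" where
  "flat n x = (if x > 0 then (1/x) ^ n * exp (- (1/x)) else 0)"

lemma power_le_fact_exp:
  fixes y :: real assumes "y \<ge> 0" shows "y ^ n \<le> fact n * exp y"
proof -
  have "sum (\<lambda>k. y ^ k /\<^sub>R fact k) {n} \<le> (\<Sum>k. y ^ k /\<^sub>R fact k)"
    using assms summable_exp_generic[of y] by (intro sum_le_suminf) auto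
  then show ?thesis by (simp add: exp_def divide_simps mult.commute)
qed

text \<open>The exponential series gives y^(n+2) \<le> (n+2)! exp y for y = 1/x. The quadratic bound
  makes the difference quotient at 0 tend to 0.\<close>

lemma flat_le: "\<bar>flat n x\<bar> \<le> fact (n + 2) * x\<^sup>2"
proof (cases "x > 0")
  case True
  define y where "y = 1/x"
  have y: "y > 0" using True by (simp add: y_def)
  have "y ^ n * exp (- y) = y ^ (n + 2) * exp (- y) / y\<^sup>2"
    using y by (simp add: power_add power2_eq_square)
  also have "\<dots> \<le> (fact (n + 2) * exp y) * exp (- y) / y\<^sup>2"
    using y by (intro divide_right_mono mult_right_mono power_le_fact_exp) auto
  also have "\<dots> = fact (n + 2) * x\<^sup>2"
    by (simp add: exp_minus y_def power_divide)
  finally have "y ^ n * exp (- y) \<le> fact (n + 2) * x\<^sup>2" .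
  then show ?thesis using True by (simp add: flat_def y_def)
qed (auto simp: flat_def)

lemma flat_deriv:
  "(flat n has_real_derivative (- real n * flat (n+1) x + flat (n+2) x)) (at x)"
proof -
  consider "x > 0" | "x < 0" | "x = 0" by linarith
  then show ?thesis
  proof cases
    case 1
    have "((\<lambda>x. (1/x) ^ n * exp (- (1/x))) has_real_derivative (- real n * flat (n+1) x + flat (n+2) x)) (at x)"
    proof (cases n)
      case 0
      then show ?thesis using 1
        by (auto intro!: derivative_eq_intros simp: flat_def power2_eq_square)
    next
      case (Suc n')
      have "((\<lambda>x. 1/x) has_real_derivative - ((1/x) * (1/x))) (at x)"
        using 1 by (auto intro!: derivative_eq_intros)
      then have "((\<lambda>x. (1/x) ^ n) has_real_derivative real n * (1/x) ^ n' * - ((1/x) * (1/x))) (at x)"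
        unfolding Suc by (rule DERIV_cong[OF DERIV_power_Suc]) (simp add: algebra_simps add_divide_distrib)
      moreover have "((\<lambda>x. exp (- (1/x))) has_real_derivative exp (- (1/x)) * ((1/x) * (1/x))) (at x)"
        using 1 by (auto intro!: derivative_eq_intros)
      ultimately show ?thesis
        by (rule DERIV_cong[OF DERIV_mult]) (use 1 in \<open>simp add: flat_def Suc algebra_simps add_divide_distrib diff_divide_distrib\<close>)
    qed
    then show ?thesis
      by (rule has_field_derivative_transform_within_open[where S="{0<..}"]) (use 1 in \<open>auto simp: flat_def\<close>)
  next
    case 2
    have "((\<lambda>x. 0) has_real_derivative (- real n * flat (n+1) x + flat (n+2) x)) (at x)"
      using 2 by (simp add: flat_def)
    then show ?thesis
      by (rule has_field_derivative_transform_within_open[where S="{..<0}"]) (use 2 in \<open>auto simp: flat_def\<close>)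
  next
    case 3
    have "((\<lambda>y. flat n y / y) \<longlongrightarrow> 0) (at 0)"
    proof (rule Lim_null_comparison)
      show "eventually (\<lambda>y. norm (flat n y / y) \<le> fact (n+2) * \<bar>y\<bar>) (at 0)"
      proof (rule eventuallyI)
        fix y :: real
        show "norm (flat n y / y) \<le> fact (n+2) * \<bar>y\<bar>"
          using flat_le[of n y] by (cases "y = 0") (auto simp: divide_simps power2_eq_square abs_mult_self_eq mult.assoc)
      qed
      show "((\<lambda>y::real. fact (n+2) * \<bar>y\<bar>) \<longlongrightarrow> 0) (at 0)"
        by (rule tendsto_eq_intros refl | simp)+
    qed
    then show ?thesis using 3 by (simp add: has_field_derivative_iff flat_def)
  qed
qed

lemma smooth_flat: "smooth (flat n)"
proof -
  have "Ck k (flat n)" for k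
  proof (induction k arbitrary: n)
    case 0
    show ?case by (simp add: continuous_at_imp_continuous_on DERIV_isCont[OF flat_deriv])
  next
    case (Suc k)
    show ?case
      by (rule Ck_Suc_real[OF flat_deriv])
         (intro Ck_add bounded_bilinear.Ck_prod[OF bounded_bilinear_mult] Ck_const Suc)
  qed
  then show ?thesis by (simp add: smooth_iff)
qed

text \<open>The standard smooth transition: 0 up to 0 and 1 from 1 on. It serves for all cutoffs and
  as the smooth time parameter of the isotopies.\<close>

definition step :: "real \<Rightarrow> real" where
  "step x = flat 0 x / (flat 0 x + flat 0 (1 - x))"

lemma flat_nonneg: "flat 0 x \<ge> 0" and flat_pos: "x > 0 \<Longrightarrow> flat 0 x > 0"
  by (auto simp: flat_def)

lemma step_denominator: "flat 0 x + flat 0 (1 - x) > 0"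
  using flat_nonneg[of x] flat_nonneg[of "1-x"] flat_pos[of x] flat_pos[of "1-x"] by (cases "x > 0") auto

lemma smooth_step [smooth_intros]:
  assumes "smooth f" shows "smooth (\<lambda>x. step (f x))"
proof -
  have "smooth (\<lambda>x. flat 0 x / (flat 0 x + flat 0 (1 - x)))"
    using step_denominator
    by (intro smooth_divide smooth_add smooth_flat smooth_compose[OF smooth_flat] smooth_intros)
       (simp add: less_imp_neq[symmetric])
  then have "smooth step" unfolding step_def[abs_def] .
  then show ?thesis using smooth_compose assms by blast
qed

lemma step_bounds: "0 \<le> step x" "step x \<le> 1"
  using flat_nonneg[of x] flat_nonneg[of "1-x"] step_denominator[of x]
  by (auto simp: step_def divide_simps)

lemma step_eq_0: "x \<le> 0 \<Longrightarrow> step x = 0"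
  by (simp add: step_def flat_def)

lemma step_eq_1: "x \<ge> 1 \<Longrightarrow> step x = 1"
  using flat_pos[of x] by (simp add: step_def flat_def)

text \<open>The first factor cuts off the jumps of \<open>frac\<close> at the integers.\<close>

definition sawtooth :: "real \<Rightarrow> real" where
  "sawtooth t = step ((9/10 - cos (2 * pi * t)) * (10/3)) * (frac t - 1/2)"

lemma cos_2pi_neq_1: "t \<notin> \<int>" if "cos (2 * pi * t) \<noteq> 1"
  using that cos_one_2pi_int[of "2 * pi * t"] by (auto elim!: Ints_cases)

lemma sawtooth_local:
  assumes "cos (2 * pi * t) < 1"
  shows "\<exists>U c. open U \<and> t \<in> U \<and> (\<forall>s\<in>U. frac s - 1/2 = s - c)"
proof -
  have "t \<notin> \<int>" using cos_2pi_neq_1 assms by auto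
  then have "of_int \<lfloor>t\<rfloor> < t"
    by (metis Ints_of_int floor_correct less_eq_real_def)
  moreover have "frac s - 1/2 = s - (of_int \<lfloor>t\<rfloor> + 1/2)" if "s \<in> {of_int \<lfloor>t\<rfloor> <..< of_int \<lfloor>t\<rfloor> + 1}" for s :: real
  proof -
    have "\<lfloor>s\<rfloor> = \<lfloor>t\<rfloor>" using that by (intro floor_unique) auto
    then show ?thesis by (simp add: frac_def)
  qed
  ultimately show ?thesis
    by (intro exI[of _ "{of_int \<lfloor>t\<rfloor> <..< of_int \<lfloor>t\<rfloor> + 1}"] exI[of _ "of_int \<lfloor>t\<rfloor> + 1/2"]) auto
qed

lemma open_cos_less: "open {t. cos (2 * pi * t) < c}" "open {t. c < cos (2 * pi * t)}"
  by (intro open_Collect_less continuous_intros)+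

lemma smooth_sawtooth: "smooth sawtooth"
proof (rule smooth_cong_local)
  fix t :: real
  show "\<exists>U g. open U \<and> t \<in> U \<and> smooth g \<and> (\<forall>y\<in>U. sawtooth y = g y)"
  proof (cases "cos (2 * pi * t) < 1")
    case True
    obtain U c where "open U" "t \<in> U" "\<forall>s\<in>U. frac s - 1/2 = s - c"
      using sawtooth_local[OF True] by blast
    then show ?thesis
      by (intro exI[of _ U] exI[of _ "\<lambda>t. step ((9/10 - cos (2 * pi * t)) * (10/3)) * (t - c)"])
        (auto simp: sawtooth_def intro!: smooth_intros)
  next
    case False
    have "sawtooth s = 0" if "9/10 < cos (2 * pi * s)" for s
      using that by (simp add: sawtooth_def step_eq_0)
    then show ?thesis
      using False open_cos_less(2)[of "9/10"]
      by (intro exI[of _ "{t. 9/10 < cos (2 * pi * t)}"] exI[of _ "\<lambda>t. 0"] conjI smooth_const) simp_all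
  qed
qed

text \<open>On each linear piece of the sawtooth this is (t - c)^r / r!, whose r-th derivative is 1.
  Being smooth and periodic it has bounded derivatives, so \<eta>^r \<open>saw r\<close> (t /
  \<eta>) has derivatives of order below r that vanish with \<eta>.\<close>

definition saw :: "nat \<Rightarrow> real \<Rightarrow> real" where
  "saw r t = sawtooth t ^ r / fact r"

lemma smooth_saw: "smooth (saw r)"
  unfolding saw_def[abs_def] using smooth_sawtooth by (intro smooth_intros)

text \<open>The argument of the cutoff in \<open>sawtooth\<close> reaches 1 at cos = 6/10. This
  value lies above 1/2, so the closed region cos \<le> 1/2 used later has an open neighborhood where
  the sawtooth is locally linear.\<close>

lemma sawtooth_deriv:
  assumes "cos (2 * pi * t) < 6/10"
  shows "(sawtooth has_real_derivative 1) (at t)"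
proof -
  obtain U c where U: "open U" "t \<in> U" "\<forall>s\<in>U. frac s - 1/2 = s - c"
    using sawtooth_local[of t] assms by fastforce
  have "((\<lambda>s. s - c) has_real_derivative 1) (at t)"
    by (auto intro!: derivative_eq_intros)
  then show ?thesis
  proof (rule has_field_derivative_transform_within_open)
    show "open (U \<inter> {t. cos (2 * pi * t) < 6/10})" using U(1) open_cos_less by blast
    show "s - c = sawtooth s" if "s \<in> U \<inter> {t. cos (2 * pi * t) < 6/10}" for s
      using that U(3) by (simp add: sawtooth_def step_eq_1)
  qed (use U assms in auto)
qed

lemma saw_deriv_good_aux:
  "j \<le> r \<Longrightarrow> cos (2 * pi * t) < 6/10 \<Longrightarrow> (deriv ^^ j) (saw r) t = sawtooth t ^ (r - j) / fact (r - j)"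
proof (induction j arbitrary: t)
  case 0
  then show ?case by (simp add: saw_def)
next
  case (Suc j)
  obtain n where n: "r - j = Suc n" "r - Suc j = n" using Suc.prems(1) by (metis Suc_diff_Suc Suc_le_lessD)
  have "((\<lambda>t. sawtooth t ^ (r - j) / fact (r - j)) has_real_derivative sawtooth t ^ n / fact n) (at t)"
    unfolding n by (rule DERIV_cong[OF DERIV_cdivide[OF DERIV_power[OF sawtooth_deriv]]])
      (use Suc.prems in \<open>auto simp del: of_nat_Suc\<close>)
  then have "((deriv ^^ j) (saw r) has_real_derivative sawtooth t ^ n / fact n) (at t)"
    by (rule has_field_derivative_transform_within_open[OF _ open_cos_less(1)[of "6/10"]])
      (use Suc in auto)
  then show ?case using n by (simp add: DERIV_imp_deriv)
qed

lemma saw_deriv_good: "cos (2 * pi * t) \<le> 1/2 \<Longrightarrow> (deriv ^^ r) (saw r) t = 1"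
  by (subst saw_deriv_good_aux) auto

lemma deriv_periodic:
  fixes f :: "real \<Rightarrow> real"
  assumes "\<And>t. f (t + 1) = f t" "smooth f"
  shows "deriv f (t + 1) = deriv f t"
proof -
  have "((\<lambda>t. f (t + 1)) has_real_derivative deriv f (t + 1)) (at t)"
    using DERIV_shift smooth_has_real_derivative[OF assms(2)] by blast
  then show ?thesis using assms(1) by (simp add: DERIV_imp_deriv)
qed

lemma saw_deriv_periodic: "(deriv ^^ j) (saw r) (t + 1) = (deriv ^^ j) (saw r) t"
proof (induction j arbitrary: t)
  case 0
  have "cos (2 * pi * (t + 1)) = cos (2 * pi * t)"
    by (simp add: distrib_left cos_add)
  then show ?case by (simp add: saw_def sawtooth_def frac_1_eq)
next
  case (Suc j)
  then show ?case by (simp add: deriv_periodic smooth_deriv_iter smooth_saw)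
qed

text \<open>Periodicity reduces the claim to [0, 1]. The bound depends on j and r only, hence can be
  fixed before the partition of unity and all length scales.\<close>

lemma saw_deriv_bounded: "\<exists>M. \<forall>t. \<bar>(deriv ^^ j) (saw r) t\<bar> \<le> M"
proof -
  let ?f = "(deriv ^^ j) (saw r)"
  have "compact (?f ` {0..1})"
    using smooth_continuous[OF smooth_deriv_iter[OF smooth_saw]] by (intro compact_continuous_image) auto
  then obtain M where M: "\<forall>t\<in>{0..1}. \<bar>?f t\<bar> \<le> M"
    using compact_imp_bounded[of "?f ` {0..1}"] by (auto simp: bounded_iff)
  have per: "?f (t + real n) = ?f t" for t n
    by (induction n) (auto simp: add.assoc[symmetric] saw_deriv_periodic add.commute[of 1])
  have "?f t = ?f (frac t)" for t
  proof (cases "\<lfloor>t\<rfloor> \<ge> 0")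
    case True
    then have "t = frac t + real (nat \<lfloor>t\<rfloor>)" by (simp add: frac_def)
    then show ?thesis using per by metis
  next
    case False
    then have "frac t = t + real (nat (- \<lfloor>t\<rfloor>))" by (simp add: frac_def)
    then show ?thesis using per by metis
  qed
  moreover have "frac t \<in> {0..1}" for t :: real
    using frac_lt_1[of t] by (auto intro: less_imp_le)
  ultimately show ?thesis using M by metis
qed

section \<open>Bump functions and partitions of unity\<close>

text \<open>The factor 4/3 makes the argument of \<open>step\<close> equal to 1 at distance d/2 from
  c; it is 0 at distance d.\<close>

definition ball_bump :: "'a::euclidean_space \<Rightarrow> real \<Rightarrow> 'a \<Rightarrow> real" where
  "ball_bump c d y = step ((4/3) * (1 - ((y - c) \<bullet> (y - c)) / d\<^sup>2))"

lemma smooth_ball_bump: "smooth (ball_bump c d)"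
  unfolding ball_bump_def[abs_def] by (intro smooth_intros)

lemma ball_bump_bounds: "0 \<le> ball_bump c d y" "ball_bump c d y \<le> 1"
  by (auto simp: ball_bump_def step_bounds)

lemma ball_bump_eq_1:
  assumes "d > 0" "dist c y \<le> d / 2" shows "ball_bump c d y = 1"
proof -
  have "(norm (y - c))\<^sup>2 \<le> (d/2)\<^sup>2"
    using assms by (intro power_mono) (auto simp: dist_norm norm_minus_commute)
  then have "((y - c) \<bullet> (y - c)) / d\<^sup>2 \<le> 1/4"
    using assms by (simp add: power2_norm_eq_inner power_divide divide_simps)
  then show ?thesis unfolding ball_bump_def by (intro step_eq_1) (simp add: mult.commute)
qed

lemma ball_bump_eq_0:
  assumes "d > 0" "y \<notin> ball c d" shows "ball_bump c d y = 0"
proof -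
  have "d\<^sup>2 \<le> (norm (y - c))\<^sup>2"
    using assms by (intro power_mono) (auto simp: dist_norm norm_minus_commute)
  then have "1 \<le> ((y - c) \<bullet> (y - c)) / d\<^sup>2"
    using assms by (simp add: power2_norm_eq_inner)
  then show ?thesis by (simp add: ball_bump_def step_eq_0)
qed

text \<open>The denominator is \<open>S\<close> where \<open>S \<ge> 1\<close> and stays positive where \<open>S\<close> vanishes.\<close>

lemma ball_partition:
  fixes K :: "'a::euclidean_space set"
  assumes K: "compact K" and d: "\<And>y. y \<in> K \<Longrightarrow> d y > 0"
  shows "\<exists>Y \<rho>. finite Y \<and> Y \<subseteq> K \<and> (\<forall>c\<in>Y. smooth (\<rho> c)) \<and> (\<forall>c\<in>Y. \<forall>y. \<rho> c y \<ge> 0) \<and>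
     (\<forall>c\<in>Y. \<forall>y. y \<notin> ball c (d c) \<longrightarrow> \<rho> c y = 0) \<and> (\<forall>y. (\<Sum>c\<in>Y. \<rho> c y) \<le> 1) \<and>
     (\<forall>y\<in>K. (\<Sum>c\<in>Y. \<rho> c y) = (1::real))"
proof -
  have "K \<subseteq> (\<Union>c\<in>K. ball c (d c / 2))"
    using d by (fastforce simp: less_imp_le)
  then obtain Y where Y: "Y \<subseteq> K" "finite Y" "K \<subseteq> (\<Union>c\<in>Y. ball c (d c / 2))"
    using compactE_image[OF K, of K "\<lambda>c. ball c (d c / 2)"] by auto
  define S where "S = (\<lambda>y. \<Sum>c\<in>Y. ball_bump c (d c) y)"
  define D where "D = (\<lambda>y. S y + (1 - step (S y)))"
  have S0: "S y \<ge> 0" for y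
    unfolding S_def by (intro sum_nonneg ball_bump_bounds)
  have SK: "S y \<ge> 1" if y: "y \<in> K" for y
  proof -
    obtain c where c: "c \<in> Y" "dist c y < d c / 2" using Y(3) y by auto
    have "ball_bump c (d c) y \<le> S y"
      unfolding S_def using c Y by (intro member_le_sum ball_bump_bounds) auto
    moreover have "ball_bump c (d c) y = 1"
      using c Y d by (intro ball_bump_eq_1) auto
    ultimately show ?thesis by simp
  qed
  have Dpos: "D y > 0" for y
    using S0[of y] step_bounds[of "S y"] step_eq_0[of "S y"] unfolding D_def by (cases "S y = 0") auto
  have DS: "S y \<le> D y" for y using step_bounds[of "S y"] by (simp add: D_def)
  have sS: "smooth S" unfolding S_def by (intro smooth_intros smooth_ball_bump)
  then have sD: "smooth D" unfolding D_def by (intro smooth_intros)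
  define \<rho> where "\<rho> = (\<lambda>c y. ball_bump c (d c) y / D y)"
  have sum: "(\<Sum>c\<in>Y. \<rho> c y) = S y / D y" for y
    by (simp add: \<rho>_def S_def sum_divide_distrib)
  show ?thesis
  proof (intro exI[of _ Y] exI[of _ \<rho>] conjI ballI allI impI)
    show "smooth (\<rho> c)" for c
      unfolding \<rho>_def using Dpos by (intro smooth_divide smooth_ball_bump sD) (simp add: less_imp_neq[symmetric])
    show "\<rho> c y \<ge> 0" for c y
      unfolding \<rho>_def using Dpos[of y] ball_bump_bounds[of c "d c" y] by simp
    show "\<rho> c y = 0" if "c \<in> Y" "y \<notin> ball c (d c)" for c y
      using that Y d ball_bump_eq_0[of "d c" y c] by (auto simp: \<rho>_def)
    show "(\<Sum>c\<in>Y. \<rho> c y) \<le> 1" for y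
      unfolding sum using Dpos[of y] DS[of y] by simp
    show "(\<Sum>c\<in>Y. \<rho> c y) = 1" if "y \<in> K" for y
      unfolding sum using Dpos[of y] SK[OF that] by (simp add: D_def step_eq_1)
  qed (use Y in auto)
qed

text \<open>The sum of a partition of unity subordinate to balls whose closures lie in
  \<open>U\<close>; finitely many of these closed balls form \<open>K'\<close>.\<close>

lemma smooth_cutoff:
  fixes K :: "'a::euclidean_space set"
  assumes K: "compact K" "K \<subseteq> U" "open U"
  shows "\<exists>\<zeta> K'. smooth \<zeta> \<and> (\<forall>y\<in>K. \<zeta> y = (1::real)) \<and> compact K' \<and> K' \<subseteq> U \<and> (\<forall>y. y \<notin> K' \<longrightarrow> \<zeta> y = 0)"
proof -
  have "\<forall>y\<in>K. \<exists>d>0. cball y d \<subseteq> U"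
    using K open_contains_cball by (metis subsetD)
  then obtain d where d: "\<And>y. y \<in> K \<Longrightarrow> d y > 0 \<and> cball y (d y) \<subseteq> U" by metis
  obtain Y \<rho> where Y: "finite Y" "Y \<subseteq> K" "\<forall>c\<in>Y. smooth (\<rho> c)"
    "\<forall>c\<in>Y. \<forall>y. y \<notin> ball c (d c) \<longrightarrow> \<rho> c y = 0" "\<forall>y\<in>K. (\<Sum>c\<in>Y. \<rho> c y) = (1::real)"
    using ball_partition[OF K(1), of d] d by blast
  show ?thesis
  proof (intro exI[of _ "\<lambda>y. \<Sum>c\<in>Y. \<rho> c y"] exI[of _ "\<Union>c\<in>Y. cball c (d c)"] conjI allI impI)
    show "smooth (\<lambda>y. \<Sum>c\<in>Y. \<rho> c y)" using Y by (intro smooth_intros) auto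
    show "(\<Union>c\<in>Y. cball c (d c)) \<subseteq> U" using Y d by blast
    show "(\<Sum>c\<in>Y. \<rho> c y) = 0" if "y \<notin> (\<Union>c\<in>Y. cball c (d c))" for y
      using that Y by (intro sum.neutral) (auto simp: less_imp_le)
  qed (use Y in auto)
qed

subsection \<open>Fixed points depending smoothly on parameters\<close>

text \<open>By linearity the estimate may be tested on small multiples of \<open>v\<close>, where
  the remainder is below any prescribed fraction of the length. In \<open>Ck_fixpoint\<close> this
  passes the contraction constant to the linearization.\<close>

lemma Lipschitz_derivative_bound:
  assumes D: "(f has_derivative f') (at x)" and L: "\<And>y. norm (f y - f x) \<le> L * norm (y - x)"
  shows "norm (f' v) \<le> L * norm v"
proof (cases "v = 0")
  case True
  then show ?thesis using has_derivative_linear[OF D] by (simp add: linear_0)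
next
  case False
  note lin = has_derivative_linear[OF D]
  show ?thesis
  proof (rule field_le_epsilon)
    fix e :: real assume e: "e > 0"
    define e' where "e' = e / norm v"
    have "e' > 0" using e False by (simp add: e'_def)
    then obtain d where d: "d > 0" "\<And>y. norm (y - x) < d \<Longrightarrow> norm (f y - f x - f' (y - x)) \<le> e' * norm (y - x)"
      using D unfolding has_derivative_at_alt by blast
    define h where "h = d / (2 * norm v)"
    have h: "h > 0" using d False by (simp add: h_def)
    have "norm (h *\<^sub>R v) < d" using d False by (simp add: h_def)
    then have "norm (f (x + h *\<^sub>R v) - f x - f' (h *\<^sub>R v)) \<le> e' * norm (h *\<^sub>R v)"
      using d(2)[of "x + h *\<^sub>R v"] by simp
    moreover have "norm (f (x + h *\<^sub>R v) - f x) \<le> L * norm (h *\<^sub>R v)"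
      using L[of "x + h *\<^sub>R v"] by simp
    moreover have "norm (f' (h *\<^sub>R v)) \<le> norm (f (x + h *\<^sub>R v) - f x) + norm (f (x + h *\<^sub>R v) - f x - f' (h *\<^sub>R v))"
      using norm_triangle_ineq4[of "f (x + h *\<^sub>R v) - f x" "f (x + h *\<^sub>R v) - f x - f' (h *\<^sub>R v)"] by simp
    ultimately have "norm (f' (h *\<^sub>R v)) \<le> (L + e') * norm (h *\<^sub>R v)"
      by (simp add: distrib_right)
    then have "h * norm (f' v) \<le> h * ((L + e') * norm v)"
      using h by (simp add: linear_cmul[OF lin] mult_ac)
    then show "norm (f' v) \<le> L * norm v + e"
      using h False by (simp add: e'_def distrib_right)
  qed
qed

lemma half_contraction_fixpoint:
  fixes g :: "'x::euclidean_space \<Rightarrow> 'x"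
  assumes "\<And>x y. norm (g x - g y) \<le> (1/2) * norm (x - y)"
  shows "\<exists>x. x = g x"
proof -
  have "\<exists>!x. g x = x"
    using assms by (intro banach_fix_type[of "1/2"]) (auto simp: dist_norm)
  then obtain x where "g x = x" by blast
  then show ?thesis by (intro exI[of _ x]) simp
qed

lemma half_contraction_unique:
  fixes x y :: "'x::real_normed_vector"
  assumes "norm (x - y) \<le> (1/2) * norm (x - y)"
  shows "x = y"
  using assms by simp

text \<open>The derivative of the fixed point solves a fixed point equation of the same kind,
  which makes the induction on the order of differentiability work.\<close>

lemma Ck_fixpoint:
  fixes E :: "'q::euclidean_space \<times> 'x::euclidean_space \<Rightarrow> 'x"
  assumes "Ck k E" and "\<And>q x y. norm (E (q, x) - E (q, y)) \<le> (1/2) * norm (x - y)"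
    and "\<And>q. X q = E (q, X q)"
  shows "Ck k X"
  using assms
proof (induction k arbitrary: E X)
  case 0
  have "isCont X q" for q
  proof -
    \<comment> \<open>The contraction absorbs half of the distance, which leaves twice the change of
      \<open>E\<close> at a fixed second argument.\<close>
    have le: "norm (X p - X q) \<le> 2 * norm (E (p, X q) - E (q, X q))" for p
    proof -
      have "norm (X p - X q) \<le> norm (E (p, X p) - E (p, X q)) + norm (E (p, X q) - E (q, X q))"
        using norm_triangle_ineq[of "E (p, X p) - E (p, X q)" "E (p, X q) - E (q, X q)"] 0(3)[of p] 0(3)[of q]
        by simp
      then show ?thesis using 0(2)[of p "X p" "X q"] by simp
    qed
    have "continuous_on UNIV (\<lambda>p. E (p, X q))"
      using 0(1) by (auto intro!: continuous_on_compose2[of UNIV E] continuous_intros)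
    then have "isCont (\<lambda>p. E (p, X q)) q" by (simp add: continuous_on_eq_continuous_at)
    then have "((\<lambda>p. E (p, X q) - E (q, X q)) \<longlongrightarrow> 0) (at q)"
      by (simp add: isCont_def LIM_zero)
    then have "((\<lambda>p. 2 * norm (E (p, X q) - E (q, X q))) \<longlongrightarrow> 0) (at q)"
      by (auto intro: tendsto_eq_intros)
    then have "((\<lambda>p. X p - X q) \<longlongrightarrow> 0) (at q)"
      by (rule Lim_null_comparison[rotated]) (use le in auto)
    then show ?thesis by (simp add: isCont_def LIM_zero_iff)
  qed
  then show ?case by (simp add: continuous_at_imp_continuous_on)
next
  case (Suc k)
  note Ck = Suc.prems(1) and lip = Suc.prems(2) and fx = Suc.prems(3)
  have XC: "Ck k X" using Suc.IH[OF Ck_Suc_imp[OF Ck] lip fx] .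
  define D where "D = (\<lambda>q. frechet_derivative E (at (q, X q)))"
  have DE: "(E has_derivative D q) (at (q, X q))" for q
    unfolding D_def by (rule Ck_SucD(1)[OF Ck])
  have lin: "linear (D q)" for q using DE has_derivative_linear by blast
  have half: "norm (D q (0, y)) \<le> (1/2) * norm y" for q y
  proof (rule Lipschitz_derivative_bound)
    show "((\<lambda>x. E (q, x)) has_derivative (\<lambda>y. D q (0, y))) (at (X q))"
      by (rule has_derivative_compose[of "\<lambda>x. (q, x)" "\<lambda>y. (0, y)", OF _ DE])
        (auto intro!: derivative_eq_intros)
  qed (rule lip)
  have Ddiff: "D q (v, x) - D q (v, y) = D q (0, x - y)" for q v x y
    using linear_diff[OF lin, of q "(v, x)" "(v, y)"] by simp
  \<comment> \<open>The candidate for the derivative: formal differentiation of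
    \<open>X q = E (q, X q)\<close> in direction v gives this equation, again a half contraction in
    y.\<close>
  have "\<exists>y. y = D q (v, y)" for q v
    by (rule half_contraction_fixpoint) (simp only: Ddiff half)
  then obtain Y where Y: "\<And>q v. Y q v = D q (v, Y q v)" by metis
  have uniq: "y = Y q v" if "y = D q (v, y)" for q v y
    by (rule half_contraction_unique) (metis that Y Ddiff half)
  have linY: "linear (Y q)" for q
  proof (rule linearI)
    show "Y q (v + w) = Y q v + Y q w" for v w
      using uniq[of "Y q v + Y q w" q "v + w"] linear_add[OF lin, of q "(v, Y q v)" "(w, Y q w)"] Y
      by (metis add_Pair)
    show "Y q (c *\<^sub>R v) = c *\<^sub>R Y q v" for c v
      using uniq[of "c *\<^sub>R Y q v" q "c *\<^sub>R v"] linear_cmul[OF lin, of q c "(v, Y q v)"] Y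
      by (metis scaleR_Pair)
  qed
  have der: "(X has_derivative Y q) (at q)" for q
    unfolding has_derivative_at_alt
  proof (intro conjI allI impI)
    show bl: "bounded_linear (Y q)" using linY linear_conv_bounded_linear by blast
    obtain M where M: "M > 0" "\<And>v. norm (Y q v) \<le> norm v * M"
      using bounded_linear.pos_bounded[OF bl] by blast
    fix e :: real assume "e > 0"
    \<comment> \<open>The bound 1/4 lets the term with \<open>R\<close> on the right of the final
      estimate be absorbed; the other bound yields the factor e after the absorption.\<close>
    define e' where "e' = min (1/4) (e / (4 * (1 + M)))"
    have e': "e' > 0" "e' \<le> 1/4" using \<open>e > 0\<close> M unfolding e'_def by (simp, intro min.cobounded1)
    have "e' \<le> e / (4 * (1 + M))" by (simp add: e'_def)
    then have e'M: "4 * e' * (1 + M) \<le> e" using M by (simp add: pos_le_divide_eq mult_ac)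
    obtain d where d: "d > 0" "\<And>y. norm (y - (q, X q)) < d \<Longrightarrow>
       norm (E y - E (q, X q) - D q (y - (q, X q))) \<le> e' * norm (y - (q, X q))"
      using DE[of q] e' unfolding has_derivative_at_alt by blast
    have "isCont X q" using Ck_continuous[OF XC] by (simp add: continuous_on_eq_continuous_at)
    then obtain d' where d': "d' > 0" "\<And>p. dist p q < d' \<Longrightarrow> dist (X p) (X q) < d / 2"
      using d(1) unfolding continuous_at_eps_delta by (metis half_gt_zero)
    show "\<exists>d>0. \<forall>p. norm (p - q) < d \<longrightarrow> norm (X p - X q - Y q (p - q)) \<le> e * norm (p - q)"
    proof (intro exI[of _ "min (d/2) d'"] conjI allI impI)
      show "0 < min (d/2) d'" using d d' by simp
      fix p assume p: "norm (p - q) < min (d/2) d'"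
      define \<xi> where "\<xi> = X p - X q"
      have \<xi>: "norm \<xi> < d / 2" using d'(2)[of p] p by (simp add: dist_norm \<xi>_def)
      have nP: "norm (p - q, \<xi>) \<le> norm (p - q) + norm \<xi>" by (rule norm_Pair_le)
      then have "norm (p - q, \<xi>) < d" using \<xi> p by simp
      then have "norm (\<xi> - D q (p - q, \<xi>)) \<le> e' * norm (p - q, \<xi>)"
        using d(2)[of "(p, X p)"] fx[of p] fx[of q] by (simp add: \<xi>_def)
      also have "\<dots> \<le> e' * (norm (p - q) + norm \<xi>)"
        using nP e' by (intro mult_left_mono) auto
      finally have 1: "norm (\<xi> - D q (p - q, \<xi>)) \<le> e' * (norm (p - q) + norm \<xi>)" .
      define R where "R = norm (\<xi> - Y q (p - q))"
      \<comment> \<open>The error solves the linearized equation up to the remainder of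
        \<open>E\<close>, so the contraction absorbs half of it.\<close>
      have "\<xi> - Y q (p - q) = (\<xi> - D q (p - q, \<xi>)) + D q (0, \<xi> - Y q (p - q))"
        unfolding Ddiff[of q "p - q" \<xi> "Y q (p - q)", symmetric] Y[of q "p - q", symmetric] by simp
      then have "R \<le> norm (\<xi> - D q (p - q, \<xi>)) + (1/2) * R"
        unfolding R_def using norm_triangle_ineq half by (metis add_left_mono order_trans)
      then have 2: "R \<le> 2 * e' * (norm (p - q) + norm \<xi>)" using 1 by simp
      have "norm \<xi> \<le> R + norm (Y q (p - q))"
        unfolding R_def using norm_triangle_ineq[of "\<xi> - Y q (p - q)" "Y q (p - q)"] by simp
      then have "norm \<xi> \<le> R + norm (p - q) * M" using M(2)[of "p - q"] by simp
      then have "2 * e' * (norm (p - q) + norm \<xi>) \<le> 2 * e' * (norm (p - q) + (R + norm (p - q) * M))"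
        using e' by (intro mult_left_mono) auto
      with 2 have 3: "R \<le> 2 * e' * (1 + M) * norm (p - q) + 2 * e' * R"
        by (simp add: algebra_simps)
      have "R \<ge> 0" by (simp add: R_def)
      then have "2 * e' * R \<le> (1/2) * R" using e' by (intro mult_right_mono) auto
      with 3 have "R \<le> 4 * e' * (1 + M) * norm (p - q)" by simp
      also have "\<dots> \<le> e * norm (p - q)" using e'M by (intro mult_right_mono) auto
      finally show "norm (X p - X q - Y q (p - q)) \<le> e * norm (p - q)"
        by (simp add: R_def \<xi>_def)
    qed
  qed
  show ?case
  proof (rule Ck_SucI[OF der])
    fix v
    \<comment> \<open>The derivative in direction v is the fixed point of this affine contraction.
      Its coefficients are C^k because the derivative of \<open>E\<close> and, by induction,
      \<open>X\<close> are.\<close>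
    define E' where "E' = (\<lambda>p. D (fst p) (v, 0) + (\<Sum>b\<in>Basis. (snd p \<bullet> b) *\<^sub>R D (fst p) (0, b)))"
    have E'_eq: "E' (q, y) = D q (v, y)" for q y
    proof -
      have "D q (v, y) = D q (v, 0) + D q (0, y)"
        using linear_add[OF lin, of q "(v, 0)" "(0, y)"] by simp
      also have "(0, y) = (\<Sum>b\<in>Basis. (y \<bullet> b) *\<^sub>R (0, b))"
        by (rule prod_eqI) (simp_all add: fst_sum snd_sum euclidean_representation)
      also have "D q \<dots> = (\<Sum>b\<in>Basis. (y \<bullet> b) *\<^sub>R D q (0, b))"
        by (simp only: linear_sum[OF lin] linear_cmul[OF lin])
      finally show ?thesis by (simp add: E'_def)
    qed
    have CD: "Ck k (\<lambda>p::'q \<times> 'x. D (fst p) w)" for w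
      unfolding D_def
      by (intro Ck_compose[OF Ck_SucD(2)[OF Ck]] Ck_Pair Ck_compose[OF XC] 
          Ck_bounded_linear bounded_linear_fst)
    have CE': "Ck k E'" unfolding E'_def
      by (intro Ck_add Ck_sum CD bounded_bilinear.Ck_prod[OF bounded_bilinear_scaleR] 
          bounded_bilinear.Ck_prod[OF bounded_bilinear_inner] Ck_const
          Ck_bounded_linear bounded_linear_snd)
    show "Ck k (\<lambda>q. Y q v)"
      by (rule Suc.IH[OF CE']) (simp_all only: E'_eq Ddiff half Y[symmetric])
  qed
qed

lemma smooth_fixpoint:
  fixes E :: "'q::euclidean_space \<times> 'x::euclidean_space \<Rightarrow> 'x"
  assumes "smooth E" and "\<And>q x y. norm (E (q, x) - E (q, y)) \<le> (1/2) * norm (x - y)"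
    and "\<And>q. X q = E (q, X q)"
  shows "smooth X"
  using assms by (auto simp: smooth_iff intro: Ck_fixpoint[of _ E X])

subsection \<open>Partial derivatives of families\<close>

text \<open>The parameter z stays part of the point, so smoothness is joint in (z, x) while
  differentiation concerns x only. \<open>Dlist_slice\<close> connects this with the partial
  derivatives of a slice.\<close>

definition dirx :: "'m::finite \<Rightarrow> ('z::real_normed_vector \<times> (real^'m) \<Rightarrow> 'b::real_normed_vector) \<Rightarrow> 'z \<times> (real^'m) \<Rightarrow> 'b" where
  "dirx i f y = frechet_derivative f (at y) (0, axis i 1)"

fun DL :: "'m::finite list \<Rightarrow> ('z::real_normed_vector \<times> (real^'m) \<Rightarrow> 'b::real_normed_vector) \<Rightarrow> 'z \<times> (real^'m) \<Rightarrow> 'b" where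
  "DL [] f = f"
| "DL (i # is) f = dirx i (DL is f)"

lemma dirxI: "(f has_derivative f') (at y) \<Longrightarrow> dirx i f y = f' (0, axis i 1)"
  unfolding dirx_def using frechet_derivative_at by metis

lemma smooth_dirx [smooth_intros]: "smooth f \<Longrightarrow> smooth (dirx i f)"
  unfolding dirx_def[abs_def] by (rule smooth_frechet_derivative)

lemma smooth_DL [smooth_intros]: "smooth f \<Longrightarrow> smooth (DL is f)"
  by (induction "is") (auto intro: smooth_intros)

lemma dirx_add: "smooth f \<Longrightarrow> smooth g \<Longrightarrow> dirx i (\<lambda>y. f y + g y) = (\<lambda>y. dirx i f y + dirx i g y)"
  by (rule ext, subst dirxI[OF has_derivative_add[OF smooth_has_derivative smooth_has_derivative]])
    (auto simp: dirx_def)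

lemma dirx_scaleR: 
  fixes f :: "'z::real_normed_vector \<times> (real^'m::finite) \<Rightarrow> real"
  shows "smooth f \<Longrightarrow> dirx i (\<lambda>y. f y *\<^sub>R a) = (\<lambda>y. dirx i f y *\<^sub>R a)"
  by (rule ext, subst dirxI[OF has_derivative_scaleR_left[OF smooth_has_derivative]])
    (auto simp: dirx_def)

lemma dirx_mult: 
  fixes f g :: "'z::real_normed_vector \<times> (real^'m::finite) \<Rightarrow> real"
  shows "smooth f \<Longrightarrow> smooth g \<Longrightarrow> dirx i (\<lambda>y. f y * g y) = (\<lambda>y. f y * dirx i g y + dirx i f y * g y)"
  by (rule ext, subst dirxI[OF has_derivative_mult[OF smooth_has_derivative smooth_has_derivative]])
    (auto simp: dirx_def)

lemma dirx_const: "dirx i (\<lambda>y. c) = (\<lambda>y. 0)"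
  by (rule ext, subst dirxI[OF has_derivative_const]) auto

lemma dirx_cmult: 
  fixes f :: "'z::real_normed_vector \<times> (real^'m::finite) \<Rightarrow> real"
  shows "smooth f \<Longrightarrow> dirx i (\<lambda>y. c * f y) = (\<lambda>y. c * dirx i f y)"
  by (subst dirx_mult) (auto simp: smooth_const dirx_const)

lemma dirx_sum: 
  assumes "\<And>j. j \<in> J \<Longrightarrow> smooth (f j)"
  shows "dirx i (\<lambda>y. \<Sum>j\<in>J. f j y) = (\<lambda>y. \<Sum>j\<in>J. dirx i (f j) y)"
  using assms by (induction J rule: infinite_finite_induct) (simp_all add: dirx_const dirx_add smooth_sum)

lemma dirx_compose_real: 
  fixes f :: "'z::real_normed_vector \<times> (real^'m::finite) \<Rightarrow> real" and P :: "real \<Rightarrow> real"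
  assumes "smooth f" "smooth P" 
  shows "dirx i (\<lambda>y. P (f y)) = (\<lambda>y. deriv P (f y) * dirx i f y)"
proof
  fix y
  have "((\<lambda>y. P (f y)) has_derivative (\<lambda>v. deriv P (f y) * frechet_derivative f (at y) v)) (at y)"
    using has_derivative_compose[OF smooth_has_derivative[OF assms(1)] 
        smooth_has_real_derivative[OF assms(2), unfolded has_field_derivative_def]] .
  then show "dirx i (\<lambda>y. P (f y)) y = deriv P (f y) * dirx i f y"
    using dirxI by (simp add: dirx_def)
qed

lemma dirx_vanish:
  assumes "open U" "\<And>y. y \<in> U \<Longrightarrow> f y = 0" "y \<in> U"
  shows "dirx i f y = 0"
proof -
  have "((\<lambda>y. 0) has_derivative (\<lambda>v. 0)) (at y)" by simp
  then have "(f has_derivative (\<lambda>v. 0)) (at y)"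
    by (rule has_derivative_transform_within_open[OF _ assms(1,3)]) (simp add: assms(2))
  then show ?thesis by (simp add: dirxI)
qed

lemma DL_vanish: "open U \<Longrightarrow> (\<And>y. y \<in> U \<Longrightarrow> f y = 0) \<Longrightarrow> y \<in> U \<Longrightarrow> DL is f y = 0"
  by (induction "is" arbitrary: y) (auto intro: dirx_vanish)

lemma DL_add: "smooth f \<Longrightarrow> smooth g \<Longrightarrow> DL is (\<lambda>y. f y + g y) = (\<lambda>y. DL is f y + DL is g y)"
  by (induction "is") (simp_all add: dirx_add smooth_DL)

lemma DL_scaleR: 
  fixes f :: "'z::real_normed_vector \<times> (real^'m::finite) \<Rightarrow> real"
  shows "smooth f \<Longrightarrow> DL is (\<lambda>y. f y *\<^sub>R a) = (\<lambda>y. DL is f y *\<^sub>R a)"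
  by (induction "is") (simp_all add: dirx_scaleR smooth_DL)

lemma DL_cmult: 
  fixes f :: "'z::real_normed_vector \<times> (real^'m::finite) \<Rightarrow> real"
  shows "smooth f \<Longrightarrow> DL is (\<lambda>y. c * f y) = (\<lambda>y. c * DL is f y)"
  by (induction "is") (simp_all add: dirx_cmult smooth_DL)

lemma has_derivative_slice:
  assumes "smooth f"
  shows "((\<lambda>x. f (z, x)) has_derivative (\<lambda>v. frechet_derivative f (at (z, x)) (0, v))) (at x)"
  by (rule has_derivative_compose[of "\<lambda>x. (z, x)" "\<lambda>y. (0, y)", OF _ smooth_has_derivative[OF assms]])
     (auto intro!: derivative_eq_intros)

lemma smooth_slice: 
  fixes f :: "'z::euclidean_space \<times> 'x::euclidean_space \<Rightarrow> 'b::real_normed_vector"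
  shows "smooth f \<Longrightarrow> smooth (\<lambda>x. f (z, x))"
  by (rule smooth_compose) (auto intro: smooth_intros)

lemma Dlist_slice: "smooth f \<Longrightarrow> Dlist is (\<lambda>x. f (z, x)) = (\<lambda>x. DL is f (z, x))"
proof (induction "is")
  case (Cons i js)
  have "frechet_derivative (\<lambda>x. DL js f (z, x)) (at x) = (\<lambda>v. frechet_derivative (DL js f) (at (z, x)) (0, v))" for x
    using frechet_derivative_at[OF has_derivative_slice[OF smooth_DL[OF Cons.prems]]] by metis
  then show ?case using Cons by (simp add: dirx_def)
qed simp

subsection \<open>Rapidly oscillating functions\<close>

text \<open>The coefficient of s^j times the j-th derivative of P at s \<phi> + \<theta> in the
  iterated derivative of c P(s \<phi> + \<theta>). A derivative either falls on the coefficient, or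
  raises j by one and brings down s and a derivative of \<phi>.\<close>

fun osc_coeff :: "('z::real_normed_vector \<times> (real^'m::finite) \<Rightarrow> real) \<Rightarrow> ('z \<times> (real^'m) \<Rightarrow> real) \<Rightarrow> 'm list \<Rightarrow> nat \<Rightarrow> 'z \<times> (real^'m) \<Rightarrow> real" where
  "osc_coeff c \<phi> [] j = (\<lambda>y. if j = 0 then c y else 0)"
| "osc_coeff c \<phi> (i # is) j = 
    (\<lambda>y. dirx i (osc_coeff c \<phi> is j) y + (if j = 0 then 0 else osc_coeff c \<phi> is (j - 1) y * dirx i \<phi> y))"

lemma smooth_osc_coeff: 
  assumes "smooth c" "smooth \<phi>"
  shows "smooth (osc_coeff c \<phi> is j)"
proof (induction "is" arbitrary: j)
  case Nil
  then show ?case using assms by (cases "j = 0") (auto intro: smooth_intros)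
next
  case (Cons i js)
  then show ?case using assms by (cases "j = 0") (auto intro!: smooth_intros)
qed

lemma osc_coeff_vanish: 
  assumes "open U" "\<And>y. y \<in> U \<Longrightarrow> c y = 0" "y \<in> U"
  shows "osc_coeff c \<phi> is j y = 0"
  using assms(3)
proof (induction "is" arbitrary: j y)
  case (Cons i js)
  then show ?case using dirx_vanish[OF assms(1) Cons.IH] by simp
qed (simp add: assms)

lemma osc_coeff_beyond: "j > length is \<Longrightarrow> osc_coeff c \<phi> is j = (\<lambda>y. 0)"
  by (induction "is" arbitrary: j) (auto simp: dirx_const)

text \<open>The top index is reached only when every derivative falls on P, so no derivative of
  \<open>c\<close> appears.\<close>

lemma osc_coeff_lead: "osc_coeff c \<phi> is (length is) y = c y * (\<Prod>i\<leftarrow>is. dirx i \<phi> y)"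
  by (induction "is") (simp_all add: osc_coeff_beyond dirx_const)

lemma DL_osc:
  assumes "smooth c" "smooth \<phi>" "smooth P"
  shows "DL is (\<lambda>y. c y * P (s * \<phi> y + \<theta>)) =
    (\<lambda>y. \<Sum>j\<le>length is. s ^ j * (osc_coeff c \<phi> is j y * (deriv ^^ j) P (s * \<phi> y + \<theta>)))"
proof (induction "is")
  case (Cons i js)
  let ?n = "length js" and ?a = "osc_coeff c \<phi> js" and ?P = "\<lambda>j y. (deriv ^^ j) P (s * \<phi> y + \<theta>)"
  have sa: "smooth (?a j)" for j by (rule smooth_osc_coeff[OF assms(1,2)])
  have sl: "smooth (\<lambda>y. s * \<phi> y + \<theta>)" using assms by (intro smooth_intros)
  have sP: "smooth (?P j)" for j
    by (rule smooth_compose[OF smooth_deriv_iter[OF assms(3)] sl])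
  have dP: "dirx i (?P j) = (\<lambda>y. ?P (Suc j) y * (s * dirx i \<phi> y))" for j
    using dirx_compose_real[OF sl smooth_deriv_iter[OF assms(3)], of i j]
      dirx_add[of "\<lambda>y. s * \<phi> y" "\<lambda>y. \<theta>" i] assms(2)
    by (simp add: dirx_cmult dirx_const smooth_mult smooth_const)
  have "dirx i (\<lambda>y. s ^ j * (?a j y * ?P j y)) = 
     (\<lambda>y. s ^ j * (dirx i (?a j) y * ?P j y) + s ^ Suc j * (?a j y * dirx i \<phi> y * ?P (Suc j) y))" for j
    by (simp add: dirx_cmult dirx_mult smooth_mult sa sP dP) (simp add: algebra_simps)
  then have "DL (i # js) (\<lambda>y. c y * P (s * \<phi> y + \<theta>)) = 
     (\<lambda>y. (\<Sum>j\<le>?n. s ^ j * (dirx i (?a j) y * ?P j y)) + 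
          (\<Sum>j\<le>?n. s ^ Suc j * (?a j y * dirx i \<phi> y * ?P (Suc j) y)))"
    by (simp add: Cons.IH dirx_sum smooth_mult smooth_const sa sP sum.distrib)
  also have "\<dots> = (\<lambda>y. \<Sum>j\<le>length (i # js). s ^ j * (osc_coeff c \<phi> (i # js) j y * ?P j y))"
  proof
    fix y
    \<comment> \<open>Both sums are brought to the range \<open>j \<le> Suc ?n\<close>: the first by
      a zero term beyond the length, the second by shifting j, with value 0 at j = 0.\<close>
    have 1: "(\<Sum>j\<le>?n. s ^ j * (dirx i (?a j) y * ?P j y)) = (\<Sum>j\<le>Suc ?n. s ^ j * (dirx i (?a j) y * ?P j y))"
      by (simp add: osc_coeff_beyond dirx_const)
    have 2: "(\<Sum>j\<le>?n. s ^ Suc j * (?a j y * dirx i \<phi> y * ?P (Suc j) y)) = 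
      (\<Sum>j\<le>Suc ?n. s ^ j * ((if j = 0 then 0 else ?a (j - 1) y * dirx i \<phi> y) * ?P j y))"
      by (simp add: sum.atMost_Suc_shift del: sum.atMost_Suc)
    show "(\<Sum>j\<le>?n. s ^ j * (dirx i (?a j) y * ?P j y)) + 
          (\<Sum>j\<le>?n. s ^ Suc j * (?a j y * dirx i \<phi> y * ?P (Suc j) y)) = 
      (\<Sum>j\<le>length (i # js). s ^ j * (osc_coeff c \<phi> (i # js) j y * ?P j y))"
      unfolding 1 2 sum.distrib[symmetric] by (simp add: distrib_left distrib_right)
  qed
  finally show ?case .
qed simp

lemma compact_support_bounded:
  fixes f :: "'y::euclidean_space \<Rightarrow> 'b::real_normed_vector"
  assumes "smooth f" "compact K" "\<And>y. y \<notin> K \<Longrightarrow> f y = 0"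
  shows "\<exists>M\<ge>0. \<forall>y. norm (f y) \<le> M"
proof -
  have "compact (f ` K)" using smooth_continuous[OF assms(1)] assms(2) by (intro compact_continuous_image)
  then obtain M where "\<forall>y\<in>K. norm (f y) \<le> M" using compact_imp_bounded[of "f ` K"] by (auto simp: bounded_iff)
  then show ?thesis using assms(3) by (intro exI[of _ "max M 0"]) (metis max.coboundedI1 max.cobounded2 norm_zero)
qed

text \<open>With s = 1/\<eta> the factor \<eta>^r turns s^j into \<eta>^(r-j), so every term but j =
  r is of order \<eta>. Compact support of \<open>c\<close> bounds the coefficients uniformly in y,
  and the bounded derivatives of P make the constant independent of \<theta> and \<eta>.\<close>

lemma osc_estimate:
  fixes c \<phi> :: "'z::euclidean_space \<times> (real^'m::finite) \<Rightarrow> real"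
  assumes c: "smooth c" "compact K" "\<And>y. y \<notin> K \<Longrightarrow> c y = 0" and \<phi>: "smooth \<phi>"
    and P: "smooth P" "\<And>j. \<exists>M. \<forall>t. \<bar>(deriv ^^ j) P t\<bar> \<le> M"
    and len: "length is \<le> r"
  shows "\<exists>C\<ge>0. \<forall>\<eta>. 0 < \<eta> \<and> \<eta> \<le> 1 \<longrightarrow> (\<forall>\<theta> y. 
    \<bar>DL is (\<lambda>y. \<eta> ^ r * (c y * P (\<phi> y / \<eta> + \<theta>))) y 
      - (if length is = r then c y * (deriv ^^ r) P (\<phi> y / \<eta> + \<theta>) * (\<Prod>i\<leftarrow>is. dirx i \<phi> y) else 0)\<bar> \<le> C * \<eta>)"
proof -
  let ?n = "length is" and ?a = "osc_coeff c \<phi> is"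
  have "\<exists>M\<ge>0. \<forall>y. norm (?a j y) \<le> M" for j
  proof (rule compact_support_bounded[OF smooth_osc_coeff[OF c(1) \<phi>] c(2)])
    show "?a j y = 0" if "y \<notin> K" for y
      using osc_coeff_vanish[of "- K" c y \<phi> "is" j] that c compact_imp_closed by auto
  qed
  then obtain A where A: "\<And>j. A j \<ge> 0" "\<And>j y. \<bar>?a j y\<bar> \<le> A j" by (metis real_norm_def)
  obtain B where B: "\<And>j t. \<bar>(deriv ^^ j) P t\<bar> \<le> B j" using P(2) by metis
  have B0: "B j \<ge> 0" for j using B[of j 0] by linarith
  define C where "C = (\<Sum>j\<le>?n. A j * B j)"
  have "C \<ge> 0" unfolding C_def by (intro sum_nonneg mult_nonneg_nonneg A B0)
  moreover have "\<bar>DL is (\<lambda>y. \<eta> ^ r * (c y * P (\<phi> y / \<eta> + \<theta>))) y 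
      - (if ?n = r then c y * (deriv ^^ r) P (\<phi> y / \<eta> + \<theta>) * (\<Prod>i\<leftarrow>is. dirx i \<phi> y) else 0)\<bar> \<le> C * \<eta>"
    if \<eta>: "0 < \<eta>" "\<eta> \<le> 1" for \<eta> \<theta> y
  proof -
    let ?t = "\<phi> y / \<eta> + \<theta>"
    have sm: "smooth (\<lambda>y. c y * P (\<phi> y / \<eta> + \<theta>))"
      by (intro smooth_mult c smooth_compose[OF P(1)] smooth_intros \<phi>)
    define T where "T = (\<lambda>j. \<eta> ^ (r - j) * (?a j y * (deriv ^^ j) P ?t))"
    have "DL is (\<lambda>y. \<eta> ^ r * (c y * P (\<phi> y / \<eta> + \<theta>))) y =
      \<eta> ^ r * (\<Sum>j\<le>?n. (1/\<eta>) ^ j * (?a j y * (deriv ^^ j) P ?t))"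
      using DL_osc[OF c(1) \<phi> P(1), of "is" "1/\<eta>" \<theta>] by (simp add: DL_cmult sm)
    also have "\<dots> = (\<Sum>j\<le>?n. T j)"
      unfolding sum_distrib_left
    proof (rule sum.cong)
      fix j assume "j \<in> {..?n}"
      then have "\<eta> ^ r = \<eta> ^ (r - j) * \<eta> ^ j" using len by (simp add: power_add[symmetric])
      then show "\<eta> ^ r * ((1/\<eta>) ^ j * (?a j y * (deriv ^^ j) P ?t)) = T j"
        using \<eta> by (simp add: T_def power_divide)
    qed simp
    finally have eq: "DL is (\<lambda>y. \<eta> ^ r * (c y * P (\<phi> y / \<eta> + \<theta>))) y = (\<Sum>j\<le>?n. T j)" .
    have T: "\<bar>T j\<bar> \<le> (A j * B j) * \<eta>" if "j < r" for j
    proof -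
      have "\<eta> ^ (r - j) \<le> \<eta>" using that \<eta> power_decreasing[of 1 "r - j" \<eta>] by simp
      then have "\<eta> ^ (r - j) * (\<bar>?a j y\<bar> * \<bar>(deriv ^^ j) P ?t\<bar>) \<le> \<eta> * (A j * B j)"
        using \<eta> A B B0 by (intro mult_mono) auto
      then show ?thesis using \<eta> by (simp add: T_def abs_mult mult_ac)
    qed
    show ?thesis
    proof (cases "?n = r")
      case True
      have "T r = c y * (deriv ^^ r) P ?t * (\<Prod>i\<leftarrow>is. dirx i \<phi> y)"
        using osc_coeff_lead[of c \<phi> "is" y] True by (simp add: T_def)
      moreover have "(\<Sum>j\<le>?n. T j) = (\<Sum>j<r. T j) + T r" using True by (simp add: lessThan_Suc_atMost[symmetric])
      moreover have "\<bar>\<Sum>j<r. T j\<bar> \<le> (\<Sum>j<r. (A j * B j) * \<eta>)"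
        using T by (intro order.trans[OF sum_abs] sum_mono) auto
      moreover have "(\<Sum>j<r. (A j * B j) * \<eta>) \<le> C * \<eta>"
        unfolding C_def sum_distrib_right using True A B0 \<eta> by (intro sum_mono2) auto
      ultimately show ?thesis using True eq by simp
    next
      case False
      have "\<bar>\<Sum>j\<le>?n. T j\<bar> \<le> (\<Sum>j\<le>?n. (A j * B j) * \<eta>)"
        using T len False by (intro order.trans[OF sum_abs] sum_mono) auto
      then show ?thesis using False eq by (simp add: C_def sum_distrib_right)
    qed
  qed
  ultimately show ?thesis by blast
qed

lemma osc_estimate_uniform:
  fixes c \<phi> :: "'z::euclidean_space \<times> (real^'m::finite) \<Rightarrow> real"
  assumes c: "smooth c" "compact K" "\<forall>y. y \<notin> K \<longrightarrow> c y = 0" and \<phi>: "smooth \<phi>"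
    and P: "smooth P" "\<And>j. \<exists>M. \<forall>t. \<bar>(deriv ^^ j) P t\<bar> \<le> M" and E: "E > 0"
  shows "\<exists>\<eta>0>0. \<forall>\<eta>. 0 < \<eta> \<and> \<eta> \<le> \<eta>0 \<longrightarrow> (\<forall>\<theta> y is. length is \<le> r \<longrightarrow>
    \<bar>DL is (\<lambda>y. \<eta> ^ r * (c y * P (\<phi> y / \<eta> + \<theta>))) y 
      - (if length is = r then c y * (deriv ^^ r) P (\<phi> y / \<eta> + \<theta>) * (\<Prod>i\<leftarrow>is. dirx i \<phi> y) else 0)\<bar> < E)"
proof -
  let ?L = "{is::'m list. length is \<le> r}"
  have fin: "finite ?L" using finite_lists_length_le[of "UNIV::'m set" r] by simp
  have "\<forall>is\<in>?L. \<exists>C\<ge>0. \<forall>\<eta>. 0 < \<eta> \<and> \<eta> \<le> 1 \<longrightarrow> (\<forall>\<theta> y. 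
    \<bar>DL is (\<lambda>y. \<eta> ^ r * (c y * P (\<phi> y / \<eta> + \<theta>))) y 
      - (if length is = r then c y * (deriv ^^ r) P (\<phi> y / \<eta> + \<theta>) * (\<Prod>i\<leftarrow>is. dirx i \<phi> y) else 0)\<bar> \<le> C * \<eta>)"
    using osc_estimate[OF c(1,2) c(3)[rule_format] \<phi> P] by blast
  from bchoice[OF this] obtain C where C: "\<forall>is\<in>?L. C is \<ge> 0 \<and> (\<forall>\<eta>. 0 < \<eta> \<and> \<eta> \<le> 1 \<longrightarrow> (\<forall>\<theta> y. 
    \<bar>DL is (\<lambda>y. \<eta> ^ r * (c y * P (\<phi> y / \<eta> + \<theta>))) y 
      - (if length is = r then c y * (deriv ^^ r) P (\<phi> y / \<eta> + \<theta>) * (\<Prod>i\<leftarrow>is. dirx i \<phi> y) else 0)\<bar> \<le> C is * \<eta>))"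
    by (elim exE)
  define D where "D = (\<Sum>is\<in>?L. C is)"
  have D0: "D \<ge> 0" unfolding D_def using C by (intro sum_nonneg) blast
  have CD: "C is \<le> D" if "is \<in> ?L" for "is"
    unfolding D_def using C fin that by (intro member_le_sum) blast+
  show ?thesis
  proof (intro exI[of _ "min 1 (E / (D + 1))"] conjI allI impI)
    show "0 < min 1 (E / (D + 1))" using E D0 by simp
    fix \<eta> :: real and \<theta> y and "is" :: "'m list"
    assume \<eta>: "0 < \<eta> \<and> \<eta> \<le> min 1 (E / (D + 1))" and len: "length is \<le> r"
    have "C is * \<eta> \<le> D * \<eta>" using CD len \<eta> by (intro mult_right_mono) auto
    also have "\<dots> < (D + 1) * \<eta>" using \<eta> by (simp add: distrib_right)
    also have "\<dots> \<le> E"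
    proof -
      have "\<eta> \<le> E / (D + 1)" using \<eta> by simp
      then show ?thesis using D0 by (simp add: pos_le_divide_eq mult.commute)
    qed
    finally have lt: "C is * \<eta> < E" .
    have "0 < \<eta> \<and> \<eta> \<le> 1" using \<eta> by simp
    with C len show "\<bar>DL is (\<lambda>y. \<eta> ^ r * (c y * P (\<phi> y / \<eta> + \<theta>))) y 
      - (if length is = r then c y * (deriv ^^ r) P (\<phi> y / \<eta> + \<theta>) * (\<Prod>i\<leftarrow>is. dirx i \<phi> y) else 0)\<bar> < E"
      using order_le_less_trans[OF _ lt] by blast
  qed
qed

subsection \<open>A single rank one term\<close>

definition gradx :: "('z::real_normed_vector \<times> (real^'m::finite) \<Rightarrow> real) \<Rightarrow> 'z \<times> (real^'m) \<Rightarrow> real^'m" where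
  "gradx f y = (\<chi> i. dirx i f y)"

lemma smooth_vec_lambda [smooth_intros]:
  fixes f :: "'i::finite \<Rightarrow> 'a::real_normed_vector \<Rightarrow> real"
  assumes "\<And>i. smooth (f i)" shows "smooth (\<lambda>y. \<chi> i. f i y)"
proof -
  have "(\<chi> i. f i y) = (\<Sum>i\<in>UNIV. f i y *\<^sub>R axis i 1)" for y
    by (simp add: vec_eq_iff axis_def if_distrib cong: if_cong)
  then show ?thesis by (simp only:) (intro smooth_intros assms)
qed

lemma smooth_gradx [smooth_intros]: "smooth f \<Longrightarrow> smooth (gradx f)"
  unfolding gradx_def[abs_def] by (intro smooth_intros)

lemma vec_eq_sum_axis: "v = (\<Sum>i\<in>UNIV. (v $ i) *\<^sub>R axis i (1::real))"
  by (simp add: vec_eq_iff axis_def if_distrib cong: if_cong)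

lemma frechet_derivative_dirx:
  fixes f :: "'z::real_normed_vector \<times> (real^'m::finite) \<Rightarrow> 'b::real_normed_vector"
  assumes "smooth f"
  shows "frechet_derivative f (at y) (0, v) = (\<Sum>i\<in>UNIV. (v $ i) *\<^sub>R dirx i f y)"
proof -
  have lin: "linear (frechet_derivative f (at y))"
    using smooth_has_derivative[OF assms] has_derivative_linear by blast
  have "(0::'z, v) = (\<Sum>i\<in>UNIV. (v $ i) *\<^sub>R (0, axis i 1))"
    by (rule prod_eqI) (simp_all add: fst_sum snd_sum vec_eq_sum_axis[symmetric])
  then show ?thesis
    by (simp only: linear_sum[OF lin] linear_cmul[OF lin] dirx_def)
qed

lemma frechet_derivative_gradx:
  "smooth f \<Longrightarrow> frechet_derivative f (at y) (0, v) = gradx f y \<bullet> v"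
  by (simp add: frechet_derivative_dirx gradx_def inner_vec_def mult.commute)

lemma Lipschitz_in_x:
  fixes B :: "'z::euclidean_space \<times> (real^'m::finite) \<Rightarrow> 'b::real_normed_vector"
  assumes "smooth B" "compact K" "\<And>y. y \<notin> K \<Longrightarrow> B y = 0"
  shows "\<exists>L>0. \<forall>z x x'. norm (B (z, x) - B (z, x')) \<le> L * norm (x - x')"
proof -
  have "\<exists>M\<ge>0. \<forall>y. norm (dirx i B y) \<le> M" for i
  proof (rule compact_support_bounded[OF smooth_dirx[OF assms(1)] assms(2)])
    show "dirx i B y = 0" if "y \<notin> K" for y
      using dirx_vanish[of "- K" B y i] that assms compact_imp_closed by auto
  qed
  then obtain M where M: "\<And>i. M i \<ge> 0" "\<And>i y. norm (dirx i B y) \<le> M i" by metis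
  \<comment> \<open>The summand 1 makes L positive, so that amplitudes can later be bounded by a
    multiple of 1/L.\<close>
  define L where "L = (\<Sum>i\<in>UNIV. M i) + 1"
  have "norm (B (z, x) - B (z, x')) \<le> L * norm (x - x')" for z x x'
  proof (rule differentiable_bound[of UNIV])
    show "((\<lambda>x. B (z, x)) has_derivative (\<lambda>v. frechet_derivative B (at (z, x)) (0, v))) (at x within UNIV)" for x
      using has_derivative_slice[OF assms(1)] by simp
    show "onorm (\<lambda>v. frechet_derivative B (at (z, x)) (0, v)) \<le> L" for x
    proof (rule onorm_le)
      fix v :: "real^'m"
      have "norm (frechet_derivative B (at (z, x)) (0, v)) \<le> (\<Sum>i\<in>UNIV. norm ((v $ i) *\<^sub>R dirx i B (z, x)))"
        unfolding frechet_derivative_dirx[OF assms(1)] by (rule norm_sum)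
      also have "\<dots> \<le> (\<Sum>i\<in>UNIV. M i * norm v)"
        using M component_le_norm_cart[of v]
        by (intro sum_mono) (subst mult.commute, simp add: mult_mono)
      also have "\<dots> \<le> L * norm v" by (simp add: L_def sum_distrib_right distrib_right)
      finally show "norm (frechet_derivative B (at (z, x)) (0, v)) \<le> L * norm v" .
    qed
  qed auto
  moreover have "L > 0" unfolding L_def using M by (intro add_nonneg_pos sum_nonneg) auto
  ultimately show ?thesis by blast
qed

text \<open>Telescoping, with all factors of modulus at most 1. It lets \<open>tangent_part\<close>
  exchange the rescaled gradient for \<nu> in an r-fold product.\<close>

lemma prod_list_diff_le:
  fixes a b :: "'i \<Rightarrow> real"
  assumes "\<And>i. \<bar>a i\<bar> \<le> 1" "\<And>i. \<bar>b i\<bar> \<le> 1" "\<And>i. \<bar>a i - b i\<bar> \<le> d"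
  shows "\<bar>(\<Prod>i\<leftarrow>is. a i) - (\<Prod>i\<leftarrow>is. b i)\<bar> \<le> real (length is) * d"
proof (induction "is")
  case (Cons i js)
  have b1: "\<bar>\<Prod>i\<leftarrow>js. b i\<bar> \<le> 1"
    by (induction js) (auto simp: abs_mult intro: mult_le_one assms(2))
  have "a i * (\<Prod>i\<leftarrow>js. a i) - b i * (\<Prod>i\<leftarrow>js. b i) = 
      a i * ((\<Prod>i\<leftarrow>js. a i) - (\<Prod>i\<leftarrow>js. b i)) + (a i - b i) * (\<Prod>i\<leftarrow>js. b i)"
    by (simp add: algebra_simps)
  also have "\<bar>\<dots>\<bar> \<le> \<bar>a i\<bar> * \<bar>(\<Prod>i\<leftarrow>js. a i) - (\<Prod>i\<leftarrow>js. b i)\<bar> + \<bar>a i - b i\<bar> * \<bar>\<Prod>i\<leftarrow>js. b i\<bar>"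
    using abs_triangle_ineq by (simp only: abs_mult[symmetric])
  also have "\<dots> \<le> 1 * (real (length js) * d) + d * 1"
    using assms Cons b1 order.trans[OF abs_ge_zero assms(3)] by (intro add_mono mult_mono) auto
  finally show ?case by (simp add: algebra_simps)
qed simp

lemma prod_list_scale:
  fixes a :: "'i \<Rightarrow> real"
  shows "(\<Prod>i\<leftarrow>is. k * a i) = k ^ length is * (\<Prod>i\<leftarrow>is. a i)"
  by (induction "is") (auto simp: algebra_simps)

text \<open>Closeness to the homogeneous jet b \<nu>^r, for partial derivatives taken in any order
  of the variables. The coefficient \<open>b\<close> is a separate argument because off the moved
  hypersurface only a bound on it is available.\<close>

definition jet_approx :: "nat \<Rightarrow> real \<Rightarrow> ('z::real_normed_vector \<times> (real^'m::finite) \<Rightarrow> real) \<Rightarrow> real \<Rightarrow> real^'m \<Rightarrow> 'z \<times> (real^'m) \<Rightarrow> bool" where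
  "jet_approx r E h b \<nu> y \<longleftrightarrow>
    (\<forall>is. length is \<le> r \<longrightarrow> \<bar>DL is h y - (if length is = r then b * (\<Prod>i\<leftarrow>is. \<nu> $ i) else 0)\<bar> < E)"

lemma jet_approx_add:
  assumes "smooth h" "smooth h'" "jet_approx r E h b \<nu> y" "jet_approx r E' h' b' \<nu> y"
  shows "jet_approx r (E + E') (\<lambda>y. h y + h' y) (b + b') \<nu> y"
  unfolding jet_approx_def
proof (intro allI impI)
  fix "is" :: "'b list" assume "length is \<le> r"
  then have 1: "\<bar>DL is h y - (if length is = r then b * (\<Prod>i\<leftarrow>is. \<nu> $ i) else 0)\<bar> < E"
    and 2: "\<bar>DL is h' y - (if length is = r then b' * (\<Prod>i\<leftarrow>is. \<nu> $ i) else 0)\<bar> < E'"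
    using assms(3,4) by (auto simp only: jet_approx_def)
  show "\<bar>DL is (\<lambda>y. h y + h' y) y - (if length is = r then (b + b') * (\<Prod>i\<leftarrow>is. \<nu> $ i) else 0)\<bar> < E + E'"
    using 1 2 by (auto simp: DL_add assms distrib_right)
qed

text \<open>\<open>tangency\<close> is the squared length of the component of the gradient orthogonal to \<open>\<nu>\<close>;
  it vanishes where the level set of \<open>f\<close> is tangent to the hyperplane orthogonal to \<open>\<nu>\<close>.\<close>

definition tangency :: "('z::real_normed_vector \<times> (real^'m::finite) \<Rightarrow> real) \<Rightarrow> real^'m \<Rightarrow> 'z \<times> (real^'m) \<Rightarrow> real" where
  "tangency f \<nu> y = gradx f y \<bullet> gradx f y - (gradx f y \<bullet> \<nu>)\<^sup>2"

text \<open>For \<kappa> > 0 it is 0 where the tangency is at most \<kappa> and 1 from 2\<kappa> on.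
  Thus the tangent part lives at tangency at most 2\<kappa>, the transverse part at tangency at
  least \<kappa>.\<close>

definition transverse_cut :: "('z::real_normed_vector \<times> (real^'m::finite) \<Rightarrow> real) \<Rightarrow> real^'m \<Rightarrow> real \<Rightarrow> 'z \<times> (real^'m) \<Rightarrow> real" where
  "transverse_cut f \<nu> \<kappa> y = step (tangency f \<nu> y / \<kappa> - 1)"

lemma smooth_tangency [smooth_intros]: "smooth f \<Longrightarrow> smooth (tangency f \<nu>)"
  unfolding tangency_def[abs_def] by (intro smooth_intros)

lemma smooth_transverse_cut [smooth_intros]: "smooth f \<Longrightarrow> smooth (transverse_cut f \<nu> \<kappa>)"
  unfolding transverse_cut_def[abs_def] by (intro smooth_intros)

text \<open>The projection of \<nu> onto the line of the gradient is k times the gradient, and its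
  squared distance to \<nu> is the tangency divided by the squared gradient. So a sawtooth power in
  f/\<eta>, corrected by k^r, has leading part close to a multiple of \<nu>^r. Correctness on a
  whole \<delta>-neighborhood of f = 0 leaves room for the isotopy of the transverse part.\<close>

lemma tangent_part:
  fixes f :: "'z::euclidean_space \<times> (real^'m::finite) \<Rightarrow> real"
  assumes f: "smooth f" "\<And>y. gradx f y \<noteq> 0" and \<rho>: "smooth \<rho>" "\<And>y. \<rho> y \<ge> 0" 
    and K: "compact K" "\<And>y. y \<notin> K \<Longrightarrow> \<rho> y = 0" and \<nu>: "norm \<nu> = 1" and E: "E > 0"
    and M: "\<And>t. \<bar>(deriv ^^ r) (saw r) t\<bar> \<le> M"
  shows "\<exists>\<kappa>>0. \<exists>h. smooth h \<and> (\<forall>y. y \<notin> K \<longrightarrow> h y = 0) \<and>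
    (\<forall>y. \<exists>b. \<bar>b\<bar> \<le> M * (\<rho> y * (1 - transverse_cut f \<nu> \<kappa> y)) \<and> jet_approx r E h b \<nu> y) \<and>
    (\<exists>\<delta>>0. \<forall>y y'. f y = 0 \<longrightarrow> dist y y' < \<delta> \<longrightarrow> jet_approx r E h (\<rho> y' * (1 - transverse_cut f \<nu> \<kappa> y')) \<nu> y')"
proof -
  define g where "g = gradx f"
  define d where "d = (\<lambda>y. g y \<bullet> \<nu>)"
  define N where "N = (\<lambda>y. g y \<bullet> g y)"
  have sg: "smooth g" unfolding g_def by (intro smooth_intros f)
  have sd: "smooth d" unfolding d_def by (intro smooth_intros sg)
  have sN: "smooth N" unfolding N_def by (intro smooth_intros sg)
  have Npos: "N y > 0" for y using f(2)[of y] by (simp add: N_def g_def)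
  have M0: "M \<ge> 0" using M[of 0] by linarith
  obtain R where R: "R \<ge> 0" "\<And>y. \<bar>\<rho> y\<bar> \<le> R"
    using compact_support_bounded[OF \<rho>(1) K] by auto
  obtain c0 where c0: "c0 > 0" "\<And>y. y \<in> K \<Longrightarrow> N y \<ge> c0"
  proof (cases "K = {}")
    case False
    obtain y0 where "y0 \<in> K" "\<forall>y\<in>K. N y0 \<le> N y"
      using continuous_attains_inf[OF K(1) False smooth_continuous[OF sN]] by blast
    then show ?thesis using that Npos by blast
  qed (use that[of 1] in auto)
  \<comment> \<open>Replacing the gradient by \<nu> in r factors costs at most M R r \<delta>, which
    is to stay below E/2; the added 1 covers a vanishing product.\<close>
  define \<delta> where "\<delta> = E / (2 * (M * R * real r + 1))"
  have \<delta>: "\<delta> > 0" "M * R * real r * \<delta> < E / 2"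
  proof -
    have p: "M * R * real r + 1 > 0" using M0 R by (intro add_nonneg_pos) auto
    show "\<delta> > 0" using p E by (simp add: \<delta>_def)
    then have "M * R * real r * \<delta> < (M * R * real r + 1) * \<delta>" by (simp add: distrib_right)
    also have "\<dots> = E / 2" using p by (simp add: \<delta>_def nonzero_divide_eq_eq less_imp_neq[symmetric])
    finally show "M * R * real r * \<delta> < E / 2" .
  qed
  \<comment> \<open>On the support of the cut weight the tangency is at most 2\<kappa>; division by
    the lower bound \<open>c0\<close> of the squared gradient gives \<delta>^2.\<close>
  define \<kappa> where "\<kappa> = c0 * \<delta>\<^sup>2 / 2"
  have \<kappa>: "\<kappa> > 0" using c0 \<delta> by (simp add: \<kappa>_def)
  define \<rho>0 where "\<rho>0 = (\<lambda>y. \<rho> y * (1 - transverse_cut f \<nu> \<kappa> y))"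
  have s\<rho>0: "smooth \<rho>0" unfolding \<rho>0_def by (intro smooth_intros \<rho> f)
  have \<rho>0: "\<rho>0 y \<ge> 0" "\<rho>0 y \<le> \<rho> y" for y
    unfolding \<rho>0_def transverse_cut_def using \<rho>(2)[of y] step_bounds[of "tangency f \<nu> y / \<kappa> - 1"]
    by (auto intro!: mult_left_le)
  have \<rho>0K: "\<rho>0 y = 0" if "y \<notin> K" for y using that K by (simp add: \<rho>0_def)
  have W: "N y - (d y)\<^sup>2 \<le> 2 * \<kappa>" if "\<rho>0 y \<noteq> 0" for y
  proof (rule ccontr)
    assume "\<not> ?thesis"
    then have "tangency f \<nu> y / \<kappa> - 1 \<ge> 1"
      using \<kappa> by (simp add: tangency_def N_def d_def g_def pos_le_divide_eq)
    then have "\<rho>0 y = 0" by (simp add: \<rho>0_def transverse_cut_def step_eq_1)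
    with that show False by simp
  qed
  define k where "k = (\<lambda>y. d y / N y)"
  have sk: "smooth k" unfolding k_def using Npos 
    by (intro smooth_divide sd sN) (simp add: less_imp_neq[symmetric])
  define c where "c = (\<lambda>y. \<rho>0 y * k y ^ r)"
  have sc: "smooth c" unfolding c_def by (intro smooth_intros s\<rho>0 sk)
  have cK: "\<forall>y. y \<notin> K \<longrightarrow> c y = 0" using \<rho>0K by (simp add: c_def)
  have lead: "\<bar>\<rho>0 y * t * (\<Prod>i\<leftarrow>is. k y * g y $ i) - \<rho>0 y * t * (\<Prod>i\<leftarrow>is. \<nu> $ i)\<bar> < E / 2"
    if t: "\<bar>t\<bar> \<le> M" and len: "length is = r" for y t and "is" :: "'m list"
  proof (cases "\<rho>0 y = 0")
    case True
    then show ?thesis using E by simp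
  next
    case False
    have yK: "y \<in> K" using False \<rho>0K by blast
    define u where "u = k y *\<^sub>R g y"
    have dN: "(d y)\<^sup>2 \<le> N y"
      using Cauchy_Schwarz_ineq[of "g y" \<nu>] \<nu> by (simp add: d_def N_def norm_eq_1)
    have gg: "g y \<bullet> g y = N y" "g y \<bullet> \<nu> = d y" by (simp_all add: N_def d_def)
    have uu: "u \<bullet> u = (d y)\<^sup>2 / N y"
      using Npos[of y] by (simp add: u_def k_def gg power2_eq_square field_simps)
    have u\<nu>: "u \<bullet> \<nu> = (d y)\<^sup>2 / N y"
      using Npos[of y] by (simp add: u_def k_def gg power2_eq_square)
    have "(norm u)\<^sup>2 \<le> 1" using uu dN Npos[of y] by (simp add: power2_norm_eq_inner)
    then have nu: "norm u \<le> 1" by (simp add: power_le_one_iff abs_square_le_1)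
    have "(norm (u - \<nu>))\<^sup>2 = u \<bullet> u - 2 * (u \<bullet> \<nu>) + \<nu> \<bullet> \<nu>"
      by (simp add: power2_norm_eq_inner inner_diff_left inner_diff_right inner_commute)
    also have "\<dots> = (N y - (d y)\<^sup>2) / N y"
      using \<nu> Npos[of y] by (simp add: uu u\<nu> norm_eq_1 field_simps)
    also have "\<dots> \<le> (2 * \<kappa>) / c0"
      using W[OF False] c0(1) c0(2)[OF yK] dN \<kappa> by (intro frac_le) auto
    also have "\<dots> = \<delta>\<^sup>2" using c0 by (simp add: \<kappa>_def)
    finally have "norm (u - \<nu>) \<le> \<delta>" using \<delta> by (simp add: power2_le_iff_abs_le)
    then have "\<bar>(\<Prod>i\<leftarrow>is. u $ i) - (\<Prod>i\<leftarrow>is. \<nu> $ i)\<bar> \<le> real (length is) * \<delta>"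
      using nu \<nu> by (intro prod_list_diff_le)
        (metis component_le_norm_cart order_trans vector_minus_component order_refl)+
    then have "(\<rho>0 y * \<bar>t\<bar>) * \<bar>(\<Prod>i\<leftarrow>is. u $ i) - (\<Prod>i\<leftarrow>is. \<nu> $ i)\<bar> \<le> (R * M) * (real r * \<delta>)"
      using \<rho>0[of y] R(2)[of y] R(1) t len \<delta> by (intro mult_mono) auto
    also have "\<dots> < E / 2" using \<delta>(2) by (simp add: mult_ac)
    finally show ?thesis
      using \<rho>0[of y] by (simp add: u_def abs_mult right_diff_distrib[symmetric])
  qed
  have "E / 2 > 0" using E by simp
  from osc_estimate_uniform[OF sc K(1) cK f(1) smooth_saw saw_deriv_bounded this, of r r]
  obtain \<eta> where \<eta>: "\<eta> > 0" and est0: "\<forall>\<eta>'. 0 < \<eta>' \<and> \<eta>' \<le> \<eta> \<longrightarrow> (\<forall>\<theta> y is. length is \<le> r \<longrightarrow>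
    \<bar>DL is (\<lambda>y. \<eta>' ^ r * (c y * saw r (f y / \<eta>' + \<theta>))) y 
      - (if length is = r then c y * (deriv ^^ r) (saw r) (f y / \<eta>' + \<theta>) * (\<Prod>i\<leftarrow>is. dirx i f y) else 0)\<bar> < E / 2)"
    by (elim exE conjE)
  have est: "\<bar>DL is (\<lambda>y. \<eta> ^ r * (c y * saw r (f y / \<eta> + 1/2))) y 
      - (if length is = r then c y * (deriv ^^ r) (saw r) (f y / \<eta> + 1/2) * (\<Prod>i\<leftarrow>is. dirx i f y) else 0)\<bar> < E / 2"
    if "length is \<le> r" for y "is"
    using est0 \<eta> that by blast
  \<comment> \<open>The shift 1/2 puts f = 0 in the middle of a linear piece of the
    sawtooth.\<close>
  define h where "h = (\<lambda>y. \<eta> ^ r * (c y * saw r (f y / \<eta> + 1/2)))"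
  have sh: "smooth h" unfolding h_def
    by (intro smooth_mult smooth_const sc smooth_compose[OF smooth_saw] smooth_intros f)
  have approx: "jet_approx r E h (\<rho>0 y * (deriv ^^ r) (saw r) (f y / \<eta> + 1/2)) \<nu> y" for y
    unfolding jet_approx_def
  proof (intro allI impI)
    fix "is" :: "'m list" assume len: "length is \<le> r"
    let ?t = "(deriv ^^ r) (saw r) (f y / \<eta> + 1/2)"
    show "\<bar>DL is h y - (if length is = r then \<rho>0 y * ?t * (\<Prod>i\<leftarrow>is. \<nu> $ i) else 0)\<bar> < E"
    proof (cases "length is = r")
      case True
      have "c y * ?t * (\<Prod>i\<leftarrow>is. dirx i f y) = \<rho>0 y * ?t * (\<Prod>i\<leftarrow>is. k y * g y $ i)"
        unfolding prod_list_scale True by (simp add: c_def g_def gradx_def)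
      then have "\<bar>DL is h y - \<rho>0 y * ?t * (\<Prod>i\<leftarrow>is. k y * g y $ i)\<bar> < E / 2"
        using est[OF len, of y] unfolding h_def by (simp only: True if_True refl)
      moreover have "\<bar>\<rho>0 y * ?t * (\<Prod>i\<leftarrow>is. k y * g y $ i) - \<rho>0 y * ?t * (\<Prod>i\<leftarrow>is. \<nu> $ i)\<bar> < E / 2"
        by (rule lead[OF M True])
      ultimately have "\<bar>DL is h y - \<rho>0 y * ?t * (\<Prod>i\<leftarrow>is. \<nu> $ i)\<bar> < E" by linarith
      then show ?thesis by (simp only: True if_True refl)
    next
      case False
      then show ?thesis using est[OF len, of y] E unfolding h_def by (simp only: if_False)
    qed
  qed
  have "\<exists>\<delta>>0. \<forall>y y'. f y = 0 \<longrightarrow> dist y y' < \<delta> \<longrightarrow> jet_approx r E h (\<rho>0 y') \<nu> y'"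
  proof -
    \<comment> \<open>The weight vanishes off K, so only points of K with |f| at least \<eta>/3 can
      be bad; they form a compact set at positive distance from f = 0. The value 1/3 corresponds to
      cos = -1/2, hence to 1/2 after the shift.\<close>
    have "compact (K \<inter> {y. \<eta> / 3 \<le> \<bar>f y\<bar>})"
      by (intro compact_Int_closed K closed_Collect_le continuous_intros smooth_continuous f)
    moreover have "closed {y. f y = 0}"
      by (intro closed_Collect_eq continuous_intros smooth_continuous f)
    moreover have "(K \<inter> {y. \<eta> / 3 \<le> \<bar>f y\<bar>}) \<inter> {y. f y = 0} = {}" using \<eta> by auto
    ultimately obtain \<delta> where \<delta>: "\<delta> > 0" "\<And>y' y. y' \<in> K \<Longrightarrow> \<eta> / 3 \<le> \<bar>f y'\<bar> \<Longrightarrow> f y = 0 \<Longrightarrow> \<delta> \<le> dist y' y"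
      using separate_compact_closed[of "K \<inter> {y. \<eta> / 3 \<le> \<bar>f y\<bar>}" "{y. f y = 0}"] by auto
    have "jet_approx r E h (\<rho>0 y') \<nu> y'" if "f y = 0" "dist y y' < \<delta>" for y y'
    proof -
      have "\<rho>0 y' * (deriv ^^ r) (saw r) (f y' / \<eta> + 1/2) = \<rho>0 y'"
      proof (cases "y' \<in> K")
        case True
        then have lt: "\<bar>f y'\<bar> < \<eta> / 3" using \<delta>(2)[OF True _ that(1)] that(2) by (force simp: dist_commute)
        define s where "s = \<bar>f y' / \<eta>\<bar>"
        have s: "0 \<le> s" "s \<le> 1/3" using lt \<eta> by (auto simp: s_def abs_divide pos_divide_le_eq)
        have "cos (2 * pi * (f y' / \<eta> + 1/2)) = - cos (2 * pi * (f y' / \<eta>))"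
          by (simp add: distrib_left cos_add)
        moreover have "cos (2 * pi * (f y' / \<eta>)) = cos (2 * pi * s)"
          unfolding s_def by (cases "f y' / \<eta> \<ge> 0") (simp_all add: abs_if)
        moreover have "cos (2 * pi * (1/3)) \<le> cos (2 * pi * s)"
          using s by (intro cos_monotone_0_pi_le) (auto simp: mult_left_mono)
        moreover have "cos (2 * pi * (1/3)) = - (1/2)" using cos_120 by simp
        ultimately have "cos (2 * pi * (f y' / \<eta> + 1/2)) \<le> 1/2" by linarith
        then show ?thesis by (simp add: saw_deriv_good)
      qed (simp add: \<rho>0K)
      then show ?thesis using approx[of y'] by (simp only:)
    qed
    then show ?thesis using \<delta>(1) by blast
  qed
  moreover have "\<exists>b. \<bar>b\<bar> \<le> M * \<rho>0 y \<and> jet_approx r E h b \<nu> y" for y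
    using approx[of y] mult_right_mono[OF M \<rho>0(1)[of y]] \<rho>0(1)[of y]
    by (intro exI[of _ "\<rho>0 y * (deriv ^^ r) (saw r) (f y / \<eta> + 1/2)"]) (simp add: abs_mult mult.commute)
  moreover have "h y = 0" if "y \<notin> K" for y
  proof -
    have "c y = 0" using cK that by blast
    then show ?thesis by (simp add: h_def)
  qed
  ultimately show ?thesis using \<kappa> sh unfolding \<rho>0_def by blast
qed

section \<open>Isotopies with prescribed support, and the zigzag\<close>

text \<open>The inverse is carried along and everything is defined for all z, t and x, so that
  compositions and smoothness of inverses reduce to composing globally smooth maps.\<close>

definition smooth_isotopy ::
  "(real^'q::finite \<Rightarrow> real \<Rightarrow> real^'m::finite \<Rightarrow> real^'m) \<Rightarrow> (real^'q \<Rightarrow> real \<Rightarrow> real^'m \<Rightarrow> real^'m) \<Rightarrow> ((real^'q) \<times> (real^'m)) set \<Rightarrow> bool" where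
  "smooth_isotopy F Fi K \<longleftrightarrow>
    smooth (\<lambda>p. F (fst (fst p)) (snd (fst p)) (snd p)) \<and>
    smooth (\<lambda>p. Fi (fst (fst p)) (snd (fst p)) (snd p)) \<and>
    (\<forall>z t x. Fi z t (F z t x) = x \<and> F z t (Fi z t x) = x) \<and>
    (\<forall>z x. F z 0 x = x) \<and> (\<forall>z t x. (z, x) \<notin> K \<longrightarrow> F z t x = x)"

lemma smooth_isotopyD:
  assumes "smooth_isotopy F Fi K"
  shows "smooth (\<lambda>p. F (fst (fst p)) (snd (fst p)) (snd p))"
    and "smooth (\<lambda>p. Fi (fst (fst p)) (snd (fst p)) (snd p))"
    and "Fi z t (F z t x) = x" "F z t (Fi z t x) = x" "F z 0 x = x"
    and "(z, x) \<notin> K \<Longrightarrow> F z t x = x"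
  using assms unfolding smooth_isotopy_def by blast+

lemma smooth_isotopy_compose:
  assumes F: "smooth_isotopy F Fi K" and G: "smooth_isotopy G Gi K'"
  shows "smooth_isotopy (\<lambda>z t x. G z t (F z t x)) (\<lambda>z t x. Fi z t (Gi z t x)) (K \<union> K')"
  unfolding smooth_isotopy_def
proof (intro conjI allI impI)
  note f = smooth_isotopyD[OF F] and g = smooth_isotopyD[OF G]
  have "smooth (\<lambda>p. (fst p, F (fst (fst p)) (snd (fst p)) (snd p)))"
    by (intro smooth_intros f)
  from smooth_compose[OF g(1) this]
  show "smooth (\<lambda>p. G (fst (fst p)) (snd (fst p)) (F (fst (fst p)) (snd (fst p)) (snd p)))" by simp
  have "smooth (\<lambda>p. (fst p, Gi (fst (fst p)) (snd (fst p)) (snd p)))"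
    by (intro smooth_intros g)
  from smooth_compose[OF f(2) this]
  show "smooth (\<lambda>p. Fi (fst (fst p)) (snd (fst p)) (Gi (fst (fst p)) (snd (fst p)) (snd p)))" by simp
qed (use smooth_isotopyD[OF F] smooth_isotopyD[OF G] in auto)

lemma smooth_isotopy_id: "smooth_isotopy (\<lambda>z t x. x) (\<lambda>z t x. x) K"
  by (auto simp: smooth_isotopy_def intro: smooth_intros)

lemma smooth_isotopy_mono: "smooth_isotopy F Fi K \<Longrightarrow> K \<subseteq> K' \<Longrightarrow> smooth_isotopy F Fi K'"
  unfolding smooth_isotopy_def by blast

text \<open>A displacement field \<open>B\<close> tangent to the hyperplanes \<open>\<nu> \<bullet> x = const\<close> may be multiplied with an
  arbitrarily fast function of \<open>\<nu> \<bullet> x\<close> without losing invertibility, since that function is constant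
  along the displacement.\<close>

lemma leafwise_isotopy:
  fixes B :: "(real^'q::finite) \<times> (real^'m::finite) \<Rightarrow> real^'m"
  assumes B: "smooth B" "\<And>y. y \<notin> K \<Longrightarrow> B y = 0" and tang: "\<And>y. \<nu> \<bullet> B y = 0"
    and lip: "\<And>z x x'. norm (B (z, x) - B (z, x')) \<le> L * norm (x - x')"
    and s: "smooth s" "\<And>u. \<bar>s u\<bar> \<le> A" and AL: "A * L \<le> 1/2"
  shows "\<exists>Gi. smooth_isotopy (\<lambda>z t x. x + (step t * s (\<nu> \<bullet> x)) *\<^sub>R B (z, x)) Gi K"
proof -
  define T where "T = (\<lambda>t x. step t * s (\<nu> \<bullet> x))"
  have sT: "smooth (\<lambda>p. T (a p) (b p))" if "smooth a" "smooth b" for a :: "'c::euclidean_space \<Rightarrow> real" and b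
    unfolding T_def using that by (intro smooth_intros smooth_compose[OF s(1)])
  have A0: "A \<ge> 0" using s(2)[of 0] by linarith
  have T: "\<bar>T t x\<bar> \<le> A" for t x
    unfolding T_def abs_mult using step_bounds[of t] s(2)[of "\<nu> \<bullet> x"] mult_mono[of "\<bar>step t\<bar>" 1 "\<bar>s (\<nu> \<bullet> x)\<bar>" A] by simp
  have half: "norm (T t y *\<^sub>R B (z, x) - T t y *\<^sub>R B (z, x')) \<le> (1/2) * norm (x - x')" for t y z x x'
  proof -
    have "norm (T t y *\<^sub>R B (z, x) - T t y *\<^sub>R B (z, x')) = \<bar>T t y\<bar> * norm (B (z, x) - B (z, x'))"
      by (simp add: scaleR_diff_right[symmetric])
    also have "\<dots> \<le> A * (L * norm (x - x'))"
      using T lip A0 by (intro mult_mono) auto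
    also have "\<dots> = (A * L) * norm (x - x')" by simp
    also have "\<dots> \<le> (1/2) * norm (x - x')" using AL by (intro mult_right_mono) auto
    finally show ?thesis .
  qed
  \<comment> \<open>The inverse at y solves x = y - T t y B(z, x), with z, t and y as parameters.
    The fast factor is evaluated at y instead of x, which is the same on a leaf, and so the
    contraction constant A L does not involve the derivative of \<open>s\<close>.\<close>
  define E where "E = (\<lambda>p :: (((real^'q) \<times> real) \<times> (real^'m)) \<times> (real^'m). 
     snd (fst p) - T (snd (fst (fst p))) (snd (fst p)) *\<^sub>R B (fst (fst (fst p)), snd p))"
  have sE: "smooth E" unfolding E_def by (intro smooth_intros sT smooth_compose[OF B(1)])
  have Elip: "norm (E (q, x) - E (q, x')) \<le> (1/2) * norm (x - x')" for q x x'
    using half[of "snd (fst q)" "snd q" "fst (fst q)" x' x] by (simp add: E_def norm_minus_commute)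
  have "\<exists>x. x = E (q, x)" for q by (rule half_contraction_fixpoint[OF Elip])
  then obtain X where X: "\<And>q. X q = E (q, X q)" by metis
  have uniq: "x = X q" if "x = E (q, x)" for q x
    by (rule half_contraction_unique) (use that X Elip in metis)
  have sX: "smooth X" by (rule smooth_fixpoint[OF sE Elip X])
  have X': "X ((z, t), y) = y - T t y *\<^sub>R B (z, X ((z, t), y))" for z t y
    using X[of "((z, t), y)"] by (simp add: E_def)
  have Tinv: "T t (x + c *\<^sub>R B y) = T t x" for t x c y
    by (simp add: T_def inner_add_right tang)
  have "smooth_isotopy (\<lambda>z t x. x + T t x *\<^sub>R B (z, x)) (\<lambda>z t y. X ((z, t), y)) K"
    unfolding smooth_isotopy_def
  proof (intro conjI allI impI)
    show "smooth (\<lambda>p::((real^'q) \<times> real) \<times> (real^'m). snd p + T (snd (fst p)) (snd p) *\<^sub>R B (fst (fst p), snd p))"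
      by (intro smooth_intros sT smooth_compose[OF B(1)])
    show "smooth (\<lambda>p. X ((fst (fst p), snd (fst p)), snd p))" using sX by simp
    show "X ((z, t), x + T t x *\<^sub>R B (z, x)) = x" for z t x
      by (rule uniq[symmetric]) (simp add: E_def Tinv)
    show "X ((z, t), x) + T t (X ((z, t), x)) *\<^sub>R B (z, X ((z, t), x)) = x" for z t x
    proof -
      have eq: "X ((z, t), x) + T t x *\<^sub>R B (z, X ((z, t), x)) = x"
        using X'[of z t x] by (simp only: eq_diff_eq)
      then have "T t (X ((z, t), x)) = T t x"
        using Tinv[of t "X ((z, t), x)" "T t x" "(z, X ((z, t), x))"] by (simp only:)
      then show ?thesis by (simp only: eq)
    qed
    show "x + T 0 x *\<^sub>R B (z, x) = x" for z x by (simp add: T_def step_eq_0)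
    show "x + T t x *\<^sub>R B (z, x) = x" if "(z, x) \<notin> K" for z t x using B(2)[OF that] by simp
  qed
  then show ?thesis unfolding T_def by blast
qed

text \<open>A point of f = 0 is displaced by \<tau> B with \<tau> = -2 A cos(2 pi \<phi>/\<eta>),
  and f grows along B at a rate above \<kappa>/2. The unshifted sawtooth can fail only where cos >
  1/2; there \<tau> < -A and f has dropped to -A \<kappa>/2 or below, where \<open>cf\<close>
  selects the shifted one. Where cos < -1/2 the roles are exchanged. In between both are correct, so
  the transition of \<open>cf\<close> does no harm.\<close>

lemma transverse_part:
  fixes f :: "(real^'q::finite) \<times> (real^'m::finite) \<Rightarrow> real"
  assumes f: "smooth f" and \<rho>: "smooth \<rho>" "\<And>y. \<rho> y \<ge> 0" 
    and K: "compact K" "\<And>y. y \<notin> K \<Longrightarrow> \<rho> y = 0" "K \<subseteq> U" "open U" 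
    and \<nu>: "norm \<nu> = 1" and E: "E > 0" and \<kappa>: "\<kappa> > 0"
    and M: "\<And>t. \<bar>(deriv ^^ r) (saw r) t\<bar> \<le> M"
  shows "\<exists>G Gi K' h. smooth_isotopy G Gi K' \<and> compact K' \<and> K' \<subseteq> U \<and> (\<forall>z t x. norm (G z t x - x) < E) \<and> 
    smooth h \<and> (\<forall>y. y \<notin> K \<longrightarrow> h y = 0) \<and>
    (\<forall>y. \<exists>b. \<bar>b\<bar> \<le> M * (\<rho> y * transverse_cut f \<nu> \<kappa> y) \<and> jet_approx r E h b \<nu> y) \<and>
    (\<forall>z x. f (z, x) = 0 \<longrightarrow> jet_approx r E h (\<rho> (z, G z 1 x) * transverse_cut f \<nu> \<kappa> (z, G z 1 x)) \<nu> (z, G z 1 x))"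
proof -
  define g where "g = gradx f"
  define W where "W = tangency f \<nu>"
  define w where "w = (\<lambda>y. g y - (g y \<bullet> \<nu>) *\<^sub>R \<nu>)"
  have \<nu>\<nu>: "\<nu> \<bullet> \<nu> = 1" using \<nu> by (simp add: norm_eq_1)
  have sg: "smooth g" unfolding g_def by (intro smooth_intros f)
  have sw: "smooth w" unfolding w_def by (intro smooth_intros sg)
  have sW: "smooth W" unfolding W_def by (intro smooth_intros f)
  have gw: "g y \<bullet> w y = W y" for y
    by (simp add: w_def W_def tangency_def g_def inner_diff_right power2_eq_square)
  have \<nu>w: "\<nu> \<bullet> w y = 0" for y by (simp add: w_def inner_diff_right \<nu>\<nu> inner_commute)
  define \<rho>1 where "\<rho>1 = (\<lambda>y. \<rho> y * transverse_cut f \<nu> \<kappa> y)"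
  have s\<rho>1: "smooth \<rho>1" unfolding \<rho>1_def by (intro smooth_intros \<rho> f)
  have \<rho>1: "\<rho>1 y \<ge> 0" for y unfolding \<rho>1_def transverse_cut_def using \<rho>(2) step_bounds by simp
  have \<rho>1K: "\<rho>1 y = 0" if "y \<notin> K" for y using that K by (simp add: \<rho>1_def)
  have W\<kappa>: "W y \<ge> \<kappa>" if "\<rho>1 y \<noteq> 0" for y
  proof (rule ccontr)
    assume "\<not> ?thesis"
    then have "W y / \<kappa> - 1 \<le> 0" using \<kappa> by (simp add: pos_divide_le_eq)
    then show False using that by (simp add: \<rho>1_def transverse_cut_def W_def step_eq_0)
  qed
  obtain \<zeta> K' where \<zeta>: "smooth \<zeta>" "\<forall>y\<in>K. \<zeta> y = (1::real)" and K': "compact K'" "K' \<subseteq> U" 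
    "\<forall>y. y \<notin> K' \<longrightarrow> \<zeta> y = 0"
    using smooth_cutoff[OF K(1,3,4)] by blast
  define B where "B = (\<lambda>y. \<zeta> y *\<^sub>R w y)"
  have sB: "smooth B" unfolding B_def by (intro smooth_intros \<zeta> sw)
  have BK: "B y = 0" if "y \<notin> K'" for y
  proof -
    have "\<zeta> y = 0" using K'(3) that by blast
    then show ?thesis by (simp add: B_def)
  qed
  have \<nu>B: "\<nu> \<bullet> B y = 0" for y by (simp add: B_def \<nu>w)
  obtain MB where MB: "MB \<ge> 0" "\<And>y. norm (B y) \<le> MB"
    using compact_support_bounded[OF sB K'(1) BK] by auto
  obtain L where L: "L > 0" "\<And>z x x'. norm (B (z, x) - B (z, x')) \<le> L * norm (x - x')"
    using Lipschitz_in_x[OF sB K'(1) BK] by auto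
  obtain \<delta> where \<delta>: "\<delta> > 0" 
    "\<And>y y1 y2. y \<in> K \<Longrightarrow> W y \<ge> \<kappa> \<Longrightarrow> dist y y1 < \<delta> \<Longrightarrow> dist y y2 < \<delta> \<Longrightarrow> g y1 \<bullet> B y2 > \<kappa> / 2"
  proof -
    \<comment> \<open>Gradient and field are taken at two different points because f is
      differentiated along a segment whose direction is the field at its starting point. On this
      compact part of the diagonal the product is at least \<kappa>, so it exceeds \<kappa>/2
      uniformly nearby.\<close>
    define O' where "O' = {p. g (fst p) \<bullet> B (snd p) > \<kappa> / 2}"
    define K1 where "K1 = (\<lambda>y. (y, y)) ` (K \<inter> {y. \<kappa> \<le> W y})"
    have "open O'" unfolding O'_def
      by (intro open_Collect_less smooth_continuous[of "\<lambda>p. g (fst p) \<bullet> B (snd p)"] continuous_intros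
         smooth_inner smooth_compose[OF sg] smooth_compose[OF sB] smooth_intros)
    moreover have "compact K1" unfolding K1_def
      by (intro compact_continuous_image continuous_intros compact_Int_closed K closed_Collect_le
          smooth_continuous sW)
    moreover have "K1 \<subseteq> O'"
      using \<zeta>(2) gw \<kappa> by (auto simp: K1_def O'_def B_def)
    ultimately obtain \<delta> where \<delta>: "\<delta> > 0" "(\<Union>p\<in>K1. ball p \<delta>) \<subseteq> O'"
      using compact_subset_open_imp_ball_epsilon_subset by metis
    show ?thesis
    proof (rule that[of "\<delta> / 2"])
      fix y y1 y2 assume *: "y \<in> K" "W y \<ge> \<kappa>" "dist y y1 < \<delta> / 2" "dist y y2 < \<delta> / 2"
      have "dist (y, y) (y1, y2) \<le> dist y y1 + dist y y2"
        unfolding dist_Pair_Pair by (intro sqrt_sum_squares_le_sum) auto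
      then have "(y1, y2) \<in> (\<Union>p\<in>K1. ball p \<delta>)" using * by (force simp: K1_def)
      then have "(y1, y2) \<in> O'" using \<delta>(2) by blast
      then show "g y1 \<bullet> B y2 > \<kappa> / 2" by (simp add: O'_def)
    qed (use \<delta> in simp)
  qed
  \<comment> \<open>Displacement coefficients are at most 2A. The first bound gives 2 A L \<le> 1/2,
    the contraction condition; the second keeps displacements below E and \<delta>. No wavelength
    enters.\<close>
  define A where "A = min (1 / (4 * L)) (min E \<delta> / (2 * (MB + 1)) / 2)"
  have A: "A > 0" "2 * A * L \<le> 1/2" "2 * A * MB < min E \<delta>"
  proof -
    show "A > 0" using L E \<delta> MB by (simp add: A_def)
    have "A \<le> 1 / (4 * L)" by (simp add: A_def)
    then show "2 * A * L \<le> 1/2" using L(1) by (simp add: field_simps)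
    have m: "min E \<delta> > 0" using E \<delta> by simp
    have "A \<le> min E \<delta> / (2 * (MB + 1)) / 2" by (simp add: A_def)
    then have "2 * A * (MB + 1) \<le> min E \<delta> / 2" using MB(1) by (simp add: field_simps)
    then show "2 * A * MB < min E \<delta>" using m \<open>A > 0\<close> by (simp add: distrib_left)
  qed
  \<comment> \<open>The transition happens for f between -A \<kappa>/2 and A \<kappa>/2, the levels
    that the zigzag is guaranteed to reach where |cos| exceeds 1/2.\<close>
  define cf where "cf = (\<lambda>y. step (1/2 + f y / (A * \<kappa>)))"
  have scf: "smooth cf" unfolding cf_def by (intro smooth_intros f)
  have cf: "0 \<le> cf y" "cf y \<le> 1" for y by (auto simp: cf_def step_bounds)
  define c1 where "c1 = (\<lambda>y. \<rho>1 y * cf y)"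
  define c2 where "c2 = (\<lambda>y. \<rho>1 y * (1 - cf y))"
  define \<phi> where "\<phi> = (\<lambda>y::(real^'q) \<times> (real^'m). \<nu> \<bullet> snd y)"
  have sc: "smooth c1" "smooth c2" unfolding c1_def c2_def by (intro smooth_intros s\<rho>1 scf)+
  have s\<phi>: "smooth \<phi>" unfolding \<phi>_def by (intro smooth_intros)
  have cK: "\<forall>y. y \<notin> K \<longrightarrow> c1 y = 0" "\<forall>y. y \<notin> K \<longrightarrow> c2 y = 0" using \<rho>1K by (auto simp: c1_def c2_def)
  have d\<phi>: "dirx i \<phi> y = \<nu> $ i" for i y
  proof -
    have "(\<phi> has_derivative (\<lambda>v. \<nu> \<bullet> snd v)) (at y)"
      unfolding \<phi>_def by (auto intro!: derivative_eq_intros)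
    then show ?thesis by (simp add: dirxI inner_axis)
  qed
  have E2: "E / 2 > 0" using E by simp
  from osc_estimate_uniform[OF sc(1) K(1) cK(1) s\<phi> smooth_saw saw_deriv_bounded E2, of r r]
  obtain \<eta>1 where \<eta>1: "\<eta>1 > 0" "\<forall>\<eta>. 0 < \<eta> \<and> \<eta> \<le> \<eta>1 \<longrightarrow> (\<forall>\<theta> y is. length is \<le> r \<longrightarrow>
    \<bar>DL is (\<lambda>y. \<eta> ^ r * (c1 y * saw r (\<phi> y / \<eta> + \<theta>))) y 
      - (if length is = r then c1 y * (deriv ^^ r) (saw r) (\<phi> y / \<eta> + \<theta>) * (\<Prod>i\<leftarrow>is. dirx i \<phi> y) else 0)\<bar> < E / 2)"
    by (elim exE conjE)
  from osc_estimate_uniform[OF sc(2) K(1) cK(2) s\<phi> smooth_saw saw_deriv_bounded E2, of r r]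
  obtain \<eta>2 where \<eta>2: "\<eta>2 > 0" "\<forall>\<eta>. 0 < \<eta> \<and> \<eta> \<le> \<eta>2 \<longrightarrow> (\<forall>\<theta> y is. length is \<le> r \<longrightarrow>
    \<bar>DL is (\<lambda>y. \<eta> ^ r * (c2 y * saw r (\<phi> y / \<eta> + \<theta>))) y 
      - (if length is = r then c2 y * (deriv ^^ r) (saw r) (\<phi> y / \<eta> + \<theta>) * (\<Prod>i\<leftarrow>is. dirx i \<phi> y) else 0)\<bar> < E / 2)"
    by (elim exE conjE)
  define \<eta> where "\<eta> = min \<eta>1 \<eta>2"
  have \<eta>: "\<eta> > 0" "\<eta> \<le> \<eta>1" "\<eta> \<le> \<eta>2" using \<eta>1 \<eta>2 by (auto simp: \<eta>_def)
  define h1 where "h1 = (\<lambda>y. \<eta> ^ r * (c1 y * saw r (\<phi> y / \<eta> + 0)))"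
  define h2 where "h2 = (\<lambda>y. \<eta> ^ r * (c2 y * saw r (\<phi> y / \<eta> + 1/2)))"
  have sh: "smooth h1" "smooth h2" unfolding h1_def h2_def
    by (intro smooth_mult smooth_const sc smooth_compose[OF smooth_saw] smooth_intros s\<phi>)+
  let ?P = "(deriv ^^ r) (saw r)"
  have J1: "jet_approx r (E/2) h1 (c1 y * ?P (\<phi> y / \<eta> + 0)) \<nu> y" for y
    using \<eta>1(2) \<eta> unfolding jet_approx_def h1_def d\<phi> by blast
  have J2: "jet_approx r (E/2) h2 (c2 y * ?P (\<phi> y / \<eta> + 1/2)) \<nu> y" for y
    using \<eta>2(2) \<eta> unfolding jet_approx_def h2_def d\<phi> by blast
  define h where "h = (\<lambda>y. h1 y + h2 y)"
  have hK: "h y = 0" if "y \<notin> K" for y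
  proof -
    have "c1 y = 0" "c2 y = 0" using cK that by blast+
    then show ?thesis by (simp add: h_def h1_def h2_def)
  qed
  have sh': "smooth h" unfolding h_def by (intro smooth_intros sh)
  define b where "b = (\<lambda>y. c1 y * ?P (\<phi> y / \<eta> + 0) + c2 y * ?P (\<phi> y / \<eta> + 1/2))"
  have J: "jet_approx r E h (b y) \<nu> y" for y
    using jet_approx_add[OF sh J1 J2, of y] by (simp add: h_def b_def)
  have b: "\<bar>b y\<bar> \<le> M * \<rho>1 y" for y
  proof -
    have c: "c1 y \<ge> 0" "c2 y \<ge> 0" using \<rho>1 cf by (auto simp: c1_def c2_def)
    have "\<bar>b y\<bar> \<le> c1 y * \<bar>?P (\<phi> y / \<eta> + 0)\<bar> + c2 y * \<bar>?P (\<phi> y / \<eta> + 1/2)\<bar>"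
      unfolding b_def using c by (intro order.trans[OF abs_triangle_ineq]) (simp add: abs_mult)
    also have "\<dots> \<le> c1 y * M + c2 y * M" using c M by (intro add_mono mult_left_mono)
    also have "\<dots> = M * \<rho>1 y" by (simp add: c1_def c2_def algebra_simps)
    finally show ?thesis .
  qed
  \<comment> \<open>Same wavelength as the sawtooth. The factor 2 makes the displacement coefficient
    at least A in modulus where |cos| \<ge> 1/2.\<close>
  define s where "s = (\<lambda>u. A * (- 2 * cos (2 * pi * (u / \<eta>))))"
  have ss: "smooth s" unfolding s_def by (intro smooth_intros)
  have sA: "\<bar>s u\<bar> \<le> 2 * A" for u
    unfolding s_def using A(1) by (simp add: abs_mult mult_left_le)
  define G where "G = (\<lambda>z t x. x + (step t * s (\<nu> \<bullet> x)) *\<^sub>R B (z, x))"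
  obtain Gi where iso: "smooth_isotopy G Gi K'"
    using leafwise_isotopy[OF sB BK \<nu>B L(2) ss sA A(2)] unfolding G_def by blast
  have small: "norm (a *\<^sub>R B y) < min E \<delta>" if "\<bar>a\<bar> \<le> 2 * A" for a y
  proof -
    have "norm (a *\<^sub>R B y) \<le> 2 * A * MB" unfolding norm_scaleR
      using that MB(1) MB(2)[of y] by (intro mult_mono) auto
    then show ?thesis using A(3) by simp
  qed
  have Gsmall: "norm (G z t x - x) < E" for z t x
  proof -
    have "\<bar>step t * s (\<nu> \<bullet> x)\<bar> \<le> 2 * A"
      using step_bounds[of t] sA[of "\<nu> \<bullet> x"] mult_mono[of "\<bar>step t\<bar>" 1 "\<bar>s (\<nu> \<bullet> x)\<bar>" "2 * A"] 
      by (simp add: abs_mult)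
    from small[OF this] show ?thesis by (simp add: G_def)
  qed
  have good: "b (z, G z 1 x) = \<rho>1 (z, G z 1 x)" if f0: "f (z, x) = 0" for z x
  proof (cases "\<rho>1 (z, G z 1 x) = 0")
    case True
    then show ?thesis by (simp add: b_def c1_def c2_def)
  next
    case False
    define y where "y = (z, G z 1 x)"
    define \<tau> where "\<tau> = s (\<nu> \<bullet> x)"
    have y: "y = (z, x + \<tau> *\<^sub>R B (z, x))" by (simp add: y_def G_def \<tau>_def step_eq_1)
    have yK: "y \<in> K" "W y \<ge> \<kappa>" using False \<rho>1K W\<kappa> unfolding y_def by blast+
    have \<phi>y: "\<phi> y = \<nu> \<bullet> x" by (simp add: y \<phi>_def inner_add_right \<nu>B)
    define C where "C = cos (2 * pi * (\<phi> y / \<eta>))"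
    have \<tau>: "\<tau> = A * (- 2 * C)" by (simp add: \<tau>_def s_def C_def \<phi>y)
    define j where "j = (\<lambda>u. f (z, x + u *\<^sub>R B (z, x)))"
    have dj: "(j has_real_derivative (g (z, x + u *\<^sub>R B (z, x)) \<bullet> B (z, x))) (at u)" for u
    proof -
      have "((\<lambda>u. f (z, x + u *\<^sub>R B (z, x))) has_derivative
        (\<lambda>v. frechet_derivative f (at (z, x + u *\<^sub>R B (z, x))) (0, v *\<^sub>R B (z, x)))) (at u)"
        by (rule has_derivative_compose[OF _ has_derivative_slice[OF f]])
           (auto intro!: derivative_eq_intros)
      then show ?thesis
        unfolding frechet_derivative_gradx[OF f] has_field_derivative_def j_def g_def
        by (rule has_derivative_eq_rhs) (simp add: fun_eq_iff)
    qed
    \<comment> \<open>Nearness is measured from the image y: there the weight is nonzero, so y lies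
      in K with tangency at least \<kappa>, which need not hold at the starting point. For u between
      0 and \<tau> the condition follows from |\<tau>| \<le> 2A.\<close>
    have pos: "g (z, x + u *\<^sub>R B (z, x)) \<bullet> B (z, x) > \<kappa> / 2" if u: "\<bar>\<tau> - u\<bar> \<le> 2 * A" for u
    proof (rule \<delta>(2)[OF yK])
      have "norm ((\<tau> - u) *\<^sub>R B (z, x)) < \<delta>" using small[OF u, of "(z, x)"] by simp
      then show "dist y (z, x + u *\<^sub>R B (z, x)) < \<delta>"
        by (simp add: y dist_Pair_Pair dist_norm scaleR_diff_left)
      have "norm (\<tau> *\<^sub>R B (z, x)) < \<delta>" using small[OF sA] by (simp add: \<tau>_def)
      then show "dist y (z, x) < \<delta>" by (simp add: y dist_Pair_Pair dist_norm)
    qed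
    have \<tau>A: "\<bar>\<tau>\<bar> \<le> 2 * A" using sA by (simp add: \<tau>_def)
    have fy: "f y = j \<tau>" "j 0 = 0" using f0 by (simp_all add: j_def y)
    have up: "f y \<ge> A * \<kappa> / 2" if "\<tau> \<ge> A"
    proof -
      have "\<tau> > 0" using that A by simp
      then obtain u where u: "0 < u" "u < \<tau>" "j \<tau> - j 0 = (\<tau> - 0) * (g (z, x + u *\<^sub>R B (z, x)) \<bullet> B (z, x))"
        using MVT2[of 0 \<tau> j "\<lambda>u. g (z, x + u *\<^sub>R B (z, x)) \<bullet> B (z, x)"] dj by blast
      have "A * (\<kappa> / 2) \<le> \<tau> * (g (z, x + u *\<^sub>R B (z, x)) \<bullet> B (z, x))"
        using that A \<kappa> \<open>\<tau> > 0\<close> pos[of u] u \<tau>A by (intro mult_mono) auto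
      then show ?thesis using u fy by simp
    qed
    have down: "f y \<le> - (A * \<kappa> / 2)" if "\<tau> \<le> - A"
    proof -
      have "\<tau> < 0" using that A by simp
      then obtain u where u: "\<tau> < u" "u < 0" "j 0 - j \<tau> = (0 - \<tau>) * (g (z, x + u *\<^sub>R B (z, x)) \<bullet> B (z, x))"
        using MVT2[of \<tau> 0 j "\<lambda>u. g (z, x + u *\<^sub>R B (z, x)) \<bullet> B (z, x)"] dj by blast
      have "A * (\<kappa> / 2) \<le> (0 - \<tau>) * (g (z, x + u *\<^sub>R B (z, x)) \<bullet> B (z, x))"
        using that A \<kappa> \<open>\<tau> < 0\<close> pos[of u] u \<tau>A by (intro mult_mono) auto
      then show ?thesis using u fy by simp
    qed
    have P1: "?P (\<phi> y / \<eta> + 0) = 1" if "C \<le> 1/2"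
      using that by (simp add: saw_deriv_good C_def)
    have P2: "?P (\<phi> y / \<eta> + 1/2) = 1" if "C \<ge> - 1/2"
    proof (rule saw_deriv_good)
      have "cos (2 * pi * (\<phi> y / \<eta> + 1/2)) = - C" by (simp add: C_def distrib_left cos_add)
      then show "cos (2 * pi * (\<phi> y / \<eta> + 1/2)) \<le> 1/2" using that by simp
    qed
    have Ak: "A * \<kappa> > 0" using A \<kappa> by simp
    consider "C > 1/2" | "C < - 1/2" | "- 1/2 \<le> C" "C \<le> 1/2" by linarith
    then have "b y = \<rho>1 y"
    proof cases
      case 1
      then have "\<tau> \<le> - A" using A(1) mult_left_mono[of 1 "2 * C" A] by (simp add: \<tau>)
      from down[OF this] have "f y / (A * \<kappa>) \<le> - 1/2" using Ak by (simp add: pos_divide_le_eq)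
      then have "cf y = 0" unfolding cf_def by (intro step_eq_0) linarith
      then show ?thesis using P2 1 by (simp add: b_def c1_def c2_def)
    next
      case 2
      then have "\<tau> \<ge> A" using A(1) mult_left_mono[of 1 "- 2 * C" A] by (simp add: \<tau>)
      from up[OF this] have "f y / (A * \<kappa>) \<ge> 1/2" using Ak by (simp add: pos_le_divide_eq)
      then have "cf y = 1" unfolding cf_def by (intro step_eq_1) linarith
      then show ?thesis using P1 2 by (simp add: b_def c1_def c2_def)
    next
      case 3
      then show ?thesis using P1 P2 by (simp add: b_def c1_def c2_def algebra_simps)
    qed
    then show ?thesis by (simp add: y_def)
  qed
  have fin1: "\<forall>y. \<exists>b. \<bar>b\<bar> \<le> M * (\<rho> y * transverse_cut f \<nu> \<kappa> y) \<and> jet_approx r E h b \<nu> y"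
    using J b unfolding \<rho>1_def by blast
  have fin2: "\<forall>z x. f (z, x) = 0 \<longrightarrow> jet_approx r E h (\<rho> (z, G z 1 x) * transverse_cut f \<nu> \<kappa> (z, G z 1 x)) \<nu> (z, G z 1 x)"
    using J good unfolding \<rho>1_def by metis
  have fin3: "\<forall>z t x. norm (G z t x - x) < E" "\<forall>y. y \<notin> K \<longrightarrow> h y = 0" using Gsmall hK by blast+
  show ?thesis
    by (intro exI[of _ G] exI[of _ Gi] exI[of _ K'] exI[of _ h] conjI iso K'(1,2) sh' fin1 fin2 fin3)
qed

subsection \<open>Finite sums of rank one terms\<close>

lemma jet_approx_mono: "jet_approx r E h b \<nu> y \<Longrightarrow> E \<le> E' \<Longrightarrow> jet_approx r E' h b \<nu> y"
  unfolding jet_approx_def by (blast intro: order_less_le_trans)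

text \<open>The image of the hyperplane is the zero set of the i0-th coordinate of the inverse.
  Moving the preimage along the i0-th axis gives a curve on which f grows at unit speed, so its
  gradient cannot vanish.\<close>

lemma isotopy_coordinate:
  fixes F :: "real^'q::finite \<Rightarrow> real \<Rightarrow> real^'m::finite \<Rightarrow> real^'m" and i0 :: 'm
  assumes F: "smooth_isotopy F Fi K0"
  defines "f \<equiv> \<lambda>y. Fi (fst y) 1 (snd y) $ i0"
  shows "smooth f" and "gradx f y \<noteq> 0"
proof -
  note FD = smooth_isotopyD[OF F]
  have s: "smooth (\<lambda>y. ((fst y, 1::real), snd y))" by (intro smooth_intros)
  show sf: "smooth f" unfolding f_def
    using smooth_compose[OF FD(2) s] by (intro smooth_intros) simp
  obtain z x where y: "y = (z, x)" by (cases y)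
  define \<gamma> where "\<gamma> = (\<lambda>s::real. F z 1 (Fi z 1 x + s *\<^sub>R axis i0 1))"
  have "smooth (\<lambda>s::real. ((z, 1::real), Fi z 1 x + s *\<^sub>R axis i0 1))" by (intro smooth_intros)
  from smooth_compose[OF FD(1) this] have "smooth \<gamma>" unfolding \<gamma>_def by simp
  from smooth_has_derivative[OF this, of 0] obtain \<gamma>' where \<gamma>': "(\<gamma> has_derivative \<gamma>') (at 0)" by blast
  have \<gamma>0: "\<gamma> 0 = x" by (simp add: \<gamma>_def FD)
  have "((\<lambda>s. f (z, \<gamma> s)) has_derivative (\<lambda>s. gradx f y \<bullet> \<gamma>' s)) (at 0)"
    using has_derivative_compose[OF \<gamma>' has_derivative_slice[OF sf]] 
    by (simp add: frechet_derivative_gradx[OF sf] \<gamma>0 y)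
  moreover have "(\<lambda>s. f (z, \<gamma> s)) = (\<lambda>s. Fi z 1 x $ i0 + s)"
    by (simp add: f_def \<gamma>_def FD axis_def)
  moreover have "((\<lambda>s. Fi z 1 x $ i0 + s) has_derivative (\<lambda>s. s)) (at 0)"
    by (auto intro!: derivative_eq_intros)
  ultimately have "(\<lambda>s. gradx f y \<bullet> \<gamma>' s) = (\<lambda>s. s)"
    using has_derivative_unique by metis
  then have "gradx f y \<bullet> \<gamma>' 1 = 1" by metis
  then show "gradx f y \<noteq> 0" by auto
qed

text \<open>The weight is split by \<open>transverse_cut\<close>. Only the transverse half moves
  points, and its isotopy is taken smaller than the \<delta> of the tangent half, whose closeness
  therefore holds at the displaced points.\<close>

lemma rank_one_step:
  fixes F :: "real^'q::finite \<Rightarrow> real \<Rightarrow> real^'m::finite \<Rightarrow> real^'m"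
  assumes F: "smooth_isotopy F Fi K0" and \<rho>: "smooth \<rho>" "\<And>y. \<rho> y \<ge> 0" 
    and K: "compact K" "\<forall>y. y \<notin> K \<longrightarrow> \<rho> y = 0" "K \<subseteq> U" "open U" 
    and \<nu>: "norm \<nu> = 1" and E: "E > 0"
    and M: "\<And>t. \<bar>(deriv ^^ r) (saw r) t\<bar> \<le> M"
  shows "\<exists>G Gi K' h. smooth_isotopy G Gi K' \<and> compact K' \<and> K' \<subseteq> U \<and> (\<forall>z t x. norm (G z t x - x) < E) \<and> 
    smooth h \<and> (\<forall>y. y \<notin> K \<longrightarrow> h y = 0) \<and>
    (\<forall>y. \<exists>b. \<bar>b\<bar> \<le> M * \<rho> y \<and> jet_approx r E h b \<nu> y) \<and>
    (\<forall>z x. x $ i0 = 0 \<longrightarrow> jet_approx r E h (\<rho> (z, G z 1 (F z 1 x))) \<nu> (z, G z 1 (F z 1 x)))"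
proof -
  define f where "f = (\<lambda>y. Fi (fst y) 1 (snd y) $ i0)"
  have f: "smooth f" "gradx f y \<noteq> 0" for y
    unfolding f_def by (rule isotopy_coordinate[OF F])+
  have E2: "E / 2 > 0" using E by simp
  obtain \<kappa> h0 \<delta> where \<kappa>: "\<kappa> > 0" and h0: "smooth h0" "\<forall>y. y \<notin> K \<longrightarrow> h0 y = 0"
    "\<forall>y. \<exists>b. \<bar>b\<bar> \<le> M * (\<rho> y * (1 - transverse_cut f \<nu> \<kappa> y)) \<and> jet_approx r (E/2) h0 b \<nu> y"
    and \<delta>: "\<delta> > 0" "\<forall>y y'. f y = 0 \<longrightarrow> dist y y' < \<delta> \<longrightarrow> jet_approx r (E/2) h0 (\<rho> y' * (1 - transverse_cut f \<nu> \<kappa> y')) \<nu> y'"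
    using tangent_part[OF f \<rho> K(1) K(2)[rule_format] \<nu> E2 M] by blast
  define E' where "E' = min (E/2) \<delta>"
  have E': "E' > 0" "E' \<le> E/2" "E' \<le> \<delta>" using E \<delta> by (auto simp: E'_def)
  obtain G Gi K' h1 where G: "smooth_isotopy G Gi K'" "compact K'" "K' \<subseteq> U" "\<forall>z t x. norm (G z t x - x) < E'"
    and h1: "smooth h1" "\<forall>y. y \<notin> K \<longrightarrow> h1 y = 0"
    "\<forall>y. \<exists>b. \<bar>b\<bar> \<le> M * (\<rho> y * transverse_cut f \<nu> \<kappa> y) \<and> jet_approx r E' h1 b \<nu> y"
    "\<forall>z x. f (z, x) = 0 \<longrightarrow> jet_approx r E' h1 (\<rho> (z, G z 1 x) * transverse_cut f \<nu> \<kappa> (z, G z 1 x)) \<nu> (z, G z 1 x)"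
    using transverse_part[OF f(1) \<rho> K(1) K(2)[rule_format] K(3,4) \<nu> E'(1) \<kappa> M] by blast
  define h where "h = (\<lambda>y. h0 y + h1 y)"
  have sh: "smooth h" unfolding h_def by (intro smooth_intros h0 h1)
  have hK: "\<forall>y. y \<notin> K \<longrightarrow> h y = 0"
  proof (intro allI impI)
    fix y assume "y \<notin> K"
    then have "h0 y = 0" "h1 y = 0" using h0(2) h1(2) by blast+
    then show "h y = 0" by (simp add: h_def)
  qed
  have add: "jet_approx r E h (b + b') \<nu> y" if "jet_approx r (E/2) h0 b \<nu> y" "jet_approx r E' h1 b' \<nu> y" for b b' y
    using jet_approx_add[OF h0(1) h1(1) that(1) jet_approx_mono[OF that(2) E'(2)]] by (simp add: h_def)
  have 1: "\<forall>y. \<exists>b. \<bar>b\<bar> \<le> M * \<rho> y \<and> jet_approx r E h b \<nu> y"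
  proof
    fix y
    obtain b where b: "\<bar>b\<bar> \<le> M * (\<rho> y * (1 - transverse_cut f \<nu> \<kappa> y))" "jet_approx r (E/2) h0 b \<nu> y"
      using h0(3) by blast
    obtain b' where b': "\<bar>b'\<bar> \<le> M * (\<rho> y * transverse_cut f \<nu> \<kappa> y)" "jet_approx r E' h1 b' \<nu> y"
      using h1(3) by blast
    have "\<bar>b + b'\<bar> \<le> M * (\<rho> y * (1 - transverse_cut f \<nu> \<kappa> y)) + M * (\<rho> y * transverse_cut f \<nu> \<kappa> y)"
      using b b' by linarith
    also have "\<dots> = M * \<rho> y" by (simp add: algebra_simps)
    finally show "\<exists>b. \<bar>b\<bar> \<le> M * \<rho> y \<and> jet_approx r E h b \<nu> y" using add[OF b(2) b'(2)] by blast
  qed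
  have 2: "\<forall>z x. x $ i0 = 0 \<longrightarrow> jet_approx r E h (\<rho> (z, G z 1 (F z 1 x))) \<nu> (z, G z 1 (F z 1 x))"
  proof (intro allI impI)
    fix z :: "real^'q" and x :: "real^'m" assume "x $ i0 = 0"
    then have f0: "f (z, F z 1 x) = 0" by (simp add: f_def smooth_isotopyD[OF F])
    let ?y = "(z, G z 1 (F z 1 x))"
    have "norm (G z 1 (F z 1 x) - F z 1 x) < \<delta>" using G(4) E'(3) order_less_le_trans by blast
    then have "dist (z, F z 1 x) ?y < \<delta>" by (simp add: dist_Pair_Pair dist_norm norm_minus_commute)
    with \<delta>(2) f0 have a: "jet_approx r (E/2) h0 (\<rho> ?y * (1 - transverse_cut f \<nu> \<kappa> ?y)) \<nu> ?y" by blast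
    have "jet_approx r E' h1 (\<rho> ?y * transverse_cut f \<nu> \<kappa> ?y) \<nu> ?y" using h1(4) f0 by blast
    from add[OF a this] show "jet_approx r E h (\<rho> ?y) \<nu> ?y" by (simp add: algebra_simps)
  qed
  have "\<forall>z t x. norm (G z t x - x) < E"
  proof (intro allI)
    fix z t x
    show "norm (G z t x - x) < E" using G(4)[rule_format, of z t x] E'(2) E by linarith
  qed
  then show ?thesis
    by (intro exI[of _ G] exI[of _ Gi] exI[of _ K'] exI[of _ h] conjI G(1-3) sh hK 1 2)
qed

text \<open>\<open>sum_approx\<close> states that the jet of \<open>H\<close> is close to the pure top order jet
  \<open>\<Sum>j. b j \<cdot> (\<nu> j)\<^sup>r \<otimes> a j\<close>.\<close>

definition sum_approx :: "nat \<Rightarrow> real \<Rightarrow> ('z::real_normed_vector \<times> (real^'m::finite) \<Rightarrow> 'b::real_normed_vector) \<Rightarrow>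
    'j set \<Rightarrow> ('j \<Rightarrow> real^'m) \<Rightarrow> ('j \<Rightarrow> 'b) \<Rightarrow> ('j \<Rightarrow> real) \<Rightarrow> 'z \<times> (real^'m) \<Rightarrow> bool" where
  "sum_approx r E H J \<nu> a b y \<longleftrightarrow> (\<forall>is. length is \<le> r \<longrightarrow>
    norm (DL is H y - (if length is = r then \<Sum>j\<in>J. (b j * (\<Prod>i\<leftarrow>is. \<nu> j $ i)) *\<^sub>R a j else 0)) < E)"

lemma sum_approx_insert:
  fixes H :: "'z::real_normed_vector \<times> (real^'m::finite) \<Rightarrow> 'b::real_normed_vector"
  assumes J: "finite J" "j0 \<notin> J" and s: "smooth H" "smooth h"
    and H: "sum_approx r E H J \<nu> a b y" and h: "jet_approx r E' h c (\<nu> j0) y" and E': "E' * norm (a j0) \<le> E"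
  shows "sum_approx r (E + E) (\<lambda>y. H y + h y *\<^sub>R a j0) (insert j0 J) \<nu> a (b(j0 := c)) y"
  unfolding sum_approx_def
proof (intro allI impI)
  fix "is" :: "'m list" assume len: "length is \<le> r"
  define P where "P = (if length is = r then \<Sum>j\<in>J. (b j * (\<Prod>i\<leftarrow>is. \<nu> j $ i)) *\<^sub>R a j else 0)"
  define p where "p = (if length is = r then c * (\<Prod>i\<leftarrow>is. \<nu> j0 $ i) else 0)"
  have 1: "norm (DL is H y - P) < E" using H len by (simp add: sum_approx_def P_def)
  have 2: "\<bar>DL is h y - p\<bar> < E'" using h len by (simp add: jet_approx_def p_def)
  have D: "DL is (\<lambda>y. H y + h y *\<^sub>R a j0) y = DL is H y + DL is h y *\<^sub>R a j0"
    using s by (simp add: DL_add DL_scaleR smooth_scaleR smooth_const)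
  have S: "(\<Sum>j\<in>J. ((b(j0 := c)) j * (\<Prod>i\<leftarrow>is. \<nu> j $ i)) *\<^sub>R a j) = (\<Sum>j\<in>J. (b j * (\<Prod>i\<leftarrow>is. \<nu> j $ i)) *\<^sub>R a j)"
    using J by (intro sum.cong) auto
  have Q: "(if length is = r then \<Sum>j\<in>insert j0 J. ((b(j0 := c)) j * (\<Prod>i\<leftarrow>is. \<nu> j $ i)) *\<^sub>R a j else 0) = P + p *\<^sub>R a j0"
    using J S by (simp add: P_def p_def add.commute)
  have "norm ((DL is H y - P) + (DL is h y - p) *\<^sub>R a j0) \<le> norm (DL is H y - P) + \<bar>DL is h y - p\<bar> * norm (a j0)"
    by (metis norm_triangle_ineq norm_scaleR)
  also have "\<dots> < E + E"
    using 1 2 E' mult_right_mono[of "\<bar>DL is h y - p\<bar>" E' "norm (a j0)"] by auto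
  finally show "norm (DL is (\<lambda>y. H y + h y *\<^sub>R a j0) y - 
    (if length is = r then \<Sum>j\<in>insert j0 J. ((b(j0 := c)) j * (\<Prod>i\<leftarrow>is. \<nu> j $ i)) *\<^sub>R a j else 0)) < E + E"
    unfolding D Q by (simp add: algebra_simps)
qed

lemma open_sum_approx:
  fixes H :: "'z::euclidean_space \<times> (real^'m::finite) \<Rightarrow> 'b::real_normed_vector"
  assumes "smooth H" "\<And>j. j \<in> J \<Longrightarrow> smooth (\<rho> j)"
  shows "open {y. sum_approx r E H J \<nu> a (\<lambda>j. \<rho> j y) y}"
proof -
  have "finite {is::'m list. length is \<le> r}"
    using finite_lists_length_le[of "UNIV::'m set" r] by simp
  moreover have "open {y. norm (DL is H y - (if length is = r then \<Sum>j\<in>J. (\<rho> j y * (\<Prod>i\<leftarrow>is. \<nu> j $ i)) *\<^sub>R a j else 0)) < E}" for "is"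
  proof -
    have "smooth (\<lambda>y. DL is H y - (if length is = r then \<Sum>j\<in>J. (\<rho> j y * (\<Prod>i\<leftarrow>is. \<nu> j $ i)) *\<^sub>R a j else 0))"
      using assms by (cases "length is = r") (auto intro!: smooth_intros)
    then show ?thesis
      by (intro open_Collect_less continuous_on_norm continuous_on_const smooth_continuous)
  qed
  ultimately have "open (\<Inter>is\<in>{is. length is \<le> r}. {y. norm (DL is H y - (if length is = r then \<Sum>j\<in>J. (\<rho> j y * (\<Prod>i\<leftarrow>is. \<nu> j $ i)) *\<^sub>R a j else 0)) < E})"
    by (intro open_INT) auto
  also have "\<dots> = {y. sum_approx r E H J \<nu> a (\<lambda>j. \<rho> j y) y}"
    unfolding sum_approx_def by blast
  finally show ?thesis .
qed

text \<open>Closeness achieved so far holds on a neighborhood of the image of the hyperplane and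
  therefore survives the next, sufficiently small, isotopy.\<close>

lemma rank_one_induction:
  fixes \<rho> :: "'j \<Rightarrow> (real^'q::finite) \<times> (real^'m::finite) \<Rightarrow> real" and a :: "'j \<Rightarrow> 'b::real_normed_vector"
  assumes "finite J" and \<rho>: "\<forall>j\<in>J. smooth (\<rho> j)" "\<forall>j\<in>J. \<forall>y. \<rho> j y \<ge> 0" 
    and KJ: "\<forall>j\<in>J. compact (KJ j)" "\<forall>j\<in>J. \<forall>y. y \<notin> KJ j \<longrightarrow> \<rho> j y = 0" "\<forall>j\<in>J. KJ j \<subseteq> U" 
    and U: "open U" and \<nu>: "\<forall>j\<in>J. norm (\<nu> j) = 1" and E: "E > 0"
    and M: "\<And>t. \<bar>(deriv ^^ r) (saw r) t\<bar> \<le> M" and Q: "compact Q"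
  shows "\<exists>F Fi K H. smooth_isotopy F Fi K \<and> compact K \<and> K \<subseteq> U \<and> (\<forall>z t x. norm (F z t x - x) < E) \<and> 
    smooth H \<and> (\<forall>y. y \<notin> K \<longrightarrow> H y = 0) \<and>
    (\<forall>y. \<exists>b. (\<forall>j\<in>J. \<bar>b j\<bar> \<le> M * \<rho> j y) \<and> sum_approx r E H J \<nu> a b y) \<and>
    (\<forall>z x. (z, x) \<in> Q \<longrightarrow> x $ i0 = 0 \<longrightarrow> sum_approx r E H J \<nu> a (\<lambda>j. \<rho> j (z, F z 1 x)) (z, F z 1 x))"
  using assms(1) \<rho> KJ \<nu> E
proof (induction J arbitrary: E rule: finite_induct)
  case empty
  have D0: "DL is (\<lambda>y. 0) y = 0" for "is" :: "'m list" and y :: "(real^'q) \<times> (real^'m)"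
    by (rule DL_vanish[of UNIV]) auto
  show ?case
    by (intro exI[of _ "\<lambda>z t x. x"] exI[of _ "{}"] exI[of _ "\<lambda>y. 0"])
      (use empty in \<open>auto simp: smooth_isotopy_id sum_approx_def D0 smooth_const\<close>)
next
  case (insert j0 J)
  have E2: "E / 2 > 0" using insert.prems by simp
  have prems: "\<forall>j\<in>J. smooth (\<rho> j)" "\<forall>j\<in>J. \<forall>y. \<rho> j y \<ge> 0" "\<forall>j\<in>J. compact (KJ j)" 
    "\<forall>j\<in>J. \<forall>y. y \<notin> KJ j \<longrightarrow> \<rho> j y = 0" "\<forall>j\<in>J. KJ j \<subseteq> U" "\<forall>j\<in>J. norm (\<nu> j) = 1"
    using insert.prems by blast+
  have j0: "smooth (\<rho> j0)" "\<And>y. \<rho> j0 y \<ge> 0" "compact (KJ j0)" "\<forall>y. y \<notin> KJ j0 \<longrightarrow> \<rho> j0 y = 0"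
    "KJ j0 \<subseteq> U" "norm (\<nu> j0) = 1"
    using insert.prems by blast+
  from insert.IH[OF prems E2]
  obtain F Fi K H where F: "smooth_isotopy F Fi K" "compact K" "K \<subseteq> U" "\<forall>z t x. norm (F z t x - x) < E / 2"
    and H: "smooth H" "\<forall>y. y \<notin> K \<longrightarrow> H y = 0"
      "\<forall>y. \<exists>b. (\<forall>j\<in>J. \<bar>b j\<bar> \<le> M * \<rho> j y) \<and> sum_approx r (E/2) H J \<nu> a b y"
      "\<forall>z x. (z, x) \<in> Q \<longrightarrow> x $ i0 = 0 \<longrightarrow> sum_approx r (E/2) H J \<nu> a (\<lambda>j. \<rho> j (z, F z 1 x)) (z, F z 1 x)"
    by (elim exE conjE)
  \<comment> \<open>Compactness of Q makes this image compact, so the open region of closeness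
    contains a neighborhood of uniform radius \<delta>.\<close>
  define C where "C = (\<lambda>y. (fst y, F (fst y) 1 (snd y))) ` (Q \<inter> {y. snd y $ i0 = 0})"
  have "smooth (\<lambda>y::(real^'q) \<times> (real^'m). ((fst y, 1::real), snd y))" by (intro smooth_intros)
  from smooth_compose[OF smooth_isotopyD(1)[OF F(1)] this]
  have sF: "smooth (\<lambda>y. F (fst y) 1 (snd y))" by simp
  have cC: "compact C" unfolding C_def
    by (intro compact_continuous_image compact_Int_closed Q closed_Collect_eq continuous_intros
       smooth_continuous[OF sF])
  have oO: "open {y. sum_approx r (E/2) H J \<nu> a (\<lambda>j. \<rho> j y) y}"
    using prems(1) by (intro open_sum_approx H) blast
  have sub: "C \<subseteq> {y. sum_approx r (E/2) H J \<nu> a (\<lambda>j. \<rho> j y) y}"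
  proof
    fix y assume "y \<in> C"
    then obtain z x where "(z, x) \<in> Q" "x $ i0 = 0" "y = (z, F z 1 x)" by (auto simp: C_def)
    then show "y \<in> {y. sum_approx r (E/2) H J \<nu> a (\<lambda>j. \<rho> j y) y}" using H(4) by blast
  qed
  obtain \<delta> where \<delta>: "\<delta> > 0" "(\<Union>y\<in>C. ball y \<delta>) \<subseteq> {y. sum_approx r (E/2) H J \<nu> a (\<lambda>j. \<rho> j y) y}"
    using compact_subset_open_imp_ball_epsilon_subset[OF cC oO sub] by blast
  \<comment> \<open>Three demands on the next step: half of the displacement budget, staying within
    the \<delta>-neighborhood, and an error below E/2 after multiplication by
    \<open>a j0\<close>.\<close>
  define E' where "E' = min (min (E/2) \<delta>) ((E/2) / (norm (a j0) + 1))"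
  have na: "norm (a j0) + 1 > 0" by (simp add: add_nonneg_pos)
  have "E' \<le> min (E/2) \<delta>" unfolding E'_def by (rule min.cobounded1)
  moreover have "E' > 0" using E2 \<delta>(1) na by (simp add: E'_def)
  ultimately have E': "E' > 0" "E' \<le> E/2" "E' \<le> \<delta>" by auto
  have "E' \<le> (E/2) / (norm (a j0) + 1)" by (simp add: E'_def)
  then have "E' * (norm (a j0) + 1) \<le> E/2" using na by (simp only: pos_le_divide_eq)
  then have E'a: "E' * norm (a j0) \<le> E/2" using E'(1) by (simp add: distrib_left)
  from rank_one_step[OF F(1) j0(1-5) U j0(6) E'(1) M, of i0]
  obtain G Gi K' h where G: "smooth_isotopy G Gi K'" "compact K'" "K' \<subseteq> U" "\<forall>z t x. norm (G z t x - x) < E'"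
    and h: "smooth h" "\<forall>y. y \<notin> KJ j0 \<longrightarrow> h y = 0"
     "\<forall>y. \<exists>b. \<bar>b\<bar> \<le> M * \<rho> j0 y \<and> jet_approx r E' h b (\<nu> j0) y"
     "\<forall>z x. x $ i0 = 0 \<longrightarrow> jet_approx r E' h (\<rho> j0 (z, G z 1 (F z 1 x))) (\<nu> j0) (z, G z 1 (F z 1 x))"
    by (elim exE conjE)
  define F' where "F' = (\<lambda>z t x. G z t (F z t x))"
  define H' where "H' = (\<lambda>y. H y + h y *\<^sub>R a j0)"
  have iso: "smooth_isotopy F' (\<lambda>z t x. Fi z t (Gi z t x)) (K \<union> K')"
    unfolding F'_def by (rule smooth_isotopy_compose[OF F(1) G(1)])
  have add: "sum_approx r E H' (insert j0 J) \<nu> a (b(j0 := c)) y"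
    if "sum_approx r (E/2) H J \<nu> a b y" "jet_approx r E' h c (\<nu> j0) y" for b c y
    using sum_approx_insert[OF insert.hyps(1,2) H(1) h(1) that E'a] by (simp add: H'_def)
  have 1: "\<forall>y. \<exists>b. (\<forall>j\<in>insert j0 J. \<bar>b j\<bar> \<le> M * \<rho> j y) \<and> sum_approx r E H' (insert j0 J) \<nu> a b y"
  proof
    fix y
    obtain b where b: "\<forall>j\<in>J. \<bar>b j\<bar> \<le> M * \<rho> j y" "sum_approx r (E/2) H J \<nu> a b y" using H(3) by blast
    obtain c where c: "\<bar>c\<bar> \<le> M * \<rho> j0 y" "jet_approx r E' h c (\<nu> j0) y" using h(3) by blast
    show "\<exists>b. (\<forall>j\<in>insert j0 J. \<bar>b j\<bar> \<le> M * \<rho> j y) \<and> sum_approx r E H' (insert j0 J) \<nu> a b y"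
      using add[OF b(2) c(2)] b c insert.hyps(2) by (intro exI[of _ "b(j0 := c)"]) auto
  qed
  have 2: "\<forall>z x. (z, x) \<in> Q \<longrightarrow> x $ i0 = 0 \<longrightarrow> sum_approx r E H' (insert j0 J) \<nu> a (\<lambda>j. \<rho> j (z, F' z 1 x)) (z, F' z 1 x)"
  proof (intro allI impI)
    fix z :: "real^'q" and x :: "real^'m" assume zx: "(z, x) \<in> Q" "x $ i0 = 0"
    let ?y = "(z, F' z 1 x)"
    have "(z, F z 1 x) \<in> C" unfolding C_def using zx by (intro image_eqI[of _ _ "(z, x)"]) auto
    moreover have "dist (z, F z 1 x) ?y < \<delta>"
      using G(4)[rule_format, of z 1 "F z 1 x"] E'(3) by (simp add: F'_def dist_Pair_Pair dist_norm norm_minus_commute)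
    ultimately have "sum_approx r (E/2) H J \<nu> a (\<lambda>j. \<rho> j ?y) ?y" using \<delta>(2) by fastforce
    moreover have "jet_approx r E' h (\<rho> j0 ?y) (\<nu> j0) ?y" using h(4) zx(2) by (simp add: F'_def)
    ultimately have "sum_approx r E H' (insert j0 J) \<nu> a ((\<lambda>j. \<rho> j ?y)(j0 := \<rho> j0 ?y)) ?y" by (rule add)
    moreover have "(\<lambda>j. \<rho> j ?y)(j0 := \<rho> j0 ?y) = (\<lambda>j. \<rho> j ?y)" by auto
    ultimately show "sum_approx r E H' (insert j0 J) \<nu> a (\<lambda>j. \<rho> j ?y) ?y" by (simp only:)
  qed
  have 3: "\<forall>z t x. norm (F' z t x - x) < E"
  proof (intro allI)
    fix z t x
    have "norm (F' z t x - x) \<le> norm (G z t (F z t x) - F z t x) + norm (F z t x - x)"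
      unfolding F'_def using norm_triangle_ineq[of "G z t (F z t x) - F z t x" "F z t x - x"] by simp
    then show "norm (F' z t x - x) < E"
      using G(4)[rule_format, of z t "F z t x"] F(4)[rule_format, of z t x] E'(2) by simp
  qed
  have 4: "\<forall>y. y \<notin> K \<union> K' \<union> KJ j0 \<longrightarrow> H' y = 0"
  proof (intro allI impI)
    fix y assume "y \<notin> K \<union> K' \<union> KJ j0"
    then have "H y = 0" "h y = 0" using H(2) h(2) by blast+
    then show "H' y = 0" by (simp add: H'_def)
  qed
  have 5: "smooth H'" unfolding H'_def by (intro smooth_intros H h)
  have 6: "compact (K \<union> K' \<union> KJ j0)" "K \<union> K' \<union> KJ j0 \<subseteq> U"
    using F G j0 by (auto intro!: compact_Un)
  show ?case
    by (rule exI[of _ F'], rule exI[of _ "\<lambda>z t x. Fi z t (Gi z t x)"], rule exI[of _ "K \<union> K' \<union> KJ j0"], rule exI[of _ H'])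
      (intro conjI smooth_isotopy_mono[OF iso] 6 5 4 3 2 1; blast)
qed

subsection \<open>Jets and the cube\<close>

text \<open>A list with given multiplicities exists because the index type is finite. The estimates
  are stated for all lists, so they hold for whichever list the choice in \<open>mlist\<close>
  returns.\<close>

lemma mlist_count: "count_list (mlist \<alpha>) i = \<alpha> i"
proof -
  have "\<exists>xs. \<forall>i. count_list xs i = (if i \<in> S then \<alpha> i else 0)" if "finite S" for S :: "'a set"
    using that
  proof (induction S rule: finite_induct)
    case empty
    show ?case by (intro exI[of _ "[]"]) simp
  next
    case (insert a S)
    then obtain xs where xs: "\<forall>i. count_list xs i = (if i \<in> S then \<alpha> i else 0)" by blast
    have "count_list (replicate n a) i = (if i = a then n else 0)" for n i
      by (induction n) auto
    then show ?case using xs insert.hyps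
      by (intro exI[of _ "replicate (\<alpha> a) a @ xs"]) auto
  qed
  from this[of UNIV] have "\<exists>xs. \<forall>i. count_list xs i = \<alpha> i" by simp
  then show ?thesis unfolding mlist_def by (rule someI2_ex) blast
qed

lemma length_mlist: "length (mlist \<alpha>) = mabs \<alpha>"
proof -
  have "length xs = (\<Sum>i\<in>UNIV. count_list xs i)" for xs :: "'a list"
    using sum_count_set[of xs UNIV] by simp
  then show ?thesis by (simp add: mabs_def mlist_count)
qed

definition mpow :: "real^'m::finite \<Rightarrow> 'm mindex \<Rightarrow> real" where
  "mpow \<nu> \<alpha> = (\<Prod>i\<in>UNIV. (\<nu> $ i) ^ \<alpha> i)"

lemma prod_mlist: "(\<Prod>i\<leftarrow>mlist \<alpha>. \<nu> $ i) = mpow \<nu> \<alpha>"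
proof -
  have "(\<Prod>i\<leftarrow>xs. \<nu> $ i) = (\<Prod>i\<in>UNIV. (\<nu> $ i) ^ count_list xs i)" for xs :: "'a list"
  proof (induction xs)
    case (Cons x xs)
    have "(\<Prod>i\<in>UNIV. (\<nu> $ i) ^ count_list (x # xs) i) = (\<Prod>i\<in>UNIV. (if i = x then \<nu> $ i else 1) * (\<nu> $ i) ^ count_list xs i)"
      by (intro prod.cong) auto
    then show ?case using Cons by (simp add: prod.distrib)
  qed simp
  then show ?thesis by (simp add: mpow_def mlist_count)
qed

lemma mpow_madd1: "mpow \<nu> (madd1 \<alpha> i) = \<nu> $ i * mpow \<nu> \<alpha>"
proof -
  have "mpow \<nu> (madd1 \<alpha> i) = (\<Prod>k\<in>UNIV. (if k = i then \<nu> $ k else 1) * (\<nu> $ k) ^ \<alpha> k)"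
    unfolding mpow_def by (intro prod.cong) (auto simp: madd1_def)
  then show ?thesis by (simp add: prod.distrib mpow_def)
qed

lemma mabs_madd1: "mabs (madd1 \<alpha> i) = Suc (mabs \<alpha>)"
proof -
  have "mabs (madd1 \<alpha> i) = (\<Sum>k\<in>UNIV. (if k = i then 1 else 0) + \<alpha> k)"
    unfolding mabs_def by (intro sum.cong) (auto simp: madd1_def)
  then show ?thesis by (simp add: sum.distrib mabs_def)
qed

lemma abs_mpow_le_1: "norm \<nu> = 1 \<Longrightarrow> \<bar>mpow \<nu> \<alpha>\<bar> \<le> 1"
  unfolding mpow_def abs_prod power_abs
  by (intro prod_le_1) (metis abs_ge_zero component_le_norm_cart power_le_one zero_le_power)

lemma finite_mindices: "finite {\<alpha>::'m::finite mindex. mabs \<alpha> \<le> r}"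
proof -
  have "{\<alpha>::'m mindex. mabs \<alpha> \<le> r} \<subseteq> PiE UNIV (\<lambda>_. {..r})"
    by (auto simp: mabs_def PiE_iff) (meson UNIV_I finite member_le_sum order_trans zero_le)
  then show ?thesis by (rule finite_subset) (intro finite_PiE; simp)
qed

text \<open>The vector \<nu>_k e_i - \<nu>_i e_k is orthogonal to \<nu>, so an index i can be traded
  for k at the cost of \<nu>_i / \<nu>_k. With \<nu>_k nonzero, all entries of order r reduce to the
  pure one in direction k.\<close>

lemma rank_one_jet:
  fixes s :: "('m::finite, 'n::finite) jet"
  assumes perp: "perp_zero r {v. \<nu> \<bullet> v = 0} s" and \<nu>: "\<nu> \<noteq> 0" and r: "r \<ge> 1"
  shows "\<exists>a. \<forall>\<alpha>. mabs \<alpha> = r \<longrightarrow> s \<alpha> = mpow \<nu> \<alpha> *\<^sub>R a"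
proof -
  obtain k where k: "\<nu> $ k \<noteq> 0" using \<nu> by (auto simp: vec_eq_iff)
  have swap: "\<nu> $ k *\<^sub>R s (madd1 \<beta> i) = \<nu> $ i *\<^sub>R s (madd1 \<beta> k)" if \<beta>: "mabs \<beta> < r" for \<beta> i
  proof -
    define v where "v = \<nu> $ k *\<^sub>R axis i 1 - \<nu> $ i *\<^sub>R axis k (1::real)"
    have "\<nu> \<bullet> v = 0" by (simp add: v_def inner_diff_right inner_axis)
    then have "jet_dir s v \<beta> = 0" using perp \<beta> unfolding perp_zero_def by blast
    moreover have "jet_dir s v \<beta> = (\<Sum>l\<in>UNIV. (if l = i then \<nu> $ k *\<^sub>R s (madd1 \<beta> l) else 0) - (if l = k then \<nu> $ i *\<^sub>R s (madd1 \<beta> l) else 0))"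
      unfolding jet_dir_def by (intro sum.cong) (auto simp: v_def axis_def scaleR_diff_left)
    ultimately show ?thesis by (simp add: sum_subtractf)
  qed
  define \<alpha>0 where "\<alpha>0 = (\<lambda>i. if i = k then r else 0)"
  define a where "a = (1 / (\<nu> $ k) ^ r) *\<^sub>R s \<alpha>0"
  have "s \<alpha> = mpow \<nu> \<alpha> *\<^sub>R a" if "mabs \<alpha> = r" for \<alpha>
    using that
  proof (induction "r - \<alpha> k" arbitrary: \<alpha>)
    case 0
    have split: "mabs \<alpha> = \<alpha> k + (\<Sum>i\<in>UNIV - {k}. \<alpha> i)"
      unfolding mabs_def by (rule sum.remove) auto
    then have "\<alpha> k = r" and z: "(\<Sum>i\<in>UNIV - {k}. \<alpha> i) = 0" using 0 by auto
    then have \<alpha>: "\<alpha> = \<alpha>0" by (auto simp: \<alpha>0_def fun_eq_iff)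
    have "mpow \<nu> \<alpha>0 = (\<Prod>i\<in>UNIV. if i = k then (\<nu> $ i) ^ r else 1)"
      unfolding mpow_def \<alpha>0_def by (intro prod.cong) auto
    then have "mpow \<nu> \<alpha>0 = (\<nu> $ k) ^ r" by simp
    then show ?case using k by (simp add: \<alpha> a_def)
  next
    case (Suc d)
    have split: "mabs \<alpha> = \<alpha> k + (\<Sum>i\<in>UNIV - {k}. \<alpha> i)"
      unfolding mabs_def by (rule sum.remove) auto
    then have "(\<Sum>i\<in>UNIV - {k}. \<alpha> i) \<noteq> 0" using Suc.hyps(2) Suc.prems by linarith
    then obtain i where "i \<in> UNIV - {k}" "\<alpha> i \<noteq> 0" by (meson sum.neutral)
    then have i: "i \<noteq> k" "\<alpha> i > 0" by auto
    define \<beta> where "\<beta> = \<alpha>(i := \<alpha> i - 1)"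
    have \<alpha>: "\<alpha> = madd1 \<beta> i" using i by (auto simp: \<beta>_def madd1_def fun_eq_iff)
    have \<beta>r: "Suc (mabs \<beta>) = r" using Suc.prems by (simp add: \<alpha> mabs_madd1)
    have "\<beta> k = \<alpha> k" using i by (simp add: \<beta>_def)
    then have "(madd1 \<beta> k) k = Suc (\<alpha> k)" by (simp add: madd1_def)
    moreover have "mabs (madd1 \<beta> k) = r" using \<beta>r by (simp add: mabs_madd1)
    ultimately have "s (madd1 \<beta> k) = mpow \<nu> (madd1 \<beta> k) *\<^sub>R a"
      using Suc.hyps(2) by (intro Suc.hyps(1)) simp_all
    then have "\<nu> $ k *\<^sub>R s \<alpha> = \<nu> $ k *\<^sub>R (mpow \<nu> \<alpha> *\<^sub>R a)"
      using swap[of \<beta> i] \<beta>r by (simp add: \<alpha> mpow_madd1 mult_ac)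
    then show ?case using k by (simp only: scaleR_cancel_left) simp
  qed
  then show ?thesis by blast
qed

lemma smooth_on_imp_continuous_on: "smooth_on S f \<Longrightarrow> continuous_on S f"
  unfolding smooth_on_def smooth_open_def
  by (metis Ck_on.simps(1) continuous_on_cong continuous_on_subset)

lemma compact_cube: "compact cube"
  by (simp add: cube_def compact_cbox)

lemma frontier_cube: "x \<in> cube \<Longrightarrow> x \<notin> frontier cube \<Longrightarrow> x \<in> interior cube"
  using closure_subset by (fastforce simp: frontier_def)

section \<open>Freezing the data at a point\<close>

text \<open>Normal and rank one coefficient are frozen at y0, on a ball where \<sigma> hardly
  changes. The angle between frozen normal and nearby hyperplanes is weighted by M |a|, the largest
  size that the coefficient of a sawtooth term can have.\<close>

lemma local_data:
  fixes \<tau> :: "real^'q::finite \<Rightarrow> real^'m::finite \<Rightarrow> (real^'m) set" 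
    and \<sigma> :: "real^'q \<Rightarrow> real^'m \<Rightarrow> ('m,'n::finite) jet"
  assumes r: "r \<ge> 1" and \<tau>: "smooth_hyperplane_family \<tau>"
    and \<sigma>: "\<forall>\<alpha>. mabs \<alpha> \<le> r \<longrightarrow> continuous_on (cube \<times> cube) (\<lambda>(z, x). \<sigma> z x \<alpha>)"
    and perp: "\<forall>z\<in>cube. \<forall>x\<in>cube. perp_zero r (\<tau> z x) (\<sigma> z x)"
    and \<epsilon>: "\<epsilon> > 0" and M: "M \<ge> 0" and y0: "y0 \<in> interior cube \<times> interior cube"
  shows "\<exists>d \<nu> a. d > 0 \<and> cball y0 d \<subseteq> interior cube \<times> interior cube \<and> norm \<nu> = 1 \<and>
    (\<forall>\<alpha>. mabs \<alpha> = r \<longrightarrow> \<sigma> (fst y0) (snd y0) \<alpha> = mpow \<nu> \<alpha> *\<^sub>R a) \<and>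
    (\<forall>z x. (z, x) \<in> ball y0 d \<longrightarrow> (z, x) \<in> cube \<times> cube \<longrightarrow>
      (\<forall>\<alpha>. mabs \<alpha> \<le> r \<longrightarrow> norm (\<sigma> (fst y0) (snd y0) \<alpha> - \<sigma> z x \<alpha>) < \<epsilon>) \<and>
      (\<forall>v\<in>\<tau> z x. norm v = 1 \<longrightarrow> M * norm a * \<bar>\<nu> \<bullet> v\<bar> \<le> \<epsilon>))"
proof -
  have y0': "y0 \<in> cube \<times> cube" using y0 by (auto dest: subsetD[OF interior_subset])
  from bspec[OF \<tau>[unfolded smooth_hyperplane_family_def] y0']
  obtain W n where W: "open W" "y0 \<in> W" and n: "smooth_open W (n :: (real^'q) \<times> (real^'m) \<Rightarrow> real^'m)"
    and \<tau>W: "\<forall>z x. (z, x) \<in> W \<inter> (cube \<times> cube) \<longrightarrow> n (z, x) \<noteq> 0 \<and> \<tau> z x = {v. n (z, x) \<bullet> v = 0}"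
    by (elim exE conjE)
  have n0: "n y0 \<noteq> 0" "\<tau> (fst y0) (snd y0) = {v. n y0 \<bullet> v = 0}"
    using \<tau>W W y0' by (metis IntI prod.collapse)+
  define \<nu> where "\<nu> = (1 / norm (n y0)) *\<^sub>R n y0"
  have \<nu>: "norm \<nu> = 1" using n0 by (simp add: \<nu>_def)
  have \<tau>\<nu>: "\<tau> (fst y0) (snd y0) = {v. \<nu> \<bullet> v = 0}" using n0 by (simp add: \<nu>_def)
  have "perp_zero r {v. \<nu> \<bullet> v = 0} (\<sigma> (fst y0) (snd y0))"
    using perp y0' \<tau>\<nu> by (metis mem_Times_iff)
  then obtain a where a: "\<forall>\<alpha>. mabs \<alpha> = r \<longrightarrow> \<sigma> (fst y0) (snd y0) \<alpha> = mpow \<nu> \<alpha> *\<^sub>R a"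
    using rank_one_jet[of r \<nu>] \<nu> r by fastforce
  have "open (interior (cube :: (real^'q) set) \<times> interior (cube :: (real^'m) set))"
    by (intro open_Times open_interior)
  from open_contains_cball[THEN iffD1, rule_format, OF this y0]
  obtain d1 where d1: "d1 > 0" "cball y0 d1 \<subseteq> interior cube \<times> interior cube" by blast
  have "\<exists>d>0. \<forall>y\<in>cube \<times> cube. dist y y0 < d \<longrightarrow> norm (\<sigma> (fst y0) (snd y0) \<alpha> - \<sigma> (fst y) (snd y) \<alpha>) < \<epsilon>"
    if "mabs \<alpha> \<le> r" for \<alpha>
  proof -
    have "continuous_on (cube \<times> cube) (\<lambda>y. \<sigma> (fst y) (snd y) \<alpha>)" using \<sigma> that by (simp add: case_prod_beta')
    then show ?thesis unfolding continuous_on_iff dist_norm using y0' \<epsilon> by (metis norm_minus_commute)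
  qed
  then obtain d2 where d2: "\<And>\<alpha>. mabs \<alpha> \<le> r \<Longrightarrow> d2 \<alpha> > 0" 
    "\<And>\<alpha> y. mabs \<alpha> \<le> r \<Longrightarrow> y \<in> cube \<times> cube \<Longrightarrow> dist y y0 < d2 \<alpha> \<Longrightarrow> norm (\<sigma> (fst y0) (snd y0) \<alpha> - \<sigma> (fst y) (snd y) \<alpha>) < \<epsilon>"
    by metis
  define D2 where "D2 = Min (insert 1 (d2 ` {\<alpha>. mabs \<alpha> \<le> r}))"
  have D2: "D2 > 0" "\<And>\<alpha>. mabs \<alpha> \<le> r \<Longrightarrow> D2 \<le> d2 \<alpha>"
  proof -
    have fin: "finite (insert 1 (d2 ` {\<alpha>. mabs \<alpha> \<le> r}))" by (simp add: finite_mindices)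
    show "D2 > 0" unfolding D2_def using d2(1) by (subst Min_gr_iff[OF fin]) auto
    show "D2 \<le> d2 \<alpha>" if "mabs \<alpha> \<le> r" for \<alpha>
      unfolding D2_def using that by (intro Min_le[OF fin]) auto
  qed
  \<comment> \<open>If the unnormalized normal varies by less than e, its product at y0 with a unit
    vector of a nearby hyperplane is at most e. Division by its length leaves \<epsilon> / (M |a| +
    1), where the 1 covers M |a| = 0.\<close>
  define e where "e = \<epsilon> * norm (n y0) / (M * norm a + 1)"
  have Ma: "M * norm a + 1 > 0" using M by (intro add_nonneg_pos) auto
  have e: "e > 0" using \<epsilon> n0 Ma by (simp add: e_def)
  have "continuous_on W n" using n unfolding smooth_open_def by (metis Ck_on.simps(1))
  then have "isCont n y0" using W by (simp add: continuous_on_eq_continuous_at)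
  then obtain d3 where d3: "d3 > 0" "\<And>y. dist y y0 < d3 \<Longrightarrow> dist (n y) (n y0) < e"
    using e unfolding continuous_at_eps_delta by metis
  obtain d4 where d4: "d4 > 0" "ball y0 d4 \<subseteq> W" using W open_contains_ball by metis
  define d where "d = min (min d1 D2) (min d3 d4)"
  have d: "d > 0" "d \<le> d1" "d \<le> D2" "d \<le> d3" "d \<le> d4" using d1 D2 d3 d4 by (auto simp: d_def)
  have "norm (\<sigma> (fst y0) (snd y0) \<alpha> - \<sigma> z x \<alpha>) < \<epsilon>" 
    if "(z, x) \<in> ball y0 d" "(z, x) \<in> cube \<times> cube" "mabs \<alpha> \<le> r" for z x \<alpha>
    using d2(2)[of \<alpha> "(z, x)"] D2(2)[of \<alpha>] d that by (auto simp: dist_commute)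
  moreover have "M * norm a * \<bar>\<nu> \<bullet> v\<bar> \<le> \<epsilon>"
    if zx: "(z, x) \<in> ball y0 d" "(z, x) \<in> cube \<times> cube" and v: "v \<in> \<tau> z x" "norm v = 1" for z x v
  proof -
    have "(z, x) \<in> W" using d4 d(5) zx(1) by auto
    then have "n (z, x) \<bullet> v = 0" using \<tau>W v zx by blast
    then have "n y0 \<bullet> v = (n y0 - n (z, x)) \<bullet> v" by (simp add: inner_diff_left)
    also have "\<bar>\<dots>\<bar> \<le> norm (n y0 - n (z, x)) * norm v" by (rule Cauchy_Schwarz_ineq2)
    also have "\<dots> \<le> e" using d3(2)[of "(z, x)"] d(4) zx(1) v by (auto simp: dist_commute dist_norm norm_minus_commute)
    finally have "\<bar>\<nu> \<bullet> v\<bar> \<le> e / norm (n y0)"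
      using n0 by (simp add: \<nu>_def abs_mult divide_right_mono)
    also have "\<dots> = \<epsilon> / (M * norm a + 1)" using n0 by (simp add: e_def)
    finally have "(M * norm a) * \<bar>\<nu> \<bullet> v\<bar> \<le> (M * norm a) * (\<epsilon> / (M * norm a + 1))"
      using M by (intro mult_left_mono) auto
    also have "\<dots> \<le> (M * norm a + 1) * (\<epsilon> / (M * norm a + 1))"
      using \<epsilon> Ma by (intro mult_right_mono) auto
    also have "\<dots> = \<epsilon>" using Ma by simp
    finally show ?thesis .
  qed
  moreover have "cball y0 d \<subseteq> interior cube \<times> interior cube"
    using d1(2) subset_cball[OF d(2)] by blast
  ultimately show ?thesis using d(1) \<nu> a
    by (intro exI[of _ d] exI[of _ \<nu>] exI[of _ a]) blast
qed

text \<open>Points outside the cube are fixed and the maps are bijective, so the cube is mapped onto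
  itself.\<close>

lemma smooth_isotopy_family:
  assumes F: "smooth_isotopy F Fi K" and K: "K \<subseteq> interior cube \<times> interior cube"
  shows "isotopy_family F"
proof -
  note FD = smooth_isotopyD[OF F]
  have in_cube: "F z t x \<in> cube" "Fi z t x \<in> cube" if "x \<in> cube" for z t x
  proof -
    have out: "F z t y = y" if "y \<notin> cube" for y
      using that K interior_subset[of cube] FD(6)[of z y t] by blast
    show "F z t x \<in> cube" using out[of "F z t x"] FD(3)[of z t] that by metis
    show "Fi z t x \<in> cube" using out[of "Fi z t x"] FD(4)[of z t] that by metis
  qed
  have inj: "inj_on (F z t) cube" for z t by (rule inj_on_inverseI[of _ "Fi z t"]) (rule FD(3))
  have bij: "bij_betw (F z t) cube cube" for z t
    unfolding bij_betw_def using inj in_cube FD(4) by (auto intro!: image_eqI[of _ "F z t" "Fi z t _"] simp: FD(4))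
  have "smooth_on cube (inv_into cube (F z t))" for z t
  proof -
    have "smooth (\<lambda>x::real^'b. ((z, t), x))" by (intro smooth_intros)
    from smooth_compose[OF FD(2) this] have "smooth (Fi z t)" by simp
    moreover have "Fi z t x = inv_into cube (F z t) x" if "x \<in> cube" for x
      using inv_into_f_eq[OF inj in_cube(2)[OF that] FD(4)] by simp
    ultimately show ?thesis unfolding smooth_on_def by (intro exI[of _ UNIV] exI[of _ "Fi z t"]) auto
  qed
  moreover have "smooth_on ((cube \<times> {0..1}) \<times> cube) (\<lambda>((z, t), x). F z t x)"
    unfolding smooth_on_def using FD(1)
    by (intro exI[of _ UNIV] exI[of _ "\<lambda>p. F (fst (fst p)) (snd (fst p)) (snd p)"]) auto
  ultimately show ?thesis unfolding isotopy_family_def using bij FD(5) by blast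
qed

text \<open>The largest index has m - 1 \<ge> k predecessors. Its coordinate vanishes on
  \<open>subcube k\<close>.\<close>

lemma exists_normal_coordinate:
  assumes "k < CARD('m::{finite,linorder})"
  shows "\<exists>i::'m. i \<notin> first_coords k"
proof -
  define m where "m = Max (UNIV :: 'm set)"
  have "x \<le> m" for x by (simp add: m_def)
  then have "{j. j < m} = UNIV - {m}" by (auto simp: less_le)
  then have "card {j. j < m} = CARD('m) - 1" by simp
  then show ?thesis using assms by (intro exI[of _ m]) (simp add: first_coords_def)
qed

lemma pderiv_slice: "smooth H \<Longrightarrow> pderiv \<alpha> (\<lambda>x. H (z, x)) x = DL (mlist \<alpha>) H (z, x)"
  by (simp add: pderiv_def Dlist_slice)

lemma sum_approx_mindex:
  assumes "sum_approx r E H J \<nu> a b y" and "mabs \<alpha> \<le> r"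
  shows "norm (DL (mlist \<alpha>) H y - (if mabs \<alpha> = r then \<Sum>j\<in>J. (b j * mpow (\<nu> j) \<alpha>) *\<^sub>R a j else 0)) < E"
  using assms(1)[unfolded sum_approx_def, rule_format, of "mlist \<alpha>"] assms(2)
  by (simp only: length_mlist prod_mlist)

text \<open>Contracting \<nu>^r with v produces the factor \<nu> \<bullet> v, so each term is small
  for v nearly orthogonal to \<nu>, whatever its coefficient within the bound. The first summand
  collects the errors of the m coordinate derivatives that make up the one along v.\<close>

lemma sum_approx_perp:
  fixes H :: "'z::real_normed_vector \<times> (real^'m::finite) \<Rightarrow> real^'n::finite"
  assumes approx: "sum_approx r E H J \<nu> a b y" and E: "E > 0" and \<alpha>: "mabs \<alpha> < r" and v: "norm v = 1" 
    and \<nu>: "\<And>j. j \<in> J \<Longrightarrow> norm (\<nu> j) = 1" and b: "\<And>j. j \<in> J \<Longrightarrow> \<bar>b j\<bar> \<le> B j"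
  shows "norm (jet_dir (\<lambda>\<alpha>. DL (mlist \<alpha>) H y) v \<alpha>) \<le> real CARD('m) * E + (\<Sum>j\<in>J. B j * norm (a j) * \<bar>\<nu> j \<bullet> v\<bar>)"
proof -
  define P where "P = (\<lambda>\<alpha>. if mabs \<alpha> = r then \<Sum>j\<in>J. (b j * mpow (\<nu> j) \<alpha>) *\<^sub>R a j else 0)"
  define X where "X = (\<lambda>\<alpha>. DL (mlist \<alpha>) H y)"
  have 1: "norm (X (madd1 \<alpha> i) - P (madd1 \<alpha> i)) \<le> E" for i
    using sum_approx_mindex[OF approx, of "madd1 \<alpha> i"] \<alpha> by (simp add: X_def P_def mabs_madd1)
  have B0: "B j \<ge> 0" if "j \<in> J" for j using b[OF that] by linarith
  have "norm (jet_dir P v \<alpha>) \<le> (\<Sum>j\<in>J. B j * norm (a j) * \<bar>\<nu> j \<bullet> v\<bar>)"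
  proof (cases "Suc (mabs \<alpha>) = r")
    case True
    have "jet_dir P v \<alpha> = (\<Sum>i\<in>UNIV. \<Sum>j\<in>J. ((b j * mpow (\<nu> j) \<alpha>) * (v $ i * \<nu> j $ i)) *\<^sub>R a j)"
      unfolding jet_dir_def P_def using True
      by (intro sum.cong) (auto simp: mabs_madd1 mpow_madd1 scaleR_sum_right mult_ac)
    also have "\<dots> = (\<Sum>j\<in>J. ((b j * mpow (\<nu> j) \<alpha>) * (\<nu> j \<bullet> v)) *\<^sub>R a j)"
      by (subst sum.swap) (simp add: inner_vec_def sum_distrib_left scaleR_left.sum mult_ac)
    also have "norm \<dots> \<le> (\<Sum>j\<in>J. B j * norm (a j) * \<bar>\<nu> j \<bullet> v\<bar>)"
    proof (rule order.trans[OF norm_sum], rule sum_mono)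
      fix j assume j: "j \<in> J"
      have "\<bar>b j\<bar> * \<bar>mpow (\<nu> j) \<alpha>\<bar> \<le> B j * 1"
        using b[OF j] abs_mpow_le_1[OF \<nu>[OF j]] B0[OF j] by (intro mult_mono) auto
      then have "(\<bar>b j\<bar> * \<bar>mpow (\<nu> j) \<alpha>\<bar>) * (norm (a j) * \<bar>\<nu> j \<bullet> v\<bar>) \<le> B j * (norm (a j) * \<bar>\<nu> j \<bullet> v\<bar>)"
        by (intro mult_right_mono) auto
      then show "norm (((b j * mpow (\<nu> j) \<alpha>) * (\<nu> j \<bullet> v)) *\<^sub>R a j) \<le> B j * norm (a j) * \<bar>\<nu> j \<bullet> v\<bar>"
        by (simp add: abs_mult mult_ac)
    qed
    finally show ?thesis .
  next
    case False
    then have "jet_dir P v \<alpha> = 0" by (simp add: jet_dir_def P_def mabs_madd1)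
    then show ?thesis using B0 by (simp add: sum_nonneg)
  qed
  moreover have "norm (jet_dir X v \<alpha> - jet_dir P v \<alpha>) \<le> real CARD('m) * E"
  proof -
    have "jet_dir X v \<alpha> - jet_dir P v \<alpha> = (\<Sum>i\<in>UNIV. v $ i *\<^sub>R (X (madd1 \<alpha> i) - P (madd1 \<alpha> i)))"
      by (simp add: jet_dir_def sum_subtractf[symmetric] scaleR_diff_right)
    also have "norm \<dots> \<le> (\<Sum>i\<in>(UNIV :: 'm set). E)"
    proof (rule order.trans[OF norm_sum], rule sum_mono)
      fix i
      have "\<bar>v $ i\<bar> * norm (X (madd1 \<alpha> i) - P (madd1 \<alpha> i)) \<le> 1 * E"
        using component_le_norm_cart[of v i] v 1[of i] by (intro mult_mono) auto
      then show "norm (v $ i *\<^sub>R (X (madd1 \<alpha> i) - P (madd1 \<alpha> i))) \<le> E" by simp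
    qed
    finally show ?thesis by simp
  qed
  ultimately show ?thesis
    using norm_triangle_ineq[of "jet_dir X v \<alpha> - jet_dir P v \<alpha>" "jet_dir P v \<alpha>"] by (simp add: X_def)
qed

theorem mainTheorem10:
  fixes k r :: nat
    and \<tau> :: "real^'q::finite \<Rightarrow> (real,'m::{finite,linorder}) vec \<Rightarrow> ((real,'m) vec) set"
    and \<sigma> :: "real^'q \<Rightarrow> (real,'m) vec \<Rightarrow> ('m,'n::finite) jet"
  assumes "k < CARD('m)" and "r \<ge> 1"
    and "smooth_hyperplane_family \<tau>"
    and "smooth_section_family r \<sigma>"
    and "\<forall>z\<in>cube. \<exists>U. open U \<and> frontier (cube :: ((real,'m) vec) set) \<subseteq> U \<and>
                 (\<forall>x\<in>U \<inter> cube. jet_zero r (\<sigma> z x))"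
    and "\<forall>z\<in>cube. \<forall>x\<in>cube. perp_zero r (\<tau> z x) (\<sigma> z x)"
    and "\<exists>V. open V \<and> frontier (cube :: (real^'q) set) \<subseteq> V \<and>
            (\<forall>z\<in>V \<inter> cube. \<forall>x\<in>cube. jet_zero r (\<sigma> z x))"
  shows "\<forall>\<epsilon>>0. \<exists>(F :: real^'q \<Rightarrow> real \<Rightarrow> (real,'m) vec \<Rightarrow> (real,'m) vec) (\<sigma>' :: real^'q \<Rightarrow> (real,'m) vec \<Rightarrow> ('m,'n) jet).
     isotopy_family F \<and> smooth_section_family r \<sigma>' \<and>
     (\<forall>z\<in>cube. holonomic r (\<sigma>' z)) \<and>
     (\<forall>z\<in>cube. \<exists>U. open U \<and> F z 1 ` subcube k \<subseteq> U \<and>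
         (\<forall>x\<in>U \<inter> cube. jet_close r \<epsilon> (\<sigma>' z x) (\<sigma> z x))) \<and>
     (\<forall>z\<in>cube. \<forall>x\<in>cube. perp_small r \<epsilon> (\<tau> z x) (\<sigma>' z x)) \<and>
     (\<forall>z\<in>cube. \<forall>t\<in>{0..1}. \<forall>x\<in>cube. dist (F z t x) x < \<epsilon>) \<and>
     (\<forall>z\<in>cube. \<exists>U. open U \<and> frontier (cube :: ((real,'m) vec) set) \<subseteq> U \<and>
         (\<forall>x\<in>U \<inter> cube. (\<forall>t\<in>{0..1}. F z t x = x) \<and> jet_zero r (\<sigma>' z x))) \<and>
     (\<exists>V. open V \<and> frontier (cube :: (real^'q) set) \<subseteq> V \<and>
         (\<forall>z\<in>V \<inter> cube. \<forall>x\<in>cube. (\<forall>t\<in>{0..1}. F z t x = x) \<and> jet_zero r (\<sigma>' z x)))"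
proof (intro allI impI)
  fix \<epsilon> :: real assume \<epsilon>: "\<epsilon> > 0"
  \<comment> \<open>Closeness will cost E + 2\<delta>, the perpendicular part m E + \<delta>;
    quarters of \<epsilon> leave room for both.\<close>
  define \<delta> where "\<delta> = \<epsilon> / 4"
  have \<delta>: "\<delta> > 0" using \<epsilon> by (simp add: \<delta>_def)
  define E where "E = (\<epsilon> / 4) / (real CARD('m) + 1)"
  have E: "E > 0" "real CARD('m) * E < \<epsilon> / 4" "E \<le> \<epsilon> / 4"
  proof -
    show "E > 0" using \<epsilon> by (simp add: E_def)
    have eq: "(real CARD('m) + 1) * E = \<epsilon> / 4"
    proof -
      have "c * (x / c) = x" if "c \<noteq> 0" for c x :: real using that by simp
      then show ?thesis unfolding E_def by (metis of_nat_0_le_iff add_nonneg_pos less_numeral_extra(1) less_irrefl)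
    qed
    have "real CARD('m) * E \<ge> 0" using \<open>E > 0\<close> by simp
    with eq show "real CARD('m) * E < \<epsilon> / 4" "E \<le> \<epsilon> / 4"
      using \<open>E > 0\<close> unfolding distrib_right by linarith+
  qed
  obtain M where M: "\<And>t. \<bar>(deriv ^^ r) (saw r) t\<bar> \<le> M" using saw_deriv_bounded by blast
  have M0: "M \<ge> 0" using M[of 0] by linarith
  obtain i0 :: 'm where i0: "i0 \<notin> first_coords k" using exists_normal_coordinate[OF assms(1)] by blast
  define Q where "Q = (cube :: (real^'q) set) \<times> (cube :: ((real,'m) vec) set)"
  define U where "U = interior (cube :: (real^'q) set) \<times> interior (cube :: ((real,'m) vec) set)"
  have U: "open U" unfolding U_def by (intro open_Times open_interior)
  have Q: "compact Q" unfolding Q_def by (intro compact_Times compact_cube)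
  have UQ: "U \<subseteq> Q" unfolding U_def Q_def by (intro Sigma_mono interior_subset)
  define S where "S = (\<lambda>y. \<sigma> (fst y) (snd y))"
  have S_cont: "continuous_on Q (\<lambda>y. S y \<alpha>)" if "mabs \<alpha> \<le> r" for \<alpha>
    using assms(4) that unfolding smooth_section_family_def S_def Q_def
    by (auto dest!: smooth_on_imp_continuous_on simp: case_prod_beta')
  have S_perp: "perp_zero r (\<tau> (fst y) (snd y)) (S y)" if "y \<in> Q" for y
    using assms(6) that by (auto simp: S_def Q_def)
  \<comment> \<open>Terms are placed only where some jet entry has size at least \<delta>. As
    \<sigma> vanishes on the boundary in x and in z, this compact set lies in the open product of
    cubes; elsewhere zero approximates \<sigma> well enough.\<close>
  define K where "K = (\<Union>\<alpha>\<in>{\<alpha>. mabs \<alpha> \<le> r}. {y \<in> Q. \<delta> \<le> norm (S y \<alpha>)})"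
  have "closed {y \<in> Q. \<delta> \<le> norm (S y \<alpha>)}" if "mabs \<alpha> \<le> r" for \<alpha>
    using S_cont[OF that] compact_imp_closed[OF Q]
    by (intro continuous_on_closed_Collect_le continuous_on_norm continuous_on_const)
  then have "closed K" unfolding K_def using finite_mindices by (intro closed_UN) auto
  moreover have KQ: "K \<subseteq> Q" by (auto simp: K_def)
  ultimately have K: "compact K" using Q compact_Int_closed[of Q K] by (simp add: Int_absorb1)
  have KU: "K \<subseteq> U"
  proof
    fix y assume y: "y \<in> K"
    then obtain \<alpha> where \<alpha>: "mabs \<alpha> \<le> r" "\<delta> \<le> norm (S y \<alpha>)" and yQ: "y \<in> Q" by (auto simp: K_def)
    then have nz: "\<not> jet_zero r (\<sigma> (fst y) (snd y))" using \<delta> by (auto simp: jet_zero_def S_def)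
    have zx: "fst y \<in> cube" "snd y \<in> cube" using yQ by (auto simp: Q_def)
    have "fst y \<notin> frontier cube" using assms(7) nz zx by blast
    moreover have "snd y \<notin> frontier cube" using assms(5) nz zx by blast
    ultimately show "y \<in> U" using frontier_cube[OF zx(1)] frontier_cube[OF zx(2)] by (simp add: U_def mem_Times_iff)
  qed
  define P where "P = (\<lambda>y d \<nu> a. d > 0 \<and> cball y d \<subseteq> U \<and> norm \<nu> = 1 \<and>
    (\<forall>\<alpha>. mabs \<alpha> = r \<longrightarrow> S y \<alpha> = mpow \<nu> \<alpha> *\<^sub>R a) \<and>
    (\<forall>z x. (z, x) \<in> ball y d \<longrightarrow> (z, x) \<in> Q \<longrightarrow>
      (\<forall>\<alpha>. mabs \<alpha> \<le> r \<longrightarrow> norm (S y \<alpha> - \<sigma> z x \<alpha>) < \<delta>) \<and>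
      (\<forall>v\<in>\<tau> z x. norm v = 1 \<longrightarrow> M * norm a * \<bar>\<nu> \<bullet> v\<bar> \<le> \<delta>)))"
  have "\<exists>d \<nu> a. P y d \<nu> a" if "y \<in> K" for y
  proof -
    have c: "\<forall>\<alpha>. mabs \<alpha> \<le> r \<longrightarrow> continuous_on (cube \<times> cube) (\<lambda>(z, x). \<sigma> z x \<alpha>)"
      using S_cont unfolding S_def Q_def by (simp add: case_prod_beta')
    have "y \<in> interior cube \<times> interior cube" using that KU by (auto simp: U_def)
    from local_data[OF assms(2,3) c assms(6) \<delta> M0 this]
    show ?thesis unfolding P_def S_def Q_def U_def .
  qed
  then obtain d \<nu> a where P: "\<And>y. y \<in> K \<Longrightarrow> P y (d y) (\<nu> y) (a y)" by metis
  have dpos: "d y > 0" and dU: "cball y (d y) \<subseteq> U" and \<nu>1: "norm (\<nu> y) = 1" 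
    and Sa: "\<And>\<alpha>. mabs \<alpha> = r \<Longrightarrow> S y \<alpha> = mpow (\<nu> y) \<alpha> *\<^sub>R a y" if "y \<in> K" for y
    using P[OF that] unfolding P_def by blast+
  have near: "norm (S c \<alpha> - S y \<alpha>) < \<delta>" if "c \<in> K" "y \<in> Q" "y \<in> ball c (d c)" "mabs \<alpha> \<le> r" for c y \<alpha>
    using P[OF that(1)] that unfolding P_def S_def by (metis prod.collapse)
  have angle: "M * norm (a c) * \<bar>\<nu> c \<bullet> v\<bar> \<le> \<delta>" 
    if "c \<in> K" "(z, x) \<in> Q" "(z, x) \<in> ball c (d c)" "v \<in> \<tau> z x" "norm v = 1" for c z x v
    using P[OF that(1)] that unfolding P_def by blast
  from ball_partition[OF K, of d] dpos
  obtain Y \<rho> where Y: "finite Y" "Y \<subseteq> K" and \<rho>: "\<forall>c\<in>Y. smooth (\<rho> c)" "\<forall>c\<in>Y. \<forall>y. \<rho> c y \<ge> 0"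
     "\<forall>c\<in>Y. \<forall>y. y \<notin> ball c (d c) \<longrightarrow> \<rho> c y = 0" "\<forall>y. (\<Sum>c\<in>Y. \<rho> c y) \<le> 1"
     "\<forall>y\<in>K. (\<Sum>c\<in>Y. \<rho> c y) = (1::real)" by blast
  have YK: "c \<in> K" if "c \<in> Y" for c using that Y by blast
  \<comment> \<open>Where the weights do not sum to 1 the point is outside K, so the missing part (1
    - s) S is at most \<delta>; the other \<delta> is the oscillation of \<sigma> on the
    balls.\<close>
  have approx_S: "norm ((\<Sum>c\<in>Y. \<rho> c y *\<^sub>R S c \<alpha>) - S y \<alpha>) \<le> 2 * \<delta>" if y: "y \<in> Q" and \<alpha>: "mabs \<alpha> \<le> r" for y \<alpha>
  proof -
    define s where "s = (\<Sum>c\<in>Y. \<rho> c y)"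
    have "0 \<le> s" unfolding s_def using \<rho>(2) by (intro sum_nonneg) blast
    moreover have "s \<le> 1" unfolding s_def using \<rho>(4) by blast
    ultimately have s: "0 \<le> s" "s \<le> 1" .
    have eq: "(\<Sum>c\<in>Y. \<rho> c y *\<^sub>R S c \<alpha>) - S y \<alpha> = (\<Sum>c\<in>Y. \<rho> c y *\<^sub>R (S c \<alpha> - S y \<alpha>)) - (1 - s) *\<^sub>R S y \<alpha>"
      by (simp add: s_def scaleR_diff_right scaleR_diff_left sum_subtractf scaleR_sum_left)
    have "norm (\<Sum>c\<in>Y. \<rho> c y *\<^sub>R (S c \<alpha> - S y \<alpha>)) \<le> (\<Sum>c\<in>Y. \<rho> c y * \<delta>)"
    proof (rule order.trans[OF norm_sum], rule sum_mono)
      fix c assume c: "c \<in> Y"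
      show "norm (\<rho> c y *\<^sub>R (S c \<alpha> - S y \<alpha>)) \<le> \<rho> c y * \<delta>"
      proof (cases "y \<in> ball c (d c)")
        case True
        then show ?thesis using near[OF YK[OF c] y True \<alpha>] \<rho>(2)[rule_format, OF c, of y] by (simp add: mult_left_mono)
      next
        case False
        then have "\<rho> c y = 0" using \<rho>(3) c by blast
        then show ?thesis by simp
      qed
    qed
    also have "\<dots> = s * \<delta>" by (simp add: s_def sum_distrib_right)
    also have "\<dots> \<le> \<delta>" using s \<delta> by simp
    finally have 1: "norm (\<Sum>c\<in>Y. \<rho> c y *\<^sub>R (S c \<alpha> - S y \<alpha>)) \<le> \<delta>" .
    have 2: "norm ((1 - s) *\<^sub>R S y \<alpha>) \<le> \<delta>"
    proof (cases "y \<in> K")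
      case True
      then have "s = 1" unfolding s_def using \<rho>(5) by blast
      then show ?thesis using \<delta> by simp
    next
      case False
      then have lt: "norm (S y \<alpha>) < \<delta>" using y \<alpha> by (force simp: K_def)
      have "(1 - s) * norm (S y \<alpha>) \<le> 1 * \<delta>" using s lt by (intro mult_mono) auto
      then show ?thesis using s by simp
    qed
    show ?thesis unfolding eq
      using norm_triangle_ineq4[of "\<Sum>c\<in>Y. \<rho> c y *\<^sub>R (S c \<alpha> - S y \<alpha>)" "(1 - s) *\<^sub>R S y \<alpha>"] 1 2 by linarith
  qed
  have ind: "\<forall>j\<in>Y. compact (cball j (d j))" "\<forall>j\<in>Y. \<forall>y. y \<notin> cball j (d j) \<longrightarrow> \<rho> j y = 0"
    "\<forall>j\<in>Y. cball j (d j) \<subseteq> U" "\<forall>j\<in>Y. norm (\<nu> j) = 1"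
    using \<rho>(3) dU \<nu>1 YK ball_subset_cball by (simp, blast, blast, blast)
  from rank_one_induction[OF Y(1) \<rho>(1,2) ind(1-3) U ind(4) E(1) M Q, of a i0]
  obtain F Fi L H where F: "smooth_isotopy F Fi L" and L: "compact L" "L \<subseteq> U" 
    and F_small: "\<forall>z t x. norm (F z t x - x) < E" and H: "smooth H" "\<forall>y. y \<notin> L \<longrightarrow> H y = 0"
    and H_perp: "\<forall>y. \<exists>b. (\<forall>j\<in>Y. \<bar>b j\<bar> \<le> M * \<rho> j y) \<and> sum_approx r E H Y \<nu> a b y"
    and H_close: "\<forall>z x. (z, x) \<in> Q \<longrightarrow> x $ i0 = 0 \<longrightarrow> sum_approx r E H Y \<nu> a (\<lambda>j. \<rho> j (z, F z 1 x)) (z, F z 1 x)"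
    by (elim exE conjE)
  note FD = smooth_isotopyD[OF F]
  define \<sigma>' where "\<sigma>' = (\<lambda>z x \<alpha>. pderiv \<alpha> (\<lambda>x. H (z, x)) x)"
  have \<sigma>': "\<sigma>' z x \<alpha> = DL (mlist \<alpha>) H (z, x)" for z x \<alpha>
    unfolding \<sigma>'_def by (rule pderiv_slice[OF H(1)])
  have iso: "isotopy_family F" using smooth_isotopy_family[OF F] L(2) unfolding U_def by blast
  have sec: "smooth_section_family r \<sigma>'"
    unfolding smooth_section_family_def smooth_on_def \<sigma>'
    by (intro allI impI exI[of _ UNIV] exI[of _ "DL (mlist \<alpha>) H" for \<alpha>]) (auto intro: smooth_DL[OF H(1)])
  have hol: "\<forall>z\<in>cube. holonomic r (\<sigma>' z)"
  proof
    fix z :: "real^'q" 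
    have s: "smooth (\<lambda>x. H (z, x))" by (rule smooth_slice[OF H(1)])
    show "holonomic r (\<sigma>' z)"
      unfolding holonomic_def smooth_on_def \<sigma>'_def
      by (rule exI[of _ "\<lambda>x. H (z, x)"]) (use s in \<open>auto intro!: exI[of _ UNIV] exI[of _ "\<lambda>x. H (z, x)"]\<close>)
  qed
  have close: "jet_close r \<epsilon> (\<sigma>' z (F z 1 x)) (\<sigma> z (F z 1 x))"
    if z: "z \<in> cube" and x: "x \<in> subcube k" for z x
    unfolding jet_close_def
  proof (intro allI impI)
    fix \<alpha> :: "'m mindex" assume \<alpha>: "mabs \<alpha> \<le> r"
    have xc: "x \<in> cube" "x $ i0 = 0" using x i0 by (auto simp: subcube_def)
    have "bij_betw (F z 1) cube cube" using iso z by (simp add: isotopy_family_def)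
    then have "F z 1 x \<in> cube" using xc bij_betwE by blast
    let ?y = "(z, F z 1 x)"
    have yQ: "?y \<in> Q" using z \<open>F z 1 x \<in> cube\<close> by (simp add: Q_def)
    have "sum_approx r E H Y \<nu> a (\<lambda>j. \<rho> j ?y) ?y" using H_close z xc by (simp add: Q_def)
    from sum_approx_mindex[OF this \<alpha>]
    have 1: "norm (\<sigma>' z (F z 1 x) \<alpha> - (if mabs \<alpha> = r then \<Sum>c\<in>Y. (\<rho> c ?y * mpow (\<nu> c) \<alpha>) *\<^sub>R a c else 0)) < E"
      by (simp add: \<sigma>')
    have 2: "norm ((if mabs \<alpha> = r then \<Sum>c\<in>Y. (\<rho> c ?y * mpow (\<nu> c) \<alpha>) *\<^sub>R a c else 0) - \<sigma> z (F z 1 x) \<alpha>) \<le> 2 * \<delta>"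
    proof (cases "mabs \<alpha> = r")
      case True
      have "(\<Sum>c\<in>Y. (\<rho> c ?y * mpow (\<nu> c) \<alpha>) *\<^sub>R a c) = (\<Sum>c\<in>Y. \<rho> c ?y *\<^sub>R S c \<alpha>)"
        using Sa[OF YK True] by (intro sum.cong) auto
      then show ?thesis using approx_S[OF yQ \<alpha>] True by (simp add: S_def)
    next
      case False
      then have "S ?y \<alpha> = 0" using S_perp[OF yQ] \<alpha> by (auto simp: perp_zero_def)
      then show ?thesis using False \<delta> by (simp add: S_def)
    qed
    have "E + 2 * \<delta> < \<epsilon>" using E(3) \<epsilon> by (simp add: \<delta>_def)
    then show "norm (\<sigma>' z (F z 1 x) \<alpha> - \<sigma> z (F z 1 x) \<alpha>) < \<epsilon>"
      using norm_diff_triangle_less[OF 1 order_le_less_trans[OF 2, of "\<epsilon> - E"]] by simp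
  qed
  have close': "\<forall>z\<in>cube. \<exists>V. open V \<and> F z 1 ` subcube k \<subseteq> V \<and> 
      (\<forall>x\<in>V \<inter> cube. jet_close r \<epsilon> (\<sigma>' z x) (\<sigma> z x))"
  proof
    fix z :: "real^'q" assume z: "z \<in> cube"
    \<comment> \<open>Continuity of \<sigma> is available on the cube, so closeness defines a
      relatively open set; finitely many multiindices give an intersection of the cube with an open
      V.\<close>
    have "openin (top_of_set cube) {x \<in> cube. norm (\<sigma>' z x \<alpha> - \<sigma> z x \<alpha>) < \<epsilon>}" if \<alpha>: "mabs \<alpha> \<le> r" for \<alpha>
    proof -
      have "continuous_on cube (\<lambda>x. S (z, x) \<alpha>)"
        by (rule continuous_on_compose2[OF S_cont[OF \<alpha>]]) (use z in \<open>auto simp: Q_def intro!: continuous_intros\<close>)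
      moreover have "continuous_on cube (\<lambda>x. \<sigma>' z x \<alpha>)"
        unfolding \<sigma>' by (rule smooth_continuous[OF smooth_slice[OF smooth_DL[OF H(1)]]])
      ultimately have "continuous_on cube (\<lambda>x. norm (\<sigma>' z x \<alpha> - \<sigma> z x \<alpha>))"
        unfolding S_def fst_conv snd_conv by (intro continuous_intros)
      from continuous_openin_preimage_gen[OF this open_lessThan[of \<epsilon>]]
      show ?thesis by (simp add: vimage_def Int_def)
    qed
    then have "openin (top_of_set cube) (\<Inter>\<alpha>\<in>{\<alpha>. mabs \<alpha> \<le> r}. {x \<in> cube. norm (\<sigma>' z x \<alpha> - \<sigma> z x \<alpha>) < \<epsilon>})"
      by (intro openin_INT2 finite_mindices) (auto intro!: exI[of _ "\<lambda>_. 0"] simp: mabs_def)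
    then obtain V where V: "open V" 
      "(\<Inter>\<alpha>\<in>{\<alpha>. mabs \<alpha> \<le> r}. {x \<in> cube. norm (\<sigma>' z x \<alpha> - \<sigma> z x \<alpha>) < \<epsilon>}) = cube \<inter> V"
      unfolding openin_open by blast
    have mem: "x \<in> V \<longleftrightarrow> jet_close r \<epsilon> (\<sigma>' z x) (\<sigma> z x)" if "x \<in> cube" for x
    proof -
      have "x \<in> V \<longleftrightarrow> x \<in> cube \<inter> V" using that by blast
      also have "\<dots> \<longleftrightarrow> jet_close r \<epsilon> (\<sigma>' z x) (\<sigma> z x)"
        unfolding V(2)[symmetric] jet_close_def using that by blast
      finally show ?thesis .
    qed
    have "F z 1 ` subcube k \<subseteq> V"
    proof
      fix y assume "y \<in> F z 1 ` subcube k"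
      then obtain x where x: "x \<in> subcube k" "y = F z 1 x" by blast
      have "bij_betw (F z 1) cube cube" using iso z by (simp add: isotopy_family_def)
      then have "y \<in> cube" using x bij_betwE by (fastforce simp: subcube_def)
      then show "y \<in> V" using mem close[OF z x(1)] x(2) by blast
    qed
    then show "\<exists>V. open V \<and> F z 1 ` subcube k \<subseteq> V \<and> (\<forall>x\<in>V \<inter> cube. jet_close r \<epsilon> (\<sigma>' z x) (\<sigma> z x))"
      using V(1) mem by blast
  qed
  have perp: "perp_small r \<epsilon> (\<tau> z x) (\<sigma>' z x)" if z: "z \<in> cube" and x: "x \<in> cube" for z x
    unfolding perp_small_def
  proof (intro allI impI conjI ballI)
    fix \<alpha> :: "'m mindex" assume \<alpha>: "mabs \<alpha> < r"
    have zx: "(z, x) \<in> Q" using z x by (simp add: Q_def)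
    obtain b where b: "\<forall>j\<in>Y. \<bar>b j\<bar> \<le> M * \<rho> j (z, x)" "sum_approx r E H Y \<nu> a b (z, x)"
      using H_perp by blast
    have "norm (\<sigma>' z x \<alpha>) < E" using sum_approx_mindex[OF b(2), of \<alpha>] \<alpha> by (simp add: \<sigma>')
    then show "norm (\<sigma>' z x \<alpha>) < \<epsilon>" using E(3) \<epsilon> by simp
    fix v assume v: "v \<in> \<tau> z x" "norm v = 1"
    \<comment> \<open>Of the coefficients only |b| \<le> M \<rho> is known here. Weighted by the
      partition, the bounds M |a| |\<nu> \<bullet> v| \<le> \<delta> add up to at most
      \<delta>.\<close>
    have "norm (jet_dir (\<sigma>' z x) v \<alpha>) \<le> real CARD('m) * E + (\<Sum>c\<in>Y. M * \<rho> c (z, x) * norm (a c) * \<bar>\<nu> c \<bullet> v\<bar>)"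
      unfolding \<sigma>'[abs_def] using ind(4) b(1) by (intro sum_approx_perp[OF b(2) E(1) \<alpha> v(2)]) auto
    also have "(\<Sum>c\<in>Y. M * \<rho> c (z, x) * norm (a c) * \<bar>\<nu> c \<bullet> v\<bar>) \<le> (\<Sum>c\<in>Y. \<rho> c (z, x) * \<delta>)"
    proof (rule sum_mono)
      fix c assume c: "c \<in> Y"
      show "M * \<rho> c (z, x) * norm (a c) * \<bar>\<nu> c \<bullet> v\<bar> \<le> \<rho> c (z, x) * \<delta>"
      proof (cases "(z, x) \<in> ball c (d c)")
        case True
        have "\<rho> c (z, x) * (M * norm (a c) * \<bar>\<nu> c \<bullet> v\<bar>) \<le> \<rho> c (z, x) * \<delta>"
          using angle[OF YK[OF c] zx True v] \<rho>(2)[rule_format, OF c] by (intro mult_left_mono)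
        then show ?thesis by (simp add: mult_ac)
      next
        case False
        then have "\<rho> c (z, x) = 0" using \<rho>(3) c by blast
        then show ?thesis by simp
      qed
    qed
    also have "\<dots> = (\<Sum>c\<in>Y. \<rho> c (z, x)) * \<delta>" by (simp add: sum_distrib_right)
    also have "\<dots> \<le> 1 * \<delta>" using \<rho>(4)[rule_format, of "(z, x)"] \<delta> by (intro mult_right_mono) auto
    finally show "norm (jet_dir (\<sigma>' z x) v \<alpha>) < \<epsilon>" using E(2) \<epsilon> by (simp add: \<delta>_def)
  qed
  have small: "dist (F z t x) x < \<epsilon>" for z t x
    using F_small[rule_format, of z t x] E(3) \<epsilon> by (simp add: dist_norm)
  have trivial: "F z t x = x" "jet_zero r (\<sigma>' z x)" if "(z, x) \<notin> L" for z t x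
  proof -
    show "F z t x = x" by (rule FD(6)[OF that])
    have "DL (mlist \<alpha>) H (z, x) = 0" for \<alpha>
      using DL_vanish[of "- L" H "(z, x)" "mlist \<alpha>"] H(2) L(1) that compact_imp_closed by blast
    then show "jet_zero r (\<sigma>' z x)" by (simp add: jet_zero_def \<sigma>')
  qed
  have bdry_x: "\<forall>z\<in>cube. \<exists>V. open V \<and> frontier (cube :: ((real,'m) vec) set) \<subseteq> V \<and>
      (\<forall>x\<in>V \<inter> cube. (\<forall>t\<in>{0..1}. F z t x = x) \<and> jet_zero r (\<sigma>' z x))"
  proof
    fix z :: "real^'q"
    \<comment> \<open>Outside the compact set L both isotopy and jet are trivial. The complement of
      its projection is open and contains the frontier, since L lies in the product of the
      interiors.\<close>
    have "open (- (snd ` L))"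
      using L(1) by (intro open_Compl compact_imp_closed compact_continuous_image continuous_intros)
    moreover have "frontier (cube :: ((real,'m) vec) set) \<subseteq> - (snd ` L)"
      using L(2) by (auto simp: U_def frontier_def)
    moreover have "(z, x) \<notin> L" if "x \<in> - (snd ` L)" for x using that by force
    ultimately show "\<exists>V. open V \<and> frontier (cube :: ((real,'m) vec) set) \<subseteq> V \<and>
      (\<forall>x\<in>V \<inter> cube. (\<forall>t\<in>{0..1}. F z t x = x) \<and> jet_zero r (\<sigma>' z x))"
      using trivial by (intro exI[of _ "- (snd ` L)"]) blast
  qed
  have bdry_z: "\<exists>V. open V \<and> frontier (cube :: (real^'q) set) \<subseteq> V \<and>
      (\<forall>z\<in>V \<inter> cube. \<forall>x\<in>cube. (\<forall>t\<in>{0..1}. F z t x = x) \<and> jet_zero r (\<sigma>' z x))"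
  proof -
    have "open (- (fst ` L))"
      using L(1) by (intro open_Compl compact_imp_closed compact_continuous_image continuous_intros)
    moreover have "frontier (cube :: (real^'q) set) \<subseteq> - (fst ` L)"
      using L(2) by (auto simp: U_def frontier_def)
    moreover have "(z, x) \<notin> L" if "z \<in> - (fst ` L)" for z x using that by force
    ultimately show ?thesis
      using trivial by (intro exI[of _ "- (fst ` L)"]) blast
  qed
  show "\<exists>F \<sigma>'. isotopy_family F \<and> smooth_section_family r \<sigma>' \<and>
     (\<forall>z\<in>cube. holonomic r (\<sigma>' z)) \<and>
     (\<forall>z\<in>cube. \<exists>U. open U \<and> F z 1 ` subcube k \<subseteq> U \<and>
         (\<forall>x\<in>U \<inter> cube. jet_close r \<epsilon> (\<sigma>' z x) (\<sigma> z x))) \<and>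
     (\<forall>z\<in>cube. \<forall>x\<in>cube. perp_small r \<epsilon> (\<tau> z x) (\<sigma>' z x)) \<and>
     (\<forall>z\<in>cube. \<forall>t\<in>{0..1}. \<forall>x\<in>cube. dist (F z t x) x < \<epsilon>) \<and>
     (\<forall>z\<in>cube. \<exists>U. open U \<and> frontier (cube :: ((real,'m) vec) set) \<subseteq> U \<and>
         (\<forall>x\<in>U \<inter> cube. (\<forall>t\<in>{0..1}. F z t x = x) \<and> jet_zero r (\<sigma>' z x))) \<and>
     (\<exists>V. open V \<and> frontier (cube :: (real^'q) set) \<subseteq> V \<and>
         (\<forall>z\<in>V \<inter> cube. \<forall>x\<in>cube. (\<forall>t\<in>{0..1}. F z t x = x) \<and> jet_zero r (\<sigma>' z x)))"
    by (intro exI[of _ F] exI[of _ \<sigma>'] conjI iso sec hol close' bdry_x bdry_z ballI perp small)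
qed

end
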